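(* Let $\Delta$ be a thick irreducible spherical building of rank at least $2$ whose Coxeter diagram is simply laced (i.e. of type $\mathsf{A}_n$ ($n\ge 2$), $\mathsf{D}_n$ ($n\ge 4$), $\mathsf{E}_6$, $\mathsf{E}_7$ or $\mathsf{E}_8$), and let $\theta$ be an automorphism of $\Delta$ (equivalently, an automorphism of its long root subgroup geometry). Then $\theta$ is uniclass if and only if $\theta$ is a polar $\{1,2'\}$-kangaroo, i.e. no point $x$ of the long root subgroup geometry is mapped to a point $x^\theta$ at distance $1$ or at distance $2'$ (codistance $1$) from $x$.
   Context: Let $(\Delta,\delta)$ be a building with Coxeter system $(W,S)$ and Weyl distance $\delta$. For an automorphism $\theta$ of $\Delta$ (not necessarily type preserving) the companion automorphism $\sigma$ of the Coxeter graph is defined by $\delta(C^\theta,D^\theta)=\delta(C,D)^\sigma$. The displacement spectrum is $\mathrm{disp}(\theta)=\{\delta(C,C^\theta): C \text{ a chamber}\}$. A $\sigma$-conjugacy class in $W$ is a set $\{v^{-1}wv^\sigma : v\in W\}$. The automorphism $\theta$ is uniclass if $\mathrm{disp}(\theta)$ is contained in a single $\sigma$-conjugacy class. The long root subgroup geometry $\Gamma$ of $\Delta$ is the point-line geometry whose points are the vertices of polar type (the simple roots not perpendicular to the highest root; with Bourbaki labelling: the incident point–hyperplane pairs of the projective space for $\mathsf{A}_n$, the lines of the polar space for $\mathsf{D}_n$, and the vertices of type $2$, $1$, $8$ for $\mathsf{E}_6,\mathsf{E}_7,\mathsf{E}_8$ respectively), lines being given by panels of cotype in the polar type. It is a parapolar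 space of diameter $3$; a symplecton (symp) is a convex subspace isomorphic to a polar space. For two points $x,y$ of $\Gamma$ their mutual position is: $0$ if $x=y$; $1$ if they are distinct and collinear; $2$ if non-collinear but contained in a common symp; $2'$ if non-collinear with exactly one point collinear to both; $3$ if at distance $3$ in the collinearity graph (equivalently, opposite in the building). For $D\subseteq\{0,1,2,2',3\}$, an automorphism $\theta$ is a polar $D$-kangaroo if for every point $x$ of $\Gamma$ the mutual position of $x$ and $x^\theta$ is not in $D$. *)

theory Defs
  imports Complex_Main "HOL-Algebra.Multiplicative_Group" "HOL-Algebra.Generated_Groups"
begin

section \<open>Coxeter systems\<close>

definition wprod :: "('w, 'b) monoid_scheme \<Rightarrow> 'w list \<Rightarrow> 'w" where
  "wprod G ws = foldr (\<lambda>a b. a \<otimes>\<^bsub>G\<^esub> b) ws \<one>\<^bsub>G\<^esub>"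

text \<open>Word length with respect to the generating set S.\<close>
definition wlen :: "('w, 'b) monoid_scheme \<Rightarrow> 'w set \<Rightarrow> 'w \<Rightarrow> nat" where
  "wlen G S w = (LEAST n. \<exists>ws. length ws = n \<and> set ws \<subseteq> S \<and> wprod G ws = w)"

text \<open>Coxeter system, via the (Bourbaki) characterisation by the exchange condition.\<close>
definition coxeter_system :: "('w, 'b) monoid_scheme \<Rightarrow> 'w set \<Rightarrow> bool" where
  "coxeter_system G S \<longleftrightarrow> group G \<and> S \<subseteq> carrier G \<and> \<one>\<^bsub>G\<^esub> \<notin> S \<and>
     (\<forall>s\<in>S. s \<otimes>\<^bsub>G\<^esub> s = \<one>\<^bsub>G\<^esub>) \<and>
     (\<forall>w\<in>carrier G. \<exists>ws. set ws \<subseteq> S \<and> wprod G ws = w) \<and>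
     (\<forall>ws s. set ws \<subseteq> S \<and> s \<in> S \<and> length ws = wlen G S (wprod G ws) \<and>
        wlen G S (s \<otimes>\<^bsub>G\<^esub> wprod G ws) \<le> wlen G S (wprod G ws) \<longrightarrow>
        (\<exists>i < length ws. s \<otimes>\<^bsub>G\<^esub> wprod G ws = wprod G (take i ws @ drop (Suc i) ws)))"

text \<open>Coxeter matrix entry m(s,t) = order of st.\<close>
definition cox_m :: "('w, 'b) monoid_scheme \<Rightarrow> 'w \<Rightarrow> 'w \<Rightarrow> nat" where
  "cox_m G s t = group.ord G (s \<otimes>\<^bsub>G\<^esub> t)"

definition spherical :: "('w, 'b) monoid_scheme \<Rightarrow> 'w set \<Rightarrow> bool" where
  "spherical G S \<longleftrightarrow> finite (carrier G)"

text \<open>Connected Coxeter graph (edges between s,t with m(s,t) >= 3).\<close>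
definition irreducible_cox :: "('w, 'b) monoid_scheme \<Rightarrow> 'w set \<Rightarrow> bool" where
  "irreducible_cox G S \<longleftrightarrow>
     (\<forall>s\<in>S. \<forall>t\<in>S. (s, t) \<in> {(a, b). a \<in> S \<and> b \<in> S \<and> cox_m G a b \<ge> 3}\<^sup>*)"

definition simply_laced :: "('w, 'b) monoid_scheme \<Rightarrow> 'w set \<Rightarrow> bool" where
  "simply_laced G S \<longleftrightarrow> (\<forall>s\<in>S. \<forall>t\<in>S. s \<noteq> t \<longrightarrow> cox_m G s t \<in> {2, 3})"

section \<open>Root system (Tits geometric representation) and polar type\<close>

definition simple_root :: "'w \<Rightarrow> 'w \<Rightarrow> real" where
  "simple_root s = (\<lambda>t. if t = s then 1 else 0)"

text \<open>Tits bilinear form B(e_s,e_t) = - cos(pi / m(s,t)) on vectors indexed by S.\<close>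
definition tits_form :: "('w, 'b) monoid_scheme \<Rightarrow> 'w set \<Rightarrow> ('w \<Rightarrow> real) \<Rightarrow> ('w \<Rightarrow> real) \<Rightarrow> real" where
  "tits_form G S u v = (\<Sum>s\<in>S. \<Sum>t\<in>S. u s * v t * (- cos (pi / real (cox_m G s t))))"

definition simple_refl :: "('w, 'b) monoid_scheme \<Rightarrow> 'w set \<Rightarrow> 'w \<Rightarrow> ('w \<Rightarrow> real) \<Rightarrow> ('w \<Rightarrow> real)" where
  "simple_refl G S s v = (\<lambda>t. v t - 2 * tits_form G S (simple_root s) v * simple_root s t)"

inductive_set roots :: "('w, 'b) monoid_scheme \<Rightarrow> 'w set \<Rightarrow> ('w \<Rightarrow> real) set"
  for G S where
  simple: "s \<in> S \<Longrightarrow> simple_root s \<in> roots G S"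
| refl: "v \<in> roots G S \<Longrightarrow> s \<in> S \<Longrightarrow> simple_refl G S s v \<in> roots G S"

definition root_height :: "'w set \<Rightarrow> ('w \<Rightarrow> real) \<Rightarrow> real" where
  "root_height S v = (\<Sum>s\<in>S. v s)"

definition highest_root :: "('w, 'b) monoid_scheme \<Rightarrow> 'w set \<Rightarrow> ('w \<Rightarrow> real) \<Rightarrow> bool" where
  "highest_root G S \<phi> \<longleftrightarrow> \<phi> \<in> roots G S \<and> (\<forall>\<psi>\<in>roots G S. root_height S \<psi> \<le> root_height S \<phi>)"

text \<open>Polar type: simple roots not perpendicular to the highest root.\<close>
definition polar_type :: "('w, 'b) monoid_scheme \<Rightarrow> 'w set \<Rightarrow> 'w set" where
  "polar_type G S = {s \<in> S. \<exists>\<phi>. highest_root G S \<phi> \<and> tits_form G S (simple_root s) \<phi> \<noteq> 0}"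

section \<open>Buildings as W-metric spaces (Abramenko--Brown)\<close>

definition building :: "('w, 'b) monoid_scheme \<Rightarrow> 'w set \<Rightarrow> 'c set \<Rightarrow> ('c \<Rightarrow> 'c \<Rightarrow> 'w) \<Rightarrow> bool" where
  "building G S Ch \<delta> \<longleftrightarrow> coxeter_system G S \<and> Ch \<noteq> {} \<and>
     (\<forall>C\<in>Ch. \<forall>D\<in>Ch. \<delta> C D \<in> carrier G) \<and>
     (\<forall>C\<in>Ch. \<forall>D\<in>Ch. \<delta> C D = \<one>\<^bsub>G\<^esub> \<longleftrightarrow> C = D) \<and>
     (\<forall>C\<in>Ch. \<forall>D\<in>Ch. \<forall>C'\<in>Ch. \<forall>s\<in>S. \<delta> C' C = s \<longrightarrow>
        \<delta> C' D \<in> {s \<otimes>\<^bsub>G\<^esub> \<delta> C D, \<delta> C D} \<and>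
        (wlen G S (s \<otimes>\<^bsub>G\<^esub> \<delta> C D) = wlen G S (\<delta> C D) + 1 \<longrightarrow> \<delta> C' D = s \<otimes>\<^bsub>G\<^esub> \<delta> C D)) \<and>
     (\<forall>C\<in>Ch. \<forall>D\<in>Ch. \<forall>s\<in>S. \<exists>C'\<in>Ch. \<delta> C' C = s \<and> \<delta> C' D = s \<otimes>\<^bsub>G\<^esub> \<delta> C D)"

text \<open>Thick: every panel contains at least three chambers.\<close>
definition thick :: "('w, 'b) monoid_scheme \<Rightarrow> 'w set \<Rightarrow> 'c set \<Rightarrow> ('c \<Rightarrow> 'c \<Rightarrow> 'w) \<Rightarrow> bool" where
  "thick G S Ch \<delta> \<longleftrightarrow> (\<forall>C\<in>Ch. \<forall>s\<in>S. \<exists>D1\<in>Ch. \<exists>D2\<in>Ch. D1 \<noteq> D2 \<and> \<delta> C D1 = s \<and> \<delta> C D2 = s)"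

text \<open>An automorphism theta (not necessarily type preserving) with companion sigma.\<close>
definition automorphism_with_companion ::
  "('w, 'b) monoid_scheme \<Rightarrow> 'w set \<Rightarrow> 'c set \<Rightarrow> ('c \<Rightarrow> 'c \<Rightarrow> 'w) \<Rightarrow> ('c \<Rightarrow> 'c) \<Rightarrow> ('w \<Rightarrow> 'w) \<Rightarrow> bool" where
  "automorphism_with_companion G S Ch \<delta> \<theta> \<sigma> \<longleftrightarrow>
     bij_betw \<theta> Ch Ch \<and> \<sigma> \<in> iso G G \<and> \<sigma> ` S = S \<and>
     (\<forall>C\<in>Ch. \<forall>D\<in>Ch. \<delta> (\<theta> C) (\<theta> D) = \<sigma> (\<delta> C D))"

definition disp :: "'c set \<Rightarrow> ('c \<Rightarrow> 'c \<Rightarrow> 'w) \<Rightarrow> ('c \<Rightarrow> 'c) \<Rightarrow> 'w set" where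
  "disp Ch \<delta> \<theta> = {\<delta> C (\<theta> C) | C. C \<in> Ch}"

definition twisted_conj_class :: "('w, 'b) monoid_scheme \<Rightarrow> ('w \<Rightarrow> 'w) \<Rightarrow> 'w \<Rightarrow> 'w set" where
  "twisted_conj_class G \<sigma> w = {inv\<^bsub>G\<^esub> v \<otimes>\<^bsub>G\<^esub> w \<otimes>\<^bsub>G\<^esub> \<sigma> v | v. v \<in> carrier G}"

definition uniclass :: "('w, 'b) monoid_scheme \<Rightarrow> 'c set \<Rightarrow> ('c \<Rightarrow> 'c \<Rightarrow> 'w) \<Rightarrow> ('c \<Rightarrow> 'c) \<Rightarrow> ('w \<Rightarrow> 'w) \<Rightarrow> bool" where
  "uniclass G Ch \<delta> \<theta> \<sigma> \<longleftrightarrow> (\<exists>w\<in>carrier G. disp Ch \<delta> \<theta> \<subseteq> twisted_conj_class G \<sigma> w)"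

section \<open>Long root subgroup geometry\<close>

text \<open>Residue of type K containing C.\<close>
definition residue :: "('w, 'b) monoid_scheme \<Rightarrow> 'c set \<Rightarrow> ('c \<Rightarrow> 'c \<Rightarrow> 'w) \<Rightarrow> 'w set \<Rightarrow> 'c \<Rightarrow> 'c set" where
  "residue G Ch \<delta> K C = {D \<in> Ch. \<delta> C D \<in> generate G K}"

text \<open>Points: vertices of polar type J, i.e. residues of type S - J.\<close>
definition lrg_points :: "('w, 'b) monoid_scheme \<Rightarrow> 'w set \<Rightarrow> 'c set \<Rightarrow> ('c \<Rightarrow> 'c \<Rightarrow> 'w) \<Rightarrow> 'c set set" where
  "lrg_points G S Ch \<delta> = {residue G Ch \<delta> (S - polar_type G S) C | C. C \<in> Ch}"

text \<open>Two distinct points are collinear iff they share a panel of type j, j in the polar type.\<close>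
definition lrg_collinear :: "('w, 'b) monoid_scheme \<Rightarrow> 'w set \<Rightarrow> 'c set \<Rightarrow> ('c \<Rightarrow> 'c \<Rightarrow> 'w) \<Rightarrow> 'c set \<Rightarrow> 'c set \<Rightarrow> bool" where
  "lrg_collinear G S Ch \<delta> x y \<longleftrightarrow> x \<in> lrg_points G S Ch \<delta> \<and> y \<in> lrg_points G S Ch \<delta> \<and> x \<noteq> y \<and>
     (\<exists>C\<in>x. \<exists>D\<in>y. \<delta> C D \<in> polar_type G S)"

text \<open>Mutual position 1: distinct and collinear.\<close>
definition lrg_pos1 :: "('w, 'b) monoid_scheme \<Rightarrow> 'w set \<Rightarrow> 'c set \<Rightarrow> ('c \<Rightarrow> 'c \<Rightarrow> 'w) \<Rightarrow> 'c set \<Rightarrow> 'c set \<Rightarrow> bool" where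
  "lrg_pos1 G S Ch \<delta> x y \<longleftrightarrow> lrg_collinear G S Ch \<delta> x y"

text \<open>Mutual position 2': non-collinear with exactly one point collinear to both.\<close>
definition lrg_pos2' :: "('w, 'b) monoid_scheme \<Rightarrow> 'w set \<Rightarrow> 'c set \<Rightarrow> ('c \<Rightarrow> 'c \<Rightarrow> 'w) \<Rightarrow> 'c set \<Rightarrow> 'c set \<Rightarrow> bool" where
  "lrg_pos2' G S Ch \<delta> x y \<longleftrightarrow> x \<in> lrg_points G S Ch \<delta> \<and> y \<in> lrg_points G S Ch \<delta> \<and> x \<noteq> y \<and>
     \<not> lrg_collinear G S Ch \<delta> x y \<and>
     (\<exists>!z. z \<in> lrg_points G S Ch \<delta> \<and> lrg_collinear G S Ch \<delta> x z \<and> lrg_collinear G S Ch \<delta> z y)"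

text \<open>Polar {1,2'}-kangaroo: no point x has x, x^theta in mutual position 1 or 2'.\<close>
definition polar_1_2'_kangaroo ::
  "('w, 'b) monoid_scheme \<Rightarrow> 'w set \<Rightarrow> 'c set \<Rightarrow> ('c \<Rightarrow> 'c \<Rightarrow> 'w) \<Rightarrow> ('c \<Rightarrow> 'c) \<Rightarrow> bool" where
  "polar_1_2'_kangaroo G S Ch \<delta> \<theta> \<longleftrightarrow>
     (\<forall>x\<in>lrg_points G S Ch \<delta>. \<not> lrg_pos1 G S Ch \<delta> x (\<theta> ` x) \<and> \<not> lrg_pos2' G S Ch \<delta> x (\<theta> ` x))"

end

theory Submission
  imports Defs "HOL-Library.Function_Algebras"
begin

text \<open>Let \<open>\<phi>\<close> be the highest root. A displacement \<open>w\<close> acts on the root lattice by the isometry \<open>g = w\<sigma>\<close>, and the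
  position of the point of a chamber relative to its image is governed by the inner product of \<open>\<phi>\<close> and
  \<open>g \<phi>\<close> (roots have norm 2): it is odd exactly in the positions 1 and 2'. So \<open>\<theta>\<close> is a kangaroo iff \<open>\<phi>\<close> is
  pure, where a root \<open>x\<close> is called pure if the inner product of \<open>x\<close> and \<open>g x\<close> is even for all displacements.

  If \<open>\<theta>\<close> is uniclass, all displacements have the same length parity, hence the displacements form a full twisted
  conjugacy class and no panel changes a displacement on one side only. This forces \<open>g\<close> to be an involution on
  every root it neither fixes nor negates. An impure root would then be conjugate to a simple root of a projective
  plane on whose two simple roots \<open>g\<close> acts as a swap, up to sign, and walks along hexagons exclude this.

  Conversely, let \<open>\<phi>\<close> be pure and let \<open>x\<close> be a maximal impure root. Passing to neighbouring chambers shows that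
  no simple root can be added to \<open>x\<close>, except if \<open>x + \<alpha> = \<phi>\<close> for a simple root \<open>\<alpha>\<close>; the latter case
  is excluded by moving the displacement through panels orthogonal to \<open>\<phi>\<close>. Hence all roots are pure. But if \<open>w\<close> and
  \<open>s w\<close> were both displacements, subtracting the two parity conditions over all roots would contradict
  irreducibility. So neighbouring displacements are always twisted conjugates.\<close>

section \<open>Coxeter groups\<close>

text \<open>The displacements enter through four rules for panels. Let \<open>g\<close> be the
  isometry of a displacement. The signs of \<open>g^-1 (e s)\<close> and \<open>g (e s)\<close> tell
  whether multiplying by \<open>s\<close> on the left and by \<open>\<sigma> s\<close> on the right
  lengthens. Apart from the parallel cases, where \<open>g (e s)\<close> is \<open>e s\<close> or
  \<open>- e s\<close>, three of the four sign patterns determine displacements that certainly occur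
  on the panel. Thickness matters when the signs differ: a third chamber then has a one-sided
  product. If both signs are negative there is only an alternative, and this is the obstacle that
  shapes the second direction: an odd value cannot simply be transported across a panel, and
  \<open>stuck\<close> records the bad branch.

  Parity suits these rules. A two-sided step moves the value of a root to the value of its reflected
  root, and the one-sided products give mixed values from which unknown parities can be solved.

  A position needs only one root because the stabilizer of \<open>phi\<close> is exactly the
  parabolic subgroup of the type of a point.\<close>

lemma (in monoid) wprod_closed [simp]: "set ws \<subseteq> carrier G \<Longrightarrow> wprod G ws \<in> carrier G"
  by (induction ws) (auto simp: wprod_def)

lemma wprod_Nil [simp]: "wprod G [] = \<one>\<^bsub>G\<^esub>"
  and wprod_Cons [simp]: "wprod G (s # ws) = s \<otimes>\<^bsub>G\<^esub> wprod G ws"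
  by (simp_all add: wprod_def)

lemma (in monoid) wprod_append:
  "set us \<subseteq> carrier G \<Longrightarrow> set ws \<subseteq> carrier G \<Longrightarrow> wprod G (us @ ws) = wprod G us \<otimes> wprod G ws"
  by (induction us) (auto simp: m_assoc)

lemma set_delete_subset: "set ws \<subseteq> B \<Longrightarrow> set (take i ws @ drop (Suc i) ws) \<subseteq> B"
  by (auto dest: in_set_takeD in_set_dropD)

lemma sum_pos_obtain:
  fixes f :: "'i \<Rightarrow> int"
  assumes "sum f B > 0"
  obtains b where "b \<in> B" "0 < f b"
proof -
  have "\<not> (\<forall>b\<in>B. f b \<le> 0)"
  proof
    assume "\<forall>b\<in>B. f b \<le> 0"
    then have "sum f B \<le> 0" by (auto intro: sum_nonpos)
    then show False using assms by simp
  qed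
  then show ?thesis using that by (auto simp: not_le)
qed

locale simply_laced_coxeter = group G for G (structure) +
  fixes S :: "'a set"
  assumes cox: "coxeter_system G S"
    and fin: "finite (carrier G)"
    and irr: "irreducible_cox G S"
    and laced: "simply_laced G S"
    and rank: "card S \<ge> 2"
begin

abbreviation len :: "'a \<Rightarrow> nat" where "len \<equiv> wlen G S"

definition reduced :: "'a list \<Rightarrow> bool" where
  "reduced ws \<longleftrightarrow> set ws \<subseteq> S \<and> length ws = len (wprod G ws)"

lemma S_sub: "S \<subseteq> carrier G" and one_notin_S: "\<one> \<notin> S"
  and S_sq [simp]: "s \<in> S \<Longrightarrow> s \<otimes> s = \<one>"
  using cox by (auto simp: coxeter_system_def)

lemma S_carrier [simp, intro]: "s \<in> S \<Longrightarrow> s \<in> carrier G"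
  using S_sub by auto

lemma set_S_carrier: "set ws \<subseteq> S \<Longrightarrow> set ws \<subseteq> carrier G"
  using S_sub by auto

lemma wprod_S [simp]: "set ws \<subseteq> S \<Longrightarrow> wprod G ws \<in> carrier G"
  by (simp add: set_S_carrier)

lemma S_sq_left [simp]: "s \<in> S \<Longrightarrow> w \<in> carrier G \<Longrightarrow> s \<otimes> (s \<otimes> w) = w"
  by (simp flip: m_assoc)

lemma S_sq_right [simp]: "s \<in> S \<Longrightarrow> w \<in> carrier G \<Longrightarrow> w \<otimes> s \<otimes> s = w"
  by (simp add: m_assoc)

lemma comm_left: "a \<otimes> b = b \<otimes> a \<Longrightarrow> a \<in> carrier G \<Longrightarrow> b \<in> carrier G \<Longrightarrow> u \<in> carrier G \<Longrightarrow>
    a \<otimes> (b \<otimes> u) = b \<otimes> (a \<otimes> u)"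
  by (metis m_assoc)

lemma braid_left: "a \<otimes> b \<otimes> a = b \<otimes> a \<otimes> b \<Longrightarrow> a \<in> carrier G \<Longrightarrow> b \<in> carrier G \<Longrightarrow> u \<in> carrier G \<Longrightarrow>
    a \<otimes> (b \<otimes> (a \<otimes> u)) = b \<otimes> (a \<otimes> (b \<otimes> u))"
  by (metis m_assoc m_closed)

lemma inv_S [simp]: "s \<in> S \<Longrightarrow> inv s = s"
  by (rule inv_equality) auto

lemma finite_S [simp]: "finite S"
  using fin S_sub finite_subset by auto

lemma len_le: "set ws \<subseteq> S \<Longrightarrow> len (wprod G ws) \<le> length ws"
  unfolding wlen_def by (rule Least_le) auto

lemma reduced_exists:
  assumes "w \<in> carrier G"
  obtains ws where "reduced ws" "wprod G ws = w"
proof -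
  have "\<exists>n ws. length ws = n \<and> set ws \<subseteq> S \<and> wprod G ws = w"
    using cox assms by (auto simp: coxeter_system_def)
  then have "\<exists>ws. length ws = len w \<and> set ws \<subseteq> S \<and> wprod G ws = w"
    unfolding wlen_def by (rule LeastI_ex)
  then show ?thesis using that unfolding reduced_def by auto
qed

lemma exchange:
  assumes "reduced ws" "s \<in> S" "len (s \<otimes> wprod G ws) \<le> len (wprod G ws)"
  obtains i where "i < length ws" "s \<otimes> wprod G ws = wprod G (take i ws @ drop (Suc i) ws)"
  using cox assms unfolding coxeter_system_def reduced_def by metis

lemma len_one [simp]: "len \<one> = 0"
  using len_le[of "[]"] by simp

lemma reduced_Nil [simp]: "reduced []" by (simp add: reduced_def)

lemma len_mult_left_le: "s \<in> S \<Longrightarrow> w \<in> carrier G \<Longrightarrow> len (s \<otimes> w) \<le> Suc (len w)"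
  by (metis insert_subset length_Cons len_le list.simps(15) reduced_def reduced_exists wprod_Cons)

lemma len_mult_left_ne:
  assumes "s \<in> S" "w \<in> carrier G" shows "len (s \<otimes> w) \<noteq> len w"
proof
  assume eq: "len (s \<otimes> w) = len w"
  obtain ws where ws: "reduced ws" "wprod G ws = w" using reduced_exists assms by blast
  obtain i where i: "i < length ws" "s \<otimes> w = wprod G (take i ws @ drop (Suc i) ws)"
    using exchange[OF ws(1) assms(1)] eq ws(2) by auto
  have "set (take i ws @ drop (Suc i) ws) \<subseteq> S"
    using ws(1) set_delete_subset unfolding reduced_def by blast
  from len_le[OF this] have "len (s \<otimes> w) < length ws" using i by auto
  with ws eq show False by (simp add: reduced_def)
qed

lemma len_mult_left: "s \<in> S \<Longrightarrow> w \<in> carrier G \<Longrightarrow> len (s \<otimes> w) = Suc (len w) \<or> Suc (len (s \<otimes> w)) = len w"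
  using len_mult_left_le[of s w] len_mult_left_le[of s "s \<otimes> w"] len_mult_left_ne[of s w] by fastforce

lemma wprod_rev: "set ws \<subseteq> S \<Longrightarrow> wprod G (rev ws) = inv (wprod G ws)"
proof (induction ws)
  case (Cons s ws)
  then show ?case by (simp add: wprod_append set_S_carrier inv_mult_group)
qed simp

lemma len_inv [simp]: assumes "w \<in> carrier G" shows "len (inv w) = len w"
proof -
  have le: "len (inv w) \<le> len w" if w: "w \<in> carrier G" for w
  proof -
    obtain ws where "reduced ws" "wprod G ws = w" using reduced_exists w by blast
    then show ?thesis using len_le[of "rev ws"] wprod_rev[of ws] by (auto simp: reduced_def)
  qed
  from le[of w] le[of "inv w"] assms show ?thesis by simp
qed

lemma len_mult_right: assumes "s \<in> S" "w \<in> carrier G"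
  shows "len (w \<otimes> s) = Suc (len w) \<or> Suc (len (w \<otimes> s)) = len w"
proof -
  have "len (w \<otimes> s) = len (s \<otimes> inv w)"
    using len_inv[of "w \<otimes> s"] assms by (simp add: inv_mult_group del: len_inv)
  then show ?thesis using len_mult_left[of s "inv w"] assms by simp
qed

lemma reduced_rev: "reduced ws \<Longrightarrow> reduced (rev ws)"
  using wprod_rev by (auto simp: reduced_def)

lemma reduced_Cons_iff: "reduced (s # ws) \<longleftrightarrow> s \<in> S \<and> reduced ws \<and> len (s \<otimes> wprod G ws) = Suc (len (wprod G ws))"
proof
  assume *: "reduced (s # ws)"
  then show "s \<in> S \<and> reduced ws \<and> len (s \<otimes> wprod G ws) = Suc (len (wprod G ws))"
    using len_le[of ws] len_mult_left_le[of s "wprod G ws"] by (auto simp: reduced_def)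
qed (auto simp: reduced_def)

lemma left_descent_reduced:
  assumes "s \<in> S" "w \<in> carrier G" "len (s \<otimes> w) < len w"
  obtains ws where "reduced (s # ws)" "wprod G (s # ws) = w" "wprod G ws = s \<otimes> w"
proof -
  obtain ws where ws: "reduced ws" "wprod G ws = s \<otimes> w"
    by (rule reduced_exists[of "s \<otimes> w"]) (use assms in auto)
  then have "reduced (s # ws)" "wprod G (s # ws) = w"
    using assms len_mult_left[of s w] by (auto simp: reduced_Cons_iff)
  then show ?thesis using that ws by blast
qed

subsection \<open>Rank two\<close>

lemma cox_m_cases:
  assumes "s \<in> S" "t \<in> S" "s \<noteq> t"
  shows "cox_m G s t = 2 \<and> s \<otimes> t = t \<otimes> s \<or> cox_m G s t = 3 \<and> s \<otimes> t \<noteq> t \<otimes> s \<and> s \<otimes> t \<otimes> s = t \<otimes> s \<otimes> t"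
proof -
  have c: "s \<otimes> t \<in> carrier G" using assms by auto
  have pow: "(s \<otimes> t) [^] group.ord G (s \<otimes> t) = \<one>" using pow_ord_eq_1[OF c] .
  have m: "cox_m G s t \<in> {2,3}" using laced assms by (auto simp: simply_laced_def)
  have inv: "inv (s \<otimes> t) = t \<otimes> s" using assms by (simp add: inv_mult_group)
  show ?thesis
  proof (cases "cox_m G s t = 2")
    case True
    then have "(s \<otimes> t) \<otimes> (s \<otimes> t) = \<one>" using pow c by (simp add: cox_m_def numeral_2_eq_2)
    then have "s \<otimes> t = inv (s \<otimes> t)" using c by (simp add: inv_equality)
    then show ?thesis using True inv by simp
  next
    case False
    then have 3: "cox_m G s t = 3" using m by auto
    have "(s \<otimes> t) [^] (Suc (Suc (Suc 0))) = \<one>" using pow 3 by (simp add: cox_m_def numeral_3_eq_3)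
    then have 1: "(s \<otimes> t) \<otimes> (s \<otimes> t) \<otimes> (s \<otimes> t) = \<one>" using c by simp
    then have "(s \<otimes> t) \<otimes> (s \<otimes> t) = inv (s \<otimes> t)" using c by (simp add: inv_equality)
    then have "s \<otimes> t \<otimes> s \<otimes> t = t \<otimes> s" using inv assms by (simp add: m_assoc)
    then have "s \<otimes> t \<otimes> s \<otimes> t \<otimes> t = t \<otimes> s \<otimes> t" by simp
    then have br: "s \<otimes> t \<otimes> s = t \<otimes> s \<otimes> t" using assms by (simp add: m_assoc)
    have "s \<otimes> t \<noteq> t \<otimes> s"
    proof
      assume "s \<otimes> t = t \<otimes> s"
      then have "(s \<otimes> t) \<otimes> (s \<otimes> t) = \<one>" using inv c by (metis r_inv)
      then have "(s \<otimes> t) [^] (2::nat) = \<one>" using c by (simp add: numeral_2_eq_2)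
      then have "group.ord G (s \<otimes> t) dvd 2" using c pow_eq_id by blast
      then show False using 3 by (auto simp: cox_m_def)
    qed
    then show ?thesis using 3 br by auto
  qed
qed

lemma cox_m_self: "s \<in> S \<Longrightarrow> cox_m G s s = 1"
  by (simp add: cox_m_def)

text \<open>Deleting the first letter \<open>s\<close> would give \<open>t = s\<close>, so the
  letter removed by the exchange condition lies further right.\<close>

lemma exchange_first:
  assumes "reduced (s # ws)" "t \<in> S" "t \<noteq> s" "len (t \<otimes> (s \<otimes> wprod G ws)) < len (s \<otimes> wprod G ws)"
  obtains us where "set us \<subseteq> S" "length us < length ws" "t \<otimes> (s \<otimes> wprod G ws) = s \<otimes> wprod G us"
proof -
  obtain i where i: "i < length (s # ws)" "t \<otimes> (s \<otimes> wprod G ws) = wprod G (take i (s # ws) @ drop (Suc i) (s # ws))"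
    using exchange[OF assms(1,2)] assms(4) by auto
  have wsS: "set ws \<subseteq> S" "s \<in> S" using assms(1) by (auto simp: reduced_def)
  show ?thesis
  proof (cases i)
    case 0
    then have "t \<otimes> (s \<otimes> wprod G ws) = wprod G ws" using i by simp
    then have "(t \<otimes> s) \<otimes> wprod G ws = \<one> \<otimes> wprod G ws" using wsS assms by (simp add: m_assoc)
    then have "t \<otimes> s = \<one>" using wsS assms(2) by (meson m_closed one_closed right_cancel S_carrier wprod_S)
    then have "t = s" using wsS assms(2) by (metis inv_S inv_equality S_carrier)
    then show ?thesis using assms by simp
  next
    case (Suc k)
    have "set (take k ws @ drop (Suc k) ws) \<subseteq> S" using wsS set_delete_subset by blast
    moreover have "length (take k ws @ drop (Suc k) ws) < length ws" using i Suc by auto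
    moreover have "t \<otimes> (s \<otimes> wprod G ws) = s \<otimes> wprod G (take k ws @ drop (Suc k) ws)" using i Suc by simp
    ultimately show ?thesis by (rule that)
  qed
qed

text \<open>An element with left descents \<open>s\<close> and \<open>t\<close> begins with the
  longest element of the rank two subgroup they generate, which is \<open>s t\<close> or
  \<open>s t s\<close> in the simply laced case.\<close>

lemma two_left_descents:
  assumes w: "w \<in> carrier G" and st: "s \<in> S" "t \<in> S" "s \<noteq> t"
    and d: "len (s \<otimes> w) < len w" "len (t \<otimes> w) < len w"
  obtains v where "s \<otimes> t = t \<otimes> s" "reduced v" "reduced (s # t # v)" "reduced (t # s # v)"
      "wprod G (s # t # v) = w" "wprod G (t # s # v) = w"
  | v where "s \<otimes> t \<otimes> s = t \<otimes> s \<otimes> t" "reduced v" "reduced (s # t # s # v)" "reduced (t # s # t # v)"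
      "wprod G (s # t # s # v) = w" "wprod G (t # s # t # v) = w"
proof -
  obtain ws where ws: "reduced (s # ws)" "wprod G (s # ws) = w" "wprod G ws = s \<otimes> w"
    using left_descent_reduced[OF st(1) w d(1)] .
  obtain us where us: "set us \<subseteq> S" "length us < length ws" "t \<otimes> w = s \<otimes> wprod G us"
    using exchange_first[OF ws(1) st(2) st(3)[symmetric]] d(2) ws(2) by auto
  have lw: "len w = Suc (length ws)" using ws by (simp add: reduced_def)
  have wts: "w = wprod G (t # s # us)" using S_sq_left[OF st(2) w] us(3) by simp
  have rts: "reduced (t # s # us)"
    using len_le[of "t # s # us"] us st lw wts by (auto simp: reduced_def)
  show ?thesis
  proof (cases "s \<otimes> t = t \<otimes> s")
    case True
    have e: "wprod G (s # t # us) = w"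
      using comm_left[OF True, of "wprod G us"] wts st us(1) by simp
    then have "reduced (s # t # us)" using rts wts by (auto simp: reduced_def)
    moreover have "reduced us" using rts by (simp add: reduced_Cons_iff)
    ultimately show ?thesis using that(1)[OF True] rts wts e by metis
  next
    case False
    then have br: "s \<otimes> t \<otimes> s = t \<otimes> s \<otimes> t" using cox_m_cases st by blast
    have wtsu: "wprod G (s # us) = t \<otimes> w" using wts st us by simp
    \<comment> \<open>Deleting \<open>t\<close> would give \<open>s = t\<close>, and deleting
      \<open>s\<close> would make \<open>s\<close> and \<open>t\<close> commute; so the deleted
      letter lies in \<open>us\<close>.\<close>
    obtain i where i: "i < length (t # s # us)"
      "s \<otimes> w = wprod G (take i (t # s # us) @ drop (Suc i) (t # s # us))"
      using exchange[OF rts st(1)] d(1) wts by auto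
    consider "i = 0" | "i = 1" | k where "i = Suc (Suc k)" by (metis One_nat_def not0_implies_Suc)
    then show ?thesis
    proof cases
      case 1
      then have "s \<otimes> w = t \<otimes> w" using i wtsu by simp
      then have "s = t" using w st by (meson right_cancel S_carrier)
      then show ?thesis using st by simp
    next
      case 2
      then have "s \<otimes> w = t \<otimes> wprod G us" using i by simp
      then have "s \<otimes> (t \<otimes> (s \<otimes> wprod G us)) = t \<otimes> wprod G us" using wts by simp
      then have "(s \<otimes> t \<otimes> s) \<otimes> wprod G us = t \<otimes> wprod G us" using st us by (simp add: m_assoc)
      then have "s \<otimes> t \<otimes> s = t" using st us by (meson m_closed right_cancel S_carrier wprod_S)
      then have "s \<otimes> t \<otimes> s \<otimes> s = t \<otimes> s" by simp
      then show ?thesis using False st by simp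
    next
      case 3
      define v where "v = take k us @ drop (Suc k) us"
      have k: "k < length us" using i 3 by simp
      have vS: "set v \<subseteq> S" unfolding v_def using us(1) set_delete_subset by blast
      have "s \<otimes> w = wprod G (t # s # v)" using i 3 by (simp add: v_def)
      then have e1: "w = wprod G (s # t # s # v)" using S_sq_left[OF st(1) w] by simp
      have lv: "length v = length us - 1" "length us > 0" using k by (auto simp: v_def)
      have lu: "len w = length us + 2" using rts wts by (simp add: reduced_def)
      have r1: "reduced (s # t # s # v)" using e1 lv lu vS st by (auto simp: reduced_def)
      have e2: "w = wprod G (t # s # t # v)" using braid_left[OF br] e1 st vS by simp
      have r2: "reduced (t # s # t # v)" using e2 lv lu vS st by (auto simp: reduced_def)
      show ?thesis using that(2)[OF br _ r1 r2] e1 e2 r1 by (auto simp: reduced_Cons_iff)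
    qed
  qed
qed

subsection \<open>The integral reflection representation\<close>

text \<open>Lattice vectors are given by their coordinates with respect to the simple roots \<open>e s\<close>, and \<open>A\<close> is twice the
  Tits form.\<close>
definition cart :: "'a \<Rightarrow> 'a \<Rightarrow> int" where
  "cart s t = (if s = t then 2 else if s \<otimes> t = t \<otimes> s then 0 else - 1)"

definition A :: "('a \<Rightarrow> int) \<Rightarrow> ('a \<Rightarrow> int) \<Rightarrow> int" where
  "A x y = (\<Sum>s\<in>S. \<Sum>t\<in>S. x s * y t * cart s t)"

definition e :: "'a \<Rightarrow> 'a \<Rightarrow> int" where
  "e s = (\<lambda>t. if t = s then 1 else 0)"

definition scl :: "int \<Rightarrow> ('a \<Rightarrow> int) \<Rightarrow> 'a \<Rightarrow> int" where
  "scl k x = (\<lambda>t. k * x t)"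

definition rf :: "'a \<Rightarrow> ('a \<Rightarrow> int) \<Rightarrow> 'a \<Rightarrow> int" where
  "rf s x = x - scl (A (e s) x) (e s)"

lemma cart_sym: "cart s t = cart t s" by (auto simp: cart_def)

lemma A_sym: "A x y = A y x"
  unfolding A_def by (subst sum.swap) (auto intro!: sum.cong simp: cart_sym)

lemma A_add1 [simp]: "A (x + y) z = A x z + A y z"
  and A_diff1 [simp]: "A (x - y) z = A x z - A y z"
  and A_scl1 [simp]: "A (scl k x) z = k * A x z"
  and A_zero1 [simp]: "A 0 z = 0"
  and A_neg1 [simp]: "A (- x) z = - A x z"
  by (simp_all add: A_def algebra_simps sum.distrib sum_subtractf sum_distrib_left scl_def sum_negf)

lemma A_add2 [simp]: "A z (x + y) = A z x + A z y"
  and A_diff2 [simp]: "A z (x - y) = A z x - A z y"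
  and A_scl2 [simp]: "A z (scl k x) = k * A z x"
  and A_zero2 [simp]: "A z 0 = 0"
  and A_neg2 [simp]: "A z (- x) = - A z x"
  by (simp_all add: A_sym[of z])

lemma scl_simps [simp]: "scl 0 x = 0" "scl 1 x = x" "scl (- 1) x = - x" "scl k 0 = 0"
  and scl_diff: "scl k (x - y) = scl k x - scl k y"
  and scl_ladd: "scl (k + l) x = scl k x + scl l x" and scl_ldiff: "scl (k - l) x = scl k x - scl l x"
  and scl_neg: "scl (- k) x = - scl k x"
  and scl_2: "scl 2 x = x + x"
  by (auto simp: scl_def algebra_simps)

lemma A_e: assumes "s \<in> S" shows "A (e s) y = (\<Sum>t\<in>S. y t * cart s t)"
proof -
  have "A (e s) y = (\<Sum>u\<in>S. if u = s then (\<Sum>t\<in>S. y t * cart s t) else 0)"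
    unfolding A_def by (intro sum.cong HOL.refl) (auto simp: e_def)
  then show ?thesis using assms by (simp add: sum.delta)
qed

lemma A_ee: assumes "s \<in> S" "t \<in> S" shows "A (e s) (e t) = cart s t"
proof -
  have "A (e s) (e t) = (\<Sum>u\<in>S. if u = t then cart s t else 0)"
    unfolding A_e[OF assms(1)] by (intro sum.cong HOL.refl) (auto simp: e_def)
  then show ?thesis using assms by (simp add: sum.delta)
qed

lemma A_es [simp]: "s \<in> S \<Longrightarrow> A (e s) (e s) = 2" by (simp add: A_ee cart_def)

lemma A_e_le: "s \<in> S \<Longrightarrow> t \<in> S \<Longrightarrow> s \<noteq> t \<Longrightarrow> A (e s) (e t) \<le> 0"
  by (simp add: A_ee cart_def)

lemma A_e_cases: "s \<in> S \<Longrightarrow> t \<in> S \<Longrightarrow> s \<noteq> t \<Longrightarrow> A (e s) (e t) = 0 \<or> A (e s) (e t) = - 1"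
  by (simp add: A_ee cart_def)

lemma A_e_minus_one: assumes "s \<in> S" "t \<in> S" "A (e s) (e t) = - 1"
  shows "s \<noteq> t" "s \<otimes> t \<otimes> s = t \<otimes> s \<otimes> t"
proof -
  have "cart s t = - 1" using A_ee assms by simp
  then have "s \<noteq> t" "s \<otimes> t \<noteq> t \<otimes> s" unfolding cart_def by (auto split: if_splits)
  then show "s \<noteq> t" "s \<otimes> t \<otimes> s = t \<otimes> s \<otimes> t" using cox_m_cases assms by blast+
qed

lemma A_expand: "A x y = (\<Sum>s\<in>S. x s * A (e s) y)"
proof -
  have h: "(\<Sum>t\<in>S. x s * y t * cart s t) = x s * A (e s) y" if "s \<in> S" for s
    using that by (simp add: A_e sum_distrib_left mult.assoc)
  show ?thesis unfolding A_def[of x] by (rule sum.cong[OF HOL.refl h])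
qed

lemma rf_add [simp]: "rf s (x + y) = rf s x + rf s y"
  and rf_diff [simp]: "rf s (x - y) = rf s x - rf s y"
  and rf_neg [simp]: "rf s (- x) = - rf s x"
  and rf_scl: "rf s (scl k x) = scl k (rf s x)"
  by (simp_all add: rf_def scl_diff scl_ladd scl_ldiff scl_neg) (simp_all add: scl_def fun_eq_iff algebra_simps)

lemma rf_rf [simp]: "s \<in> S \<Longrightarrow> rf s (rf s x) = x"
  by (simp add: rf_def) ((simp add: scl_def fun_eq_iff)?)

lemma A_rf: "s \<in> S \<Longrightarrow> A (rf s x) y = A x (rf s y)"
  by (simp add: rf_def A_sym[of x "e s"])

lemma A_rf_rf [simp]: "s \<in> S \<Longrightarrow> A (rf s x) (rf s y) = A x y"
  by (simp add: A_rf)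

lemma rf_es [simp]: "s \<in> S \<Longrightarrow> rf s (e s) = - e s"
  by (simp add: rf_def scl_2)

lemma rf_comm: "s \<in> S \<Longrightarrow> t \<in> S \<Longrightarrow> s \<noteq> t \<Longrightarrow> s \<otimes> t = t \<otimes> s \<Longrightarrow> rf s (rf t x) = rf t (rf s x)"
  by (simp add: rf_def A_ee cart_def)

lemma rf_braid:
  assumes "s \<in> S" "t \<in> S" "s \<otimes> t \<noteq> t \<otimes> s"
  shows "rf s (rf t (rf s x)) = rf t (rf s (rf t x))"
proof -
  have [simp]: "A (e s) (e t) = -1" "A (e t) (e s) = -1" using assms by (auto simp: A_ee cart_def)
  show ?thesis using assms(1,2) by (simp add: rf_def) ((simp add: scl_def fun_eq_iff algebra_simps)?)
qed

definition actl :: "'a list \<Rightarrow> ('a \<Rightarrow> int) \<Rightarrow> 'a \<Rightarrow> int" where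
  "actl ws = foldr rf ws"

lemma actl_simps [simp]: "actl [] x = x" "actl (s # ws) x = rf s (actl ws x)"
  by (simp_all add: actl_def)

text \<open>Matsumoto's argument. Words with the same first letter are compared by induction.
  Otherwise both are compared with the two words from \<open>two_left_descents\<close>, which differ
  by a commutation or braid relation that the reflections satisfy.\<close>

lemma actl_reduced_unique:
  "reduced us \<Longrightarrow> reduced vs \<Longrightarrow> wprod G us = wprod G vs \<Longrightarrow> actl us x = actl vs x"
proof (induction "length us" arbitrary: us vs rule: less_induct)
  case less
  have L: "length us = length vs" using less.prems by (simp add: reduced_def)
  have IH: "actl (s # p) x = actl (s # q) x" if "reduced (s # p)" "reduced (s # q)" "length (s # p) = length us"
      "wprod G (s # p) = wprod G (s # q)" for s p q
  proof -
    have r: "reduced p" "reduced q" "s \<in> S" using that by (auto simp: reduced_Cons_iff)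
    moreover have "s \<otimes> wprod G p = s \<otimes> wprod G q" using that(4) by simp
    ultimately have "wprod G p = wprod G q" unfolding reduced_def by (metis S_sq_left wprod_S)
    then show ?thesis using less.hyps[of p q] r that(3) by simp
  qed
  show ?case
  proof (cases us)
    case Nil then show ?thesis using L by simp
  next
    case (Cons s us')
    then obtain t vs' where vs: "vs = t # vs'" using L by (cases vs) auto
    define w where "w = wprod G us"
    have w: "w \<in> carrier G" "s \<in> S" "t \<in> S" using less.prems Cons vs by (auto simp: w_def reduced_def)
    show ?thesis
    proof (cases "s = t")
      case True then show ?thesis using IH[of s us' vs'] less.prems Cons vs by simp
    next
      case False
      have us': "set us' \<subseteq> S" "set vs' \<subseteq> S" using less.prems Cons vs by (auto simp: reduced_def)
      have "w = s \<otimes> wprod G us'" "w = t \<otimes> wprod G vs'" using less.prems Cons vs by (auto simp: w_def)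
      then have "s \<otimes> w = wprod G us'" "t \<otimes> w = wprod G vs'" using w us' S_sq_left wprod_S by metis+
      moreover have "len w = Suc (length us')" "length us' = length vs'"
        using less.prems L Cons vs by (auto simp: w_def reduced_def)
      ultimately have d: "len (s \<otimes> w) < len w" "len (t \<otimes> w) < len w"
        using len_le[OF us'(1)] len_le[OF us'(2)] by simp_all
      show ?thesis
      proof (cases rule: two_left_descents[OF w False d])
        case (1 v)
        have "length (s # t # v) = length us" "length (t # s # v) = length us"
          using 1 less.prems by (auto simp: reduced_def w_def)
        then have "actl us x = actl (s # t # v) x" "actl (t # s # v) x = actl vs x"
          using IH[of s us' "t # v"] IH[of t "s # v" vs'] 1 less.prems Cons vs by (auto simp: w_def)
        then show ?thesis using rf_comm[of s t] 1 w False by simp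
      next
        case (2 v)
        have "length (s # t # s # v) = length us" "length (t # s # t # v) = length us"
          using 2 less.prems by (auto simp: reduced_def w_def)
        then have "actl us x = actl (s # t # s # v) x" "actl (t # s # t # v) x = actl vs x"
          using IH[of s us' "t # s # v"] IH[of t "s # t # v" vs'] 2 less.prems Cons vs by (auto simp: w_def)
        \<comment> \<open>If \<open>s\<close> and \<open>t\<close> commuted, \<open>s t s v\<close>
          would shorten to \<open>t v\<close> and not be reduced.\<close>
        moreover have "s \<otimes> t \<noteq> t \<otimes> s"
        proof
          assume c: "s \<otimes> t = t \<otimes> s"
          have "s \<otimes> t \<otimes> s = t" using c w by (simp add: m_assoc)
          have vS: "set v \<subseteq> S" using 2 by (simp add: reduced_def)
          then have "w = s \<otimes> t \<otimes> s \<otimes> wprod G v" using 2(5) w by (simp add: m_assoc)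
          then have "w = wprod G (t # v)" using \<open>s \<otimes> t \<otimes> s = t\<close> by simp
          then show False using len_le[of "t # v"] 2(2,3,5) w by (auto simp: reduced_def)
        qed
        ultimately show ?thesis using rf_braid[of s t] w by simp
      qed
    qed
  qed
qed

definition act :: "'a \<Rightarrow> ('a \<Rightarrow> int) \<Rightarrow> 'a \<Rightarrow> int" where
  "act w = actl (SOME ws. reduced ws \<and> wprod G ws = w)"

lemma act_reduced: assumes "reduced ws" shows "act (wprod G ws) x = actl ws x"
proof -
  have "reduced (SOME us. reduced us \<and> wprod G us = wprod G ws) \<and> wprod G (SOME us. reduced us \<and> wprod G us = wprod G ws) = wprod G ws"
    by (rule someI_ex) (use assms in auto)
  then show ?thesis unfolding act_def using actl_reduced_unique assms by blast
qed

lemma act_one [simp]: "act \<one> x = x" using act_reduced[of "[]"] by simp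

lemma act_S_mult: assumes "s \<in> S" "w \<in> carrier G" shows "act (s \<otimes> w) x = rf s (act w x)"
proof -
  have up: "act (s \<otimes> v) x = rf s (act v x)" if v: "v \<in> carrier G" "len (s \<otimes> v) = Suc (len v)" for v
  proof -
    obtain ws where ws: "reduced ws" "wprod G ws = v" using reduced_exists v(1) by blast
    then have "reduced (s # ws)" using assms v by (simp add: reduced_Cons_iff)
    then show ?thesis using act_reduced[of "s # ws"] act_reduced[of ws] ws by simp
  qed
  show ?thesis
  proof (cases "len (s \<otimes> w) = Suc (len w)")
    case True then show ?thesis using up assms by blast
  next
    case False
    then have "len (s \<otimes> (s \<otimes> w)) = Suc (len (s \<otimes> w))" using len_mult_left[OF assms] assms by auto
    then have "act w x = rf s (act (s \<otimes> w) x)" using up[of "s \<otimes> w"] assms by simp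
    then show ?thesis using assms by simp
  qed
qed

lemma act_S [simp]: "s \<in> S \<Longrightarrow> act s x = rf s x"
  using act_S_mult[of s \<one>] by simp

lemma W_induct [consumes 1, case_names one mult]:
  assumes "w \<in> carrier G" "P \<one>" "\<And>s w. s \<in> S \<Longrightarrow> w \<in> carrier G \<Longrightarrow> P w \<Longrightarrow> P (s \<otimes> w)"
  shows "P w"
proof -
  obtain ws where "reduced ws" "wprod G ws = w" using reduced_exists assms(1) by blast
  moreover have "set ws \<subseteq> S \<Longrightarrow> P (wprod G ws)" for ws
    by (induction ws) (use assms in auto)
  ultimately show ?thesis by (auto simp: reduced_def)
qed

lemma act_mult: "v \<in> carrier G \<Longrightarrow> w \<in> carrier G \<Longrightarrow> act (v \<otimes> w) x = act v (act w x)"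
  by (induction v rule: W_induct) (simp_all add: act_S_mult m_assoc)

lemma act_add [simp]: "w \<in> carrier G \<Longrightarrow> act w (x + y) = act w x + act w y"
  and act_diff [simp]: "w \<in> carrier G \<Longrightarrow> act w (x - y) = act w x - act w y"
  and act_neg [simp]: "w \<in> carrier G \<Longrightarrow> act w (- x) = - act w x"
  by (induction w rule: W_induct, simp_all add: act_S_mult)+

lemma A_act_act [simp]: "w \<in> carrier G \<Longrightarrow> A (act w x) (act w y) = A x y"
  by (induction w rule: W_induct) (simp_all add: act_S_mult)

lemma act_inv_act [simp]: "w \<in> carrier G \<Longrightarrow> act (inv w) (act w x) = x"
  and act_act_inv [simp]: "w \<in> carrier G \<Longrightarrow> act w (act (inv w) x) = x"
  by (simp_all flip: act_mult)

lemma A_act_inv: "w \<in> carrier G \<Longrightarrow> A (act w x) y = A x (act (inv w) y)"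
  using A_act_act[of "inv w" "act w x" y] by simp

end

context simply_laced_coxeter
begin

section \<open>Roots\<close>

definition ht :: "('a \<Rightarrow> int) \<Rightarrow> int" where "ht x = (\<Sum>s\<in>S. x s)"
text \<open>The root lattice. Coordinates outside \<open>S\<close> are invisible to
  \<open>A\<close>, so definiteness and the invertibility of \<open>sig\<close> require this support
  condition.\<close>

definition Lat :: "('a \<Rightarrow> int) set" where "Lat = {x. \<forall>t. t \<notin> S \<longrightarrow> x t = 0}"
definition nonneg :: "('a \<Rightarrow> int) \<Rightarrow> bool" where "nonneg x \<longleftrightarrow> (\<forall>t. 0 \<le> x t)"
definition Rt :: "('a \<Rightarrow> int) set" where "Rt = {act w (e s) | w s. w \<in> carrier G \<and> s \<in> S}"

lemma ht_add [simp]: "ht (x + y) = ht x + ht y" and ht_diff [simp]: "ht (x - y) = ht x - ht y"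
  and ht_neg [simp]: "ht (- x) = - ht x" and ht_scl [simp]: "ht (scl k x) = k * ht x"
  by (simp_all add: ht_def sum.distrib sum_subtractf sum_negf scl_def sum_distrib_left)

lemma ht_e [simp]: "s \<in> S \<Longrightarrow> ht (e s) = 1"
  by (simp add: ht_def e_def)

lemma ht_rf: "s \<in> S \<Longrightarrow> ht (rf s x) = ht x - A (e s) x"
  by (simp add: rf_def)

lemma Lat_diff [simp]: "x \<in> Lat \<Longrightarrow> y \<in> Lat \<Longrightarrow> x - y \<in> Lat"
  and Lat_scl [simp]: "x \<in> Lat \<Longrightarrow> scl k x \<in> Lat"
  and Lat_e [simp]: "s \<in> S \<Longrightarrow> e s \<in> Lat"
  by (auto simp: Lat_def scl_def e_def)

lemma Lat_rf [simp]: "s \<in> S \<Longrightarrow> x \<in> Lat \<Longrightarrow> rf s x \<in> Lat"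
  by (simp add: rf_def)

lemma Lat_act [simp]: "w \<in> carrier G \<Longrightarrow> x \<in> Lat \<Longrightarrow> act w x \<in> Lat"
  by (induction w rule: W_induct) (simp_all add: act_S_mult)

lemma nonneg_e [simp]: "nonneg (e s)" and nonneg_add: "nonneg x \<Longrightarrow> nonneg y \<Longrightarrow> nonneg (x + y)"
  by (auto simp: nonneg_def e_def)

lemma right_descent_exists:
  assumes "w \<in> carrier G" "w \<noteq> \<one>"
  obtains t where "t \<in> S" "len (w \<otimes> t) < len w"
proof -
  obtain ws where ws: "reduced ws" "wprod G ws = inv w"
    by (rule reduced_exists[of "inv w"]) (use assms in auto)
  then obtain t us where us: "ws = t # us" using assms by (cases ws) (auto simp: inv_eq_1_iff eq_commute[of \<one>])
  then have t: "t \<in> S" "set us \<subseteq> S" using ws by (auto simp: reduced_def)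
  have "w = inv (wprod G ws)" using ws assms by simp
  then have "w = inv (wprod G us) \<otimes> t" using us t by (simp add: inv_mult_group)
  then have "w \<otimes> t = inv (wprod G us)" using t by simp
  then have "len (w \<otimes> t) \<le> length us" using len_le t(2) by simp
  moreover have "len w = Suc (length us)" using ws us assms len_inv[of w] by (simp add: reduced_def)
  ultimately show ?thesis using that t(1) by simp
qed

lemma rf_e: "s \<in> S \<Longrightarrow> t \<in> S \<Longrightarrow> s \<noteq> t \<Longrightarrow> rf s (e t) = (if s \<otimes> t = t \<otimes> s then e t else e t + e s)"
  by (simp add: rf_def A_ee cart_def)

text \<open>Split off a right descent \<open>t\<close> of \<open>w\<close>. It fixes
  \<open>e s\<close> or replaces it by \<open>e s + e t\<close>, and induction applies to the
  summands, unless the shorter element also has the right descent \<open>s\<close>; then both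
  letters are split off together.\<close>

lemma act_simple_nonneg:
  assumes "w \<in> carrier G" "s \<in> S" "len w < len (w \<otimes> s)"
  shows "nonneg (act w (e s))"
  using assms
proof (induction "len w" arbitrary: w s rule: less_induct)
  case less
  show ?case
  proof (cases "w = \<one>")
    case False
    then obtain t where t: "t \<in> S" "len (w \<otimes> t) < len w" using right_descent_exists less.prems by blast
    then have ts: "t \<noteq> s" using less.prems by auto
    define v where "v = w \<otimes> t"
    have v: "v \<in> carrier G" "w = v \<otimes> t" "len v < len w" using t less.prems by (auto simp: v_def)
    have lv: "len w = Suc (len v)" using len_mult_right[OF t(1) v(1)] v by auto
    have aw: "act w (e s) = act v (rf t (e s))" using v t by (simp add: act_mult)
    show ?thesis
    proof (cases "t \<otimes> s = s \<otimes> t")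
      case True
      have "len v < len (v \<otimes> s)"
      proof (rule ccontr)
        assume "\<not> ?thesis"
        then have l: "Suc (len (v \<otimes> s)) = len v" using len_mult_right[OF less.prems(2) v(1)] by auto
        have "w \<otimes> s = v \<otimes> s \<otimes> t" using v t less.prems True by (simp add: m_assoc)
        then have "len (w \<otimes> s) \<le> Suc (len (v \<otimes> s))" using len_mult_right[of t "v \<otimes> s"] t v less.prems by auto
        then show False using l lv less.prems by simp
      qed
      then show ?thesis using less.hyps[OF v(3) v(1) less.prems(2)] aw rf_e[of t s] t ts less.prems True by simp
    next
      case False
      have br: "t \<otimes> s \<otimes> t = s \<otimes> t \<otimes> s" using cox_m_cases[of t s] False ts t less.prems by auto
      have ts': "rf t (e s) = e s + e t" using rf_e[of t s] t ts less.prems False by simp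
      show ?thesis
      proof (cases "len v < len (v \<otimes> s)")
        case True
        then have "nonneg (act v (e s))" using less.hyps[OF v(3) v(1) less.prems(2)] by simp
        moreover have "nonneg (act v (e t))" using less.hyps[OF v(3) v(1) t(1)] v by simp
        ultimately show ?thesis using aw ts' v by (simp add: nonneg_add)
      next
        case nl: False
        \<comment> \<open>Now \<open>w = u s t\<close> and \<open>s t\<close> sends
          \<open>e s\<close> to \<open>e t\<close>, so only \<open>u\<close> and \<open>e t\<close>
          remain. If \<open>t\<close> were a descent of \<open>u\<close>, the braid relation would
          make \<open>w s\<close> too short.\<close>
        define u where "u = v \<otimes> s"
        have u: "u \<in> carrier G" "v = u \<otimes> s" using v less.prems by (auto simp: u_def)
        have lu: "len v = Suc (len u)" using nl len_mult_right[OF less.prems(2) v(1)] by (auto simp: u_def)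
        have "rf s (e s + e t) = e t" using rf_e[of s t] t ts less.prems False by auto
        then have a: "act w (e s) = act u (e t)" unfolding aw ts' using u less.prems by (simp only: act_mult act_S S_carrier)
        have "len u < len (u \<otimes> t)"
        proof (rule ccontr)
          assume "\<not> ?thesis"
          then have l: "Suc (len (u \<otimes> t)) = len u" using len_mult_right[OF t(1) u(1)] by auto
          have "w = (u \<otimes> t) \<otimes> (t \<otimes> s \<otimes> t)" using v u t less.prems by (simp flip: m_assoc)
          then have "w = (u \<otimes> t) \<otimes> (s \<otimes> t \<otimes> s)" using br by simp
          then have "w \<otimes> s = u \<otimes> t \<otimes> s \<otimes> t" using u t less.prems by (simp add: m_assoc)
          then have "len (w \<otimes> s) \<le> Suc (len (u \<otimes> t \<otimes> s))" using len_mult_right[of t "u \<otimes> t \<otimes> s"] t u less.prems by auto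
          also have "\<dots> \<le> Suc (Suc (len (u \<otimes> t)))" using len_mult_right[of s "u \<otimes> t"] t u less.prems by auto
          finally show False using l lv lu less.prems by simp
        qed
        then show ?thesis using less.hyps[of u t] a u t lu lv by simp
      qed
    qed
  qed simp
qed

lemma act_simple_nonpos:
  assumes "w \<in> carrier G" "s \<in> S" "len (w \<otimes> s) < len w"
  shows "nonneg (- act w (e s))"
proof -
  have "nonneg (act (w \<otimes> s) (e s))" using assms by (intro act_simple_nonneg) auto
  then show ?thesis using assms by (simp add: act_mult)
qed

lemma RtI: "w \<in> carrier G \<Longrightarrow> s \<in> S \<Longrightarrow> act w (e s) \<in> Rt"
  by (auto simp: Rt_def)

lemma Rt_e [simp]: "s \<in> S \<Longrightarrow> e s \<in> Rt" using RtI[of \<one> s] by simp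

lemma Rt_act [simp]: "w \<in> carrier G \<Longrightarrow> x \<in> Rt \<Longrightarrow> act w x \<in> Rt"
  unfolding Rt_def by clarsimp (metis act_mult m_closed)

lemma Rt_rf [simp]: "s \<in> S \<Longrightarrow> x \<in> Rt \<Longrightarrow> rf s x \<in> Rt"
  using Rt_act[of s x] by simp

lemma Rt_neg [simp]: "- x \<in> Rt \<longleftrightarrow> x \<in> Rt"
proof -
  have "- x \<in> Rt" if x: "x \<in> Rt" for x
  proof -
    obtain w s where ws: "w \<in> carrier G" "s \<in> S" "x = act w (e s)" using x unfolding Rt_def by blast
    then have "- x = act (w \<otimes> s) (e s)" by (simp add: act_mult)
    moreover have "act (w \<otimes> s) (e s) \<in> Rt" using ws by (intro RtI) auto
    ultimately show ?thesis by simp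
  qed
  from this[of x] this[of "- x"] show ?thesis by auto
qed

lemma Rt_Lat: "x \<in> Rt \<Longrightarrow> x \<in> Lat" by (auto simp: Rt_def)

lemma Rt_A [simp]: "x \<in> Rt \<Longrightarrow> A x x = 2" by (auto simp: Rt_def)

lemma finite_Rt: "finite Rt"
proof -
  have "Rt = (\<lambda>(w, s). act w (e s)) ` (carrier G \<times> S)" by (auto simp: Rt_def)
  then show ?thesis using fin by simp
qed

lemma Rt_cases: "x \<in> Rt \<Longrightarrow> nonneg x \<or> nonneg (- x)"
proof -
  assume "x \<in> Rt"
  then obtain w s where "w \<in> carrier G" "s \<in> S" "x = act w (e s)" by (auto simp: Rt_def)
  then show ?thesis using act_simple_nonneg[of w s] act_simple_nonpos[of w s] len_mult_right[of s w] by auto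
qed

lemma Rt_nonzero: "0 \<notin> Rt" using Rt_A[of 0] by auto

lemma nonneg_not_both: "nonneg x \<Longrightarrow> nonneg (- x) \<Longrightarrow> x = 0"
  by (auto simp: nonneg_def fun_eq_iff intro: antisym)

lemma Rt_neg_iff: "x \<in> Rt \<Longrightarrow> nonneg (- x) \<longleftrightarrow> \<not> nonneg x"
  using Rt_cases nonneg_not_both Rt_nonzero by metis

text \<open>The dictionary between lengths and signs of roots; the later case distinctions about
  panels are phrased with signs.\<close>

lemma right_ascent_iff: "w \<in> carrier G \<Longrightarrow> s \<in> S \<Longrightarrow> len w < len (w \<otimes> s) \<longleftrightarrow> nonneg (act w (e s))"
  using act_simple_nonneg[of w s] act_simple_nonpos[of w s] len_mult_right[of s w] Rt_neg_iff[of "act w (e s)"]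
  by (auto simp: RtI)

lemma left_ascent_iff: assumes "w \<in> carrier G" "s \<in> S"
  shows "len w < len (s \<otimes> w) \<longleftrightarrow> nonneg (act (inv w) (e s))"
proof -
  have "len (s \<otimes> w) = len (inv w \<otimes> s)"
    using len_inv[of "s \<otimes> w"] assms by (simp add: inv_mult_group del: len_inv)
  then show ?thesis using right_ascent_iff[of "inv w" s] assms by simp
qed

lemma Rt_multiple: assumes "x \<in> Rt" "nonneg x" "s \<in> S" "\<And>t. t \<noteq> s \<Longrightarrow> x t = 0" shows "x = e s"
proof -
  have x: "x = scl (x s) (e s)" using assms(4) by (auto simp: scl_def e_def fun_eq_iff)
  have "A x x = x s * x s * 2" by (subst (1 2) x) (use assms(3) in simp)
  then have 1: "x s * x s = 1" using assms by simp
  have "0 \<le> x s" using assms by (simp add: nonneg_def)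
  then have "x s = 1" using 1 by (metis abs_of_nonneg zmult_eq_1_iff zero_neq_neg_one neg_0_le_iff_le not_one_le_zero)
  then show ?thesis using x by simp
qed

text \<open>A positive root other than \<open>e s\<close> has a positive coordinate at another node.
  The reflection leaves it unchanged, and the coordinates of a root never have mixed signs.\<close>

lemma rf_nonneg: assumes "x \<in> Rt" "nonneg x" "s \<in> S" "x \<noteq> e s" shows "nonneg (rf s x)"
proof -
  obtain t where t: "t \<noteq> s" "x t \<noteq> 0" using Rt_multiple assms by blast
  then have "rf s x t > 0" using assms(2) by (simp add: rf_def scl_def e_def nonneg_def order_less_le)
  then have "\<not> nonneg (- rf s x)" by (auto simp: nonneg_def not_le)
  then show ?thesis using Rt_neg_iff[of "rf s x"] assms by simp
qed

lemma nonneg_sum_ne_e: assumes "x \<in> Rt" "y \<in> Rt" "nonneg x" "nonneg y" "s \<in> S" shows "x + y \<noteq> e s"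
proof
  assume eq: "x + y = e s"
  have z: "x t = 0 \<and> y t = 0" if "t \<noteq> s" for t
  proof -
    have "x t + y t = 0" using fun_cong[OF eq, of t] that by (simp add: e_def)
    moreover have "0 \<le> x t" "0 \<le> y t" using assms by (auto simp: nonneg_def)
    ultimately show ?thesis by auto
  qed
  have "x = e s" "y = e s" using Rt_multiple[of x s] Rt_multiple[of y s] z assms by auto
  then have "e s s = (0::int)" using eq by simp
  then show False by (simp add: e_def)
qed

lemma refl_Rt: assumes "x \<in> Rt" "y \<in> Rt" shows "y - scl (A x y) x \<in> Rt"
proof -
  obtain w s where ws: "w \<in> carrier G" "s \<in> S" "x = act w (e s)" using assms by (auto simp: Rt_def)
  have scl: "act w (scl k z) = scl k (act w z)" for k z using ws(1)
    by (induction w rule: W_induct) (simp_all add: act_S_mult rf_scl)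
  have "act (w \<otimes> s \<otimes> inv w) y = y - scl (A (e s) (act (inv w) y)) x"
    using ws by (simp add: act_mult m_assoc rf_def scl)
  moreover have "A (e s) (act (inv w) y) = A x y" using ws A_act_inv by simp
  moreover have "act (w \<otimes> s \<otimes> inv w) y \<in> Rt" using ws assms by simp
  ultimately show ?thesis by simp
qed

subsection \<open>Positive definiteness\<close>

lemma edge_iff: "s \<in> S \<Longrightarrow> t \<in> S \<Longrightarrow> cox_m G s t \<ge> 3 \<longleftrightarrow> A (e s) (e t) = - 1"
  using cox_m_cases[of s t] cox_m_self[of s] by (auto simp: A_ee cart_def)

lemma S_connected_induct [consumes 2]:
  assumes "s \<in> S" "t \<in> S" "P s"
    and step: "\<And>q r. q \<in> S \<Longrightarrow> r \<in> S \<Longrightarrow> A (e q) (e r) = - 1 \<Longrightarrow> P q \<Longrightarrow> P r"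
  shows "P t"
proof -
  have "(s, t) \<in> {(a, b). a \<in> S \<and> b \<in> S \<and> cox_m G a b \<ge> 3}\<^sup>*"
    using irr assms by (auto simp: irreducible_cox_def)
  then show ?thesis
    by (induction rule: rtrancl_induct) (use assms edge_iff in auto)
qed

lemma neighbour_exists: assumes "s \<in> S" obtains r where "r \<in> S" "A (e s) (e r) = - 1"
proof -
  have "\<not> S \<subseteq> {s}" using rank card_mono[of "{s}" S] by auto
  then obtain t where t: "t \<in> S" "t \<noteq> s" by auto
  have "t = s \<or> (\<exists>r\<in>S. A (e s) (e r) = - 1)"
    using assms t(1)
  proof (induction rule: S_connected_induct)
    case (2 q r) then show ?case by blast
  qed simp
  then show ?thesis using t that by blast
qed

text \<open>The average of the standard inner product over the group. By irreducibility \<open>A\<close> is a positive multiple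
  of it, hence positive definite.\<close>
definition P :: "('a \<Rightarrow> int) \<Rightarrow> ('a \<Rightarrow> int) \<Rightarrow> int" where
  "P x y = (\<Sum>w\<in>carrier G. \<Sum>s\<in>S. act w x s * act w y s)"

lemma P_sym: "P x y = P y x" by (simp add: P_def mult.commute)

lemma P_add2: "P x (y + z) = P x y + P x z"
  by (simp add: P_def sum.distrib algebra_simps)

lemma P_neg1: "P (- x) y = - P x y"
  by (simp add: P_def sum_negf)

lemma act_scl [simp]: "w \<in> carrier G \<Longrightarrow> act w (scl k z) = scl k (act w z)"
  by (induction w rule: W_induct) (simp_all add: act_S_mult rf_scl)

lemma P_scl2: "P x (scl k y) = k * P x y"
  by (simp add: P_def sum_distrib_left mult.left_commute) (simp add: scl_def mult.left_commute)

lemma P_invariant: assumes "v \<in> carrier G" shows "P (act v x) (act v y) = P x y"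
proof -
  have b: "bij_betw (\<lambda>w. w \<otimes> v) (carrier G) (carrier G)"
    by (rule bij_betwI[of _ _ _ "\<lambda>w. w \<otimes> inv v"]) (use assms in \<open>auto simp: m_assoc\<close>)
  have "P x y = (\<Sum>w\<in>carrier G. \<Sum>s\<in>S. act (w \<otimes> v) x s * act (w \<otimes> v) y s)"
    unfolding P_def by (rule sum.reindex_bij_betw[OF b, symmetric])
  also have "\<dots> = P (act v x) (act v y)"
    unfolding P_def by (rule sum.cong[OF HOL.refl]) (use assms in \<open>simp add: act_mult\<close>)
  finally show ?thesis by simp
qed

text \<open>\<open>rf s\<close> preserves \<open>P\<close> and negates \<open>e s\<close>; this
  determines \<open>P (e s) y\<close> up to the factor \<open>P (e s) (e s)\<close>.\<close>

lemma P_e: assumes "s \<in> S" shows "2 * P (e s) y = A (e s) y * P (e s) (e s)"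
proof -
  have "P (rf s (e s)) (rf s y) = P (e s) y" using P_invariant[of s "e s" y] assms by (simp only: act_S S_carrier)
  then have "P (- e s) (rf s y) = P (e s) y" using assms by simp
  moreover have "rf s y = y + scl (- A (e s) y) (e s)" by (simp add: rf_def scl_neg)
  ultimately have "P (- e s) (y + scl (- A (e s) y) (e s)) = P (e s) y" using assms by simp
  then show ?thesis by (simp add: P_neg1 P_add2 P_scl2)
qed

lemma P_self: "0 \<le> P x x" and P_self_pos: "x \<in> Lat \<Longrightarrow> x \<noteq> 0 \<Longrightarrow> 0 < P x x"
proof -
  show 0: "0 \<le> P x x" for x unfolding P_def by (intro sum_nonneg) auto
  assume x: "x \<in> Lat" "x \<noteq> 0"
  then obtain t where "x t \<noteq> 0" by (auto simp: fun_eq_iff)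
  then have t: "t \<in> S" "x t * x t > 0" using x by (auto simp: Lat_def zero_less_mult_iff)
  have "0 < x t * x t" using t by simp
  also have "\<dots> \<le> (\<Sum>s\<in>S. x s * x s)" using t by (intro member_le_sum) auto
  also have "\<dots> = (\<Sum>s\<in>S. act \<one> x s * act \<one> x s)" by simp
  also have "\<dots> \<le> P x x" unfolding P_def
    using fin by (intro member_le_sum[of "\<one>" "carrier G" "\<lambda>w. \<Sum>s\<in>S. act w x s * act w x s"]) (auto intro: sum_nonneg)
  finally show "0 < P x x" .
qed

text \<open>Compare \<open>P_e\<close> at both ends of an edge, using that \<open>P\<close> and
  \<open>A\<close> are symmetric. This turns \<open>P_e\<close> into proportionality of the two
  forms.\<close>

lemma P_e_const: assumes "s \<in> S" "t \<in> S" shows "P (e t) (e t) = P (e s) (e s)"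
  using assms
proof (induction rule: S_connected_induct)
  case (2 q r)
  then show ?case using P_e[of q "e r"] P_e[of r "e q"] P_sym[of "e q" "e r"] A_sym[of "e q" "e r"] by simp
qed simp

lemma Lat_expand_P: assumes "x \<in> Lat" shows "P x y = (\<Sum>s\<in>S. x s * P (e s) y)"
proof -
  have sum: "P y (\<Sum>s\<in>F. scl (x s) (e s)) = (\<Sum>s\<in>F. x s * P y (e s))" if "finite F" for F
    using that
  proof (induction F)
    case empty
    show ?case using P_scl2[of y 0 0] by (simp add: zero_fun_def)
  next
    case (insert t F)
    have "(\<Sum>s\<in>insert t F. scl (x s) (e s)) = scl (x t) (e t) + (\<Sum>s\<in>F. scl (x s) (e s))"
      using insert by (intro sum.insert) auto
    then show ?case using insert by (simp only: P_add2 P_scl2) simp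
  qed
  have "(\<Sum>s\<in>S. scl (x s) (e s)) = x"
  proof
    fix t
    have "(\<Sum>s\<in>F. scl (x s) (e s)) t = (\<Sum>s\<in>F. scl (x s) (e s) t)" if "finite F" for F
      using that by (induction F) auto
    then have "(\<Sum>s\<in>S. scl (x s) (e s)) t = (\<Sum>s\<in>S. scl (x s) (e s) t)" by simp
    also have "\<dots> = (\<Sum>s\<in>S. if s = t then x t else 0)"
      by (intro sum.cong HOL.refl) (auto simp: scl_def e_def)
    also have "\<dots> = x t" using assms by (auto simp: Lat_def)
    finally show "(\<Sum>s\<in>S. scl (x s) (e s)) t = x t" .
  qed
  then have "P y x = (\<Sum>s\<in>S. x s * P y (e s))" using sum[OF finite_S] by simp
  then show ?thesis by (simp only: P_sym[of y])
qed

lemma A_pos: assumes "x \<in> Lat" "x \<noteq> 0" shows "0 < A x x"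
proof -
  obtain r where r: "r \<in> S" using rank by (metis card.empty ex_in_conv not_numeral_le_zero)
  have "2 * P x x = (\<Sum>s\<in>S. x s * (2 * P (e s) x))"
    by (subst Lat_expand_P[OF assms(1)]) (simp add: sum_distrib_left mult.left_commute)
  also have "\<dots> = (\<Sum>s\<in>S. x s * A (e s) x * P (e r) (e r))"
    by (intro sum.cong HOL.refl) (metis P_e P_e_const r mult.assoc)
  also have "\<dots> = A x x * P (e r) (e r)" by (simp add: A_expand[of x x] sum_distrib_right)
  finally have "A x x * P (e r) (e r) = 2 * P x x" by simp
  moreover have "0 < P x x" using P_self_pos assms by simp
  moreover have "0 \<le> P (e r) (e r)" by (rule P_self)
  ultimately show ?thesis by (metis mult_pos_pos zero_less_mult_pos2 zero_less_numeral order_less_le mult_zero_right)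
qed

lemma A_Rt_eq_2: assumes "x \<in> Rt" "y \<in> Rt" shows "A x y = 2 \<longleftrightarrow> x = y"
proof
  assume "A x y = 2"
  then have "A (x - y) (x - y) = 0" using assms A_sym[of x y] by simp
  then show "x = y" using A_pos[of "x - y"] assms Rt_Lat by force
qed (use assms in simp)

lemma A_Rt_eq_m2: assumes "x \<in> Rt" "y \<in> Rt" shows "A x y = - 2 \<longleftrightarrow> x = - y"
  using A_Rt_eq_2[of x "- y"] assms by simp linarith

lemma A_Rt_le: assumes "x \<in> Rt" "y \<in> Rt" shows "A x y \<le> 2"
proof (cases "x = y")
  case False
  then have "0 < A (x - y) (x - y)" using assms by (intro A_pos) (auto intro: Rt_Lat Lat_diff)
  then show ?thesis using assms A_sym[of x y] by simp
qed (use assms in simp)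

lemma A_Rt_ge: "x \<in> Rt \<Longrightarrow> y \<in> Rt \<Longrightarrow> - 2 \<le> A x y"
  using A_Rt_le[of x "- y"] by simp

lemma A_Rt_cases: assumes "x \<in> Rt" "y \<in> Rt"
  obtains "A x y = 2" "x = y" | "A x y = 1" | "A x y = 0" | "A x y = - 1" | "A x y = - 2" "x = - y"
proof -
  have "A x y = 2 \<or> A x y = 1 \<or> A x y = 0 \<or> A x y = - 1 \<or> A x y = - 2"
    using A_Rt_le[OF assms] A_Rt_ge[OF assms] by linarith
  then show ?thesis using that A_Rt_eq_2[OF assms] A_Rt_eq_m2[OF assms] by blast
qed

lemma Rt_add: "x \<in> Rt \<Longrightarrow> y \<in> Rt \<Longrightarrow> A x y = - 1 \<Longrightarrow> x + y \<in> Rt"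
  using refl_Rt[of x y] by (simp add: scl_neg add.commute)

lemma Rt_diff: "x \<in> Rt \<Longrightarrow> y \<in> Rt \<Longrightarrow> A x y = 1 \<Longrightarrow> x - y \<in> Rt"
  using Rt_add[of x "- y"] by simp

lemma odd_A_Rt: assumes "x \<in> Rt" "y \<in> Rt" "odd (A x y)" shows "A x y = 1 \<or> A x y = - 1"
  using A_Rt_cases[OF assms(1,2)] assms(3) by (metis even_zero even_numeral even_minus)

subsection \<open>Dominance and the highest root\<close>

definition dominant :: "('a \<Rightarrow> int) \<Rightarrow> bool" where "dominant x \<longleftrightarrow> (\<forall>s\<in>S. 0 \<le> A x (e s))"

lemma A_dominant_nonneg: assumes "dominant x" "nonneg y" shows "0 \<le> A y x"
  unfolding A_expand[of y] using assms A_sym[of x]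
  by (intro sum_nonneg mult_nonneg_nonneg) (auto simp: dominant_def nonneg_def)

text \<open>A vector of maximal height among the images under \<open>H\<close> cannot be raised by a
  reflection from \<open>I\<close>. \<open>H\<close> is a parameter because the statement is applied
  both to the whole group and to the subgroup generated by \<open>K\<close>.\<close>

lemma dominant_conjugate_in:
  assumes "H \<subseteq> carrier G" "\<one> \<in> H" "\<And>s h. s \<in> I \<Longrightarrow> h \<in> H \<Longrightarrow> s \<otimes> h \<in> H" "I \<subseteq> S"
  obtains v where "v \<in> H" "\<And>s. s \<in> I \<Longrightarrow> 0 \<le> A (act v z) (e s)"
proof -
  have "finite ((\<lambda>v. ht (act v z)) ` H)" using fin assms(1) finite_subset by blast
  moreover have "(\<lambda>v. ht (act v z)) ` H \<noteq> {}" using assms(2) by auto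
  ultimately obtain v where v: "v \<in> H" "\<And>u. u \<in> H \<Longrightarrow> ht (act u z) \<le> ht (act v z)"
    using Max_in Max_ge by (smt (verit) imageE imageI)
  have "0 \<le> A (act v z) (e s)" if "s \<in> I" for s
  proof -
    have "ht (act (s \<otimes> v) z) \<le> ht (act v z)" using v assms(3) that by blast
    moreover have "act (s \<otimes> v) z = rf s (act v z)" using v(1) that assms by (intro act_S_mult) auto
    ultimately show ?thesis using ht_rf[of s "act v z"] that assms(4) A_sym[of "e s" "act v z"] by auto
  qed
  then show ?thesis using that v by blast
qed

lemma dominant_conjugate: obtains v where "v \<in> carrier G" "dominant (act v z)"
  using dominant_conjugate_in[of "carrier G" S z thesis] by (auto simp: dominant_def)

text \<open>The support of a dominant root spreads along edges: at a neighbour \<open>r\<close> of a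
  support node, a vanishing coordinate would make \<open>A x (e r)\<close> negative.\<close>

lemma dominant_pos: assumes "x \<in> Rt" "dominant x" "s \<in> S" shows "nonneg x" "0 < x s"
proof -
  have "A x x > 0" using assms by simp
  show nn: "nonneg x"
  proof (rule ccontr)
    assume "\<not> nonneg x"
    then have "nonneg (- x)" using assms Rt_neg_iff by blast
    then have "0 \<le> A (- x) x" using assms A_dominant_nonneg by blast
    then show False using assms by simp
  qed
  have "x \<noteq> 0" using Rt_nonzero assms(1) by auto
  then obtain t where "x t \<noteq> 0" by (auto simp: fun_eq_iff)
  then have t: "t \<in> S" "x t \<noteq> 0" using Rt_Lat[OF assms(1)] by (auto simp: Lat_def)
  then have "x t > 0" using nn by (simp add: nonneg_def order_less_le)
  with t(1) assms(3) show "0 < x s"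
  proof (induction rule: S_connected_induct)
    case (2 q r)
    show ?case
    proof (rule ccontr)
      assume "\<not> 0 < x r"
      then have xr: "x r = 0" using nn by (simp add: nonneg_def order_less_le)
      have "A x (e r) = (\<Sum>s\<in>S. x s * A (e s) (e r))" by (rule A_expand)
      also have "\<dots> = x q * A (e q) (e r) + (\<Sum>s\<in>S - {q}. x s * A (e s) (e r))"
        using 2 by (simp add: sum.remove)
      also have "(\<Sum>s\<in>S - {q}. x s * A (e s) (e r)) \<le> 0"
      proof (rule sum_nonpos)
        fix s assume s: "s \<in> S - {q}"
        then show "x s * A (e s) (e r) \<le> 0"
          using xr nn A_e_le[of s r] 2 by (cases "s = r") (auto simp: nonneg_def mult_nonneg_nonpos)
      qed
      finally have "A x (e r) < 0" using 2 by simp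
      then show False using assms 2 by (auto simp: dominant_def)
    qed
  qed
qed

text \<open>Full support rules out orthogonality. If the inner product were 1, then
  \<open>x - y\<close> would be a root pairing to 1 with \<open>x\<close> and to -1 with
  \<open>y\<close>; whatever its sign, this contradicts the dominance of one of them.\<close>

lemma dominant_root_unique: assumes x: "x \<in> Rt" "dominant x" and y: "y \<in> Rt" "dominant y" shows "x = y"
proof -
  have le: "A x y \<ge> 0" using A_dominant_nonneg dominant_pos x y by (metis neighbour_exists rank card.empty ex_in_conv not_numeral_le_zero)
  have "A x y \<noteq> 0"
  proof
    assume "A x y = 0"
    then have "(\<Sum>s\<in>S. x s * A (e s) y) = 0" by (simp add: A_expand[of x])
    then have z: "\<forall>s\<in>S. x s * A (e s) y = 0"
      using x y by (subst (asm) sum_nonneg_eq_0_iff) (auto intro!: mult_nonneg_nonneg simp: dominant_pos less_imp_le dominant_def A_sym[of _ y])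
    then have "\<forall>s\<in>S. A (e s) y = 0" using dominant_pos(2)[OF x] by fastforce
    then have "A y y = 0" by (simp add: A_expand[of y])
    then show False using y by simp
  qed
  moreover have "A x y \<noteq> 1"
  proof
    assume 1: "A x y = 1"
    then have r: "x - y \<in> Rt" using Rt_diff x y by blast
    have s: "A (x - y) x = 1" "A (x - y) y = - 1" using 1 A_sym[of x y] x y by auto
    show False using Rt_cases[OF r] A_dominant_nonneg[of y "x - y"] A_dominant_nonneg[of x "- (x - y)"] s x y by (auto simp: A_sym)
  qed
  ultimately have "A x y = 2" using le A_Rt_le[of x y] x y by linarith
  then show ?thesis using A_Rt_eq_2 x y by blast
qed

text \<open>The highest root, introduced through dominance because that is the property used;
  \<open>highest_root_phi\<close> identifies it with the root of maximal height.\<close>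

definition phi :: "'a \<Rightarrow> int" where "phi = (SOME x. x \<in> Rt \<and> dominant x)"

lemma phi_Rt [simp]: "phi \<in> Rt" and phi_dominant: "dominant phi"
proof -
  obtain r where r: "r \<in> S" using rank by (metis card.empty ex_in_conv not_numeral_le_zero)
  obtain v where "v \<in> carrier G" "dominant (act v (e r))" using dominant_conjugate by blast
  then have "\<exists>x. x \<in> Rt \<and> dominant x" using RtI r by blast
  from someI_ex[OF this] show "phi \<in> Rt" "dominant phi" by (auto simp: phi_def)
qed

lemma root_conjugate_phi: assumes "x \<in> Rt" obtains v where "v \<in> carrier G" "act v phi = x"
proof -
  obtain v where v: "v \<in> carrier G" "dominant (act v x)" using dominant_conjugate by blast
  then have "act v x = phi" using dominant_root_unique phi_dominant assms by simp
  then have "act (inv v) phi = x" using v act_inv_act by metis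
  then show ?thesis using that[of "inv v"] v by simp
qed

text \<open>\<open>J\<close> turns out to be the polar type (\<open>polar_type_J\<close>), and its
  complement \<open>K\<close> in \<open>S\<close> generates the stabilizer of \<open>phi\<close>
  (\<open>stabilizer_phi\<close>).\<close>

definition J :: "'a set" where "J = {j \<in> S. A (e j) phi = 1}"
definition K :: "'a set" where "K = S - J"

lemma phi_ne_e: "s \<in> S \<Longrightarrow> phi \<noteq> e s"
proof
  assume s: "s \<in> S" "phi = e s"
  then obtain r where "r \<in> S" "A (e s) (e r) = - 1" using neighbour_exists by blast
  then show False using phi_dominant s by (auto simp: dominant_def)
qed

lemma A_phi_e: assumes "s \<in> S" shows "A (e s) phi = (if s \<in> J then 1 else 0)"
proof -
  have "A (e s) phi \<ge> 0" using phi_dominant assms by (simp add: dominant_def A_sym)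
  moreover have "A (e s) phi \<noteq> 2" using phi_ne_e[OF assms] A_Rt_eq_2[of "e s" phi] assms by auto
  ultimately show ?thesis using A_Rt_le[of "e s" phi] assms by (auto simp: J_def)
qed

lemma J_sub: "J \<subseteq> S" "j \<in> J \<Longrightarrow> j \<in> S" and K_sub: "K \<subseteq> S" "k \<in> K \<Longrightarrow> k \<in> S"
  by (auto simp: J_def K_def)

lemma A_phi_J [simp]: "j \<in> J \<Longrightarrow> A (e j) phi = 1" "j \<in> J \<Longrightarrow> A phi (e j) = 1"
  and A_phi_K [simp]: "k \<in> K \<Longrightarrow> A (e k) phi = 0" "k \<in> K \<Longrightarrow> A phi (e k) = 0"
  by (auto simp: J_def K_def A_phi_e A_sym[of phi])

lemma rf_phi_K [simp]: "k \<in> K \<Longrightarrow> rf k phi = phi" by (simp add: rf_def)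

lemma rf_phi_J: "j \<in> J \<Longrightarrow> rf j phi = phi - e j" by (simp add: rf_def)

lemma A_phi_pos_nonneg: assumes "x \<in> Rt" "A x phi > 0" shows "nonneg x"
proof (rule ccontr)
  assume "\<not> nonneg x"
  then have "nonneg (- x)" using assms Rt_neg_iff by blast
  then show False using A_dominant_nonneg[OF phi_dominant, of "- x"] assms by simp
qed

text \<open>All terms in the expansion of \<open>A x phi\<close> are nonnegative, hence zero. So
  within \<open>S\<close> such a vector is supported on \<open>K\<close>.\<close>

lemma phi_perp_J: assumes "nonneg x" "A x phi = 0" "j \<in> J" shows "x j = 0"
proof -
  have "(\<Sum>s\<in>S. x s * A (e s) phi) = 0" using assms by (simp add: A_expand[of x])
  then have "\<forall>s\<in>S. x s * A (e s) phi = 0"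
    using assms by (subst (asm) sum_nonneg_eq_0_iff) (auto simp: A_phi_e nonneg_def)
  then show ?thesis using assms J_sub by fastforce
qed

lemma phi_perp_le: assumes "nonneg x" "A x phi = 0" "j \<in> J" shows "A x (e j) \<le> 0"
  unfolding A_expand[of x]
proof (rule sum_nonpos)
  fix s assume s: "s \<in> S"
  show "x s * A (e s) (e j) \<le> 0"
    using assms phi_perp_J[OF assms] A_e_le[of s j] s J_sub by (cases "s = j") (auto simp: nonneg_def mult_nonneg_nonpos)
qed

lemma phi_perp_neg_ge: "nonneg (- x) \<Longrightarrow> A x phi = 0 \<Longrightarrow> j \<in> J \<Longrightarrow> 0 \<le> A x (e j)"
  using phi_perp_le[of "- x" j] by simp

lemma raising_exists: assumes "x \<in> Rt" "x \<noteq> phi" obtains t where "t \<in> S" "A x (e t) < 0"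
proof -
  have "\<not> dominant x" using assms dominant_root_unique[of x phi] phi_dominant by auto
  then show ?thesis using that unfolding dominant_def by (meson not_le)
qed

lemma phi_perp_K_sum: assumes "nonneg x" "A x phi = 0" shows "A x y = (\<Sum>k\<in>K. x k * A (e k) y)"
proof -
  have "(\<Sum>s\<in>S. x s * A (e s) y) = (\<Sum>k\<in>K. x k * A (e k) y)"
    by (rule sum.mono_neutral_right) (auto simp: K_def phi_perp_J[OF assms])
  then show ?thesis by (simp add: A_expand[of x])
qed

text \<open>Some \<open>e j\<close> with \<open>j\<close> in \<open>J\<close> pairs positively with
  \<open>b\<close>, since otherwise \<open>A b b\<close> could not be positive. If \<open>b\<close>
  were not \<open>e j\<close>, then \<open>b - e j\<close> would be a positive root supported on
  \<open>K\<close>, pairing with \<open>b\<close> both to 1 and to a nonpositive number.\<close>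

lemma level1_antidominant: assumes b: "b \<in> Rt" "A b phi = 1" and anti: "\<And>k. k \<in> K \<Longrightarrow> A b (e k) \<le> 0"
  obtains j where "j \<in> J" "b = e j"
proof -
  have nb: "nonneg b" using A_phi_pos_nonneg b by simp
  have "\<exists>j\<in>J. A b (e j) > 0"
  proof (rule ccontr)
    assume "\<not> ?thesis"
    then have "\<And>s. s \<in> S \<Longrightarrow> A (e s) b \<le> 0" using anti by (force simp: K_def A_sym[of b])
    then have "A b b \<le> 0" unfolding A_expand[of b b] using nb by (intro sum_nonpos) (auto simp: nonneg_def mult_nonneg_nonpos)
    then show False using b by simp
  qed
  then obtain j where j: "j \<in> J" "A b (e j) > 0" by blast
  show ?thesis
  proof (cases "b = e j")
    case False
    then have 1: "A b (e j) = 1" using A_Rt_le[of b "e j"] A_Rt_eq_2[of b "e j"] b j J_sub by force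
    define k where "k = b - e j"
    have k: "k \<in> Rt" "A k phi = 0" "A k b = 1" using 1 b j J_sub Rt_diff[of b "e j"] by (auto simp: k_def A_sym)
    have "nonneg k" using rf_nonneg[of b j] b nb False j J_sub 1 by (simp add: k_def rf_def A_sym)
    then have "A k b = (\<Sum>i\<in>K. k i * A (e i) b)" using phi_perp_K_sum k by blast
    also have "\<dots> \<le> 0" using anti \<open>nonneg k\<close> by (intro sum_nonpos) (auto simp: A_sym[of _ b] nonneg_def mult_nonneg_nonpos)
    finally show ?thesis using k by simp
  qed (use that j in blast)
qed

lemma generate_K_sub: "generate G K \<subseteq> carrier G"
  using generate_incl K_sub(1) S_sub by blast

lemma generate_K_mult: "s \<in> K \<Longrightarrow> h \<in> generate G K \<Longrightarrow> s \<otimes> h \<in> generate G K"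
  by (simp add: generate.eng generate.incl)

lemma generate_K_act_phi: "h \<in> generate G K \<Longrightarrow> act h phi = phi"
proof (induction rule: generate.induct)
  case (inv k) then show ?case using K_sub by simp
next
  case (eng a b)
  then have "a \<in> carrier G" "b \<in> carrier G" using generate_K_sub by auto
  then show ?case using eng by (simp add: act_mult)
qed (use K_sub in auto)

text \<open>A right descent \<open>t\<close> in \<open>J\<close> is impossible: the image of
  \<open>e t\<close> would have inner product 1 with \<open>phi\<close> and so be positive. Hence
  every descent lies in \<open>K\<close> and can be split off.\<close>

lemma stabilizer_phi: assumes "w \<in> carrier G" "act w phi = phi" shows "w \<in> generate G K"
  using assms
proof (induction "len w" arbitrary: w rule: less_induct)
  case less
  show ?case
  proof (cases "w = \<one>")
    case False
    then obtain t where t: "t \<in> S" "len (w \<otimes> t) < len w" using right_descent_exists less.prems by blast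
    have tK: "t \<in> K"
    proof (rule ccontr)
      assume "t \<notin> K"
      then have "A (act w (e t)) (act w phi) = 1" using t less.prems(1) by (simp add: K_def)
      then have "nonneg (act w (e t))" using A_phi_pos_nonneg RtI t less.prems by auto
      then show False using right_ascent_iff t less.prems by force
    qed
    have "w \<otimes> t \<in> generate G K" using less.hyps[OF t(2)] t tK less.prems by (simp add: act_mult)
    then have "(w \<otimes> t) \<otimes> t \<in> generate G K" using tK generate.eng generate.incl by metis
    then show ?thesis using t less.prems by simp
  qed (simp add: generate.one)
qed

text \<open>Making \<open>b\<close> dominant for \<open>K\<close> makes \<open>phi - b\<close>
  antidominant for \<open>K\<close>, and \<open>level1_antidominant\<close> applies to the
  latter.\<close>

lemma level1_conjugate: assumes b: "b \<in> Rt" "A b phi = 1"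
  obtains v j where "v \<in> generate G K" "j \<in> J" "act v b = phi - e j"
proof -
  obtain v where v: "v \<in> generate G K" "\<And>s. s \<in> K \<Longrightarrow> 0 \<le> A (act v b) (e s)"
    using dominant_conjugate_in[of "generate G K" K b] generate_K_sub generate_K_mult generate.one K_sub by metis
  have vc: "v \<in> carrier G" using v generate_K_sub by auto
  have 1: "A (act v b) phi = 1"
    using A_act_act[OF vc, of b phi] generate_K_act_phi[OF v(1)] b by simp
  have "phi - act v b \<in> Rt" using Rt_diff[of phi "act v b"] 1 b vc by (simp add: A_sym)
  moreover have "A (phi - act v b) phi = 1" using 1 by simp
  moreover have "A (phi - act v b) (e k) \<le> 0" if "k \<in> K" for k using v(2)[OF that] that by simp
  ultimately obtain j where "j \<in> J" "phi - act v b = e j" using level1_antidominant by blast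
  then show ?thesis using that[of v j] v by (metis add_diff_cancel_left' diff_add_cancel)
qed

subsection \<open>Comparison with the real root system\<close>

definition re :: "('a \<Rightarrow> int) \<Rightarrow> 'a \<Rightarrow> real" where "re x = (\<lambda>t. real_of_int (x t))"

lemma cos_cox_m: assumes "s \<in> S" "t \<in> S" shows "- cos (pi / real (cox_m G s t)) = cart s t / 2"
proof (cases "s = t")
  case True then show ?thesis using cox_m_self assms by (simp add: cart_def)
next
  case False
  then show ?thesis using cox_m_cases[OF assms] by (auto simp: cart_def cos_60)
qed

lemma tits_form_re: "tits_form G S (re x) (re y) = A x y / 2"
  unfolding tits_form_def A_def re_def
  unfolding sum_divide_distrib of_int_sum by (intro sum.cong HOL.refl) (simp add: cos_cox_m del: mult_minus_right)

lemma simple_root_re: "simple_root s = re (e s)"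
  by (auto simp: simple_root_def re_def e_def)

lemma simple_refl_re: "simple_refl G S s (re x) = re (rf s x)"
  unfolding simple_refl_def simple_root_re tits_form_re by (auto simp: re_def rf_def scl_def)

lemma roots_re: "roots G S = re ` Rt"
proof
  show "roots G S \<subseteq> re ` Rt"
  proof
    fix v assume "v \<in> roots G S"
    then show "v \<in> re ` Rt"
      by (induction rule: roots.induct) (auto simp: simple_root_re simple_refl_re)
  qed
  have "re (act w (e s)) \<in> roots G S" if "w \<in> carrier G" "s \<in> S" for w s
    using that
  proof (induction w rule: W_induct)
    case one then show ?case using roots.simple[of s S G] by (simp add: simple_root_re)
  next
    case (mult t w)
    then have "simple_refl G S t (re (act w (e s))) \<in> roots G S" by (intro roots.refl) auto
    then show ?case using mult by (simp add: simple_refl_re act_S_mult)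
  qed
  then show "re ` Rt \<subseteq> roots G S" by (auto simp: Rt_def)
qed

lemma root_height_re: "root_height S (re x) = ht x"
  by (simp add: root_height_def re_def ht_def)

lemma highest_root_phi: "highest_root G S \<psi> \<longleftrightarrow> \<psi> = re phi"
proof -
  have max: "x = phi" if "x \<in> Rt" "\<forall>y\<in>Rt. ht y \<le> ht x" for x
  proof -
    have "0 \<le> A x (e s)" if s: "s \<in> S" for s
      using ht_rf[OF s, of x] Rt_rf[OF s] \<open>x \<in> Rt\<close> \<open>\<forall>y\<in>Rt. ht y \<le> ht x\<close> A_sym[of x] by fastforce
    then show ?thesis using dominant_root_unique phi_dominant that by (simp add: dominant_def)
  qed
  have fi: "finite (ht ` Rt)" "ht ` Rt \<noteq> {}" using finite_Rt phi_Rt by (auto simp del: phi_Rt)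
  obtain x where x: "x \<in> Rt" "ht x = Max (ht ` Rt)" using Max_in[OF fi] by auto
  then have "\<forall>y\<in>Rt. ht y \<le> ht x" using Max_ge[OF fi(1)] by simp
  with x(1) have "\<forall>y\<in>Rt. ht y \<le> ht phi" using max by blast
  then show ?thesis unfolding highest_root_def roots_re using max
    by (auto simp: root_height_re)
qed

lemma polar_type_J: "polar_type G S = J"
  unfolding polar_type_def highest_root_phi J_def
  by (auto simp: simple_root_re tits_form_re A_phi_e split: if_splits)

end

section \<open>Buildings\<close>

locale laced_building = simply_laced_coxeter G S for G (structure) and S +
  fixes Ch :: "'c set" and \<delta> :: "'c \<Rightarrow> 'c \<Rightarrow> 'a"
  assumes bld: "building G S Ch \<delta>" and thk: "thick G S Ch \<delta>"
begin

lemma \<delta>_closed [simp, intro]: "C \<in> Ch \<Longrightarrow> D \<in> Ch \<Longrightarrow> \<delta> C D \<in> carrier G"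
  using bld unfolding building_def by blast

lemma \<delta>_one_iff: "C \<in> Ch \<Longrightarrow> D \<in> Ch \<Longrightarrow> \<delta> C D = \<one> \<longleftrightarrow> C = D"
  using bld unfolding building_def by blast

lemma \<delta>_self [simp]: "C \<in> Ch \<Longrightarrow> \<delta> C C = \<one>"
  by (simp add: \<delta>_one_iff)

lemma left_step: "C \<in> Ch \<Longrightarrow> D \<in> Ch \<Longrightarrow> C' \<in> Ch \<Longrightarrow> s \<in> S \<Longrightarrow> \<delta> C' C = s \<Longrightarrow>
    \<delta> C' D = s \<otimes> \<delta> C D \<or> \<delta> C' D = \<delta> C D"
  using bld unfolding building_def by blast

lemma left_step_up: "C \<in> Ch \<Longrightarrow> D \<in> Ch \<Longrightarrow> C' \<in> Ch \<Longrightarrow> s \<in> S \<Longrightarrow> \<delta> C' C = s \<Longrightarrow>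
    len (\<delta> C D) < len (s \<otimes> \<delta> C D) \<Longrightarrow> \<delta> C' D = s \<otimes> \<delta> C D"
proof -
  assume *: "C \<in> Ch" "D \<in> Ch" "C' \<in> Ch" "s \<in> S" "\<delta> C' C = s" "len (\<delta> C D) < len (s \<otimes> \<delta> C D)"
  have "len (s \<otimes> \<delta> C D) = len (\<delta> C D) + 1" using len_mult_left[of s "\<delta> C D"] * by auto
  then show ?thesis using bld * unfolding building_def by blast
qed

lemma left_exists: "C \<in> Ch \<Longrightarrow> D \<in> Ch \<Longrightarrow> s \<in> S \<Longrightarrow> \<exists>C'\<in>Ch. \<delta> C' C = s \<and> \<delta> C' D = s \<otimes> \<delta> C D"
  using bld unfolding building_def by blast

lemma adj_sym: assumes "C \<in> Ch" "D \<in> Ch" "s \<in> S" "\<delta> C D = s" shows "\<delta> D C = s"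
proof -
  have "C \<noteq> D" using assms one_notin_S by auto
  then have "\<delta> D C \<noteq> \<one>" using assms \<delta>_one_iff by auto
  moreover have "\<one> = s \<otimes> \<delta> D C \<or> \<one> = \<delta> D C" using left_step[of D C C s] assms by simp
  ultimately have "s \<otimes> \<delta> D C = \<one>" by auto
  then have "s \<otimes> (s \<otimes> \<delta> D C) = s" using assms by simp
  then show ?thesis using assms by simp
qed

inductive gal :: "'c \<Rightarrow> 'a list \<Rightarrow> 'c \<Rightarrow> bool" where
  Nil: "C \<in> Ch \<Longrightarrow> gal C [] C"
| Cons: "C \<in> Ch \<Longrightarrow> s \<in> S \<Longrightarrow> \<delta> C D = s \<Longrightarrow> gal D ws E \<Longrightarrow> gal C (s # ws) E"

lemma gal_Ch: "gal C ws D \<Longrightarrow> C \<in> Ch \<and> D \<in> Ch"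
  by (induction rule: gal.induct) auto

lemma gal_S: "gal C ws D \<Longrightarrow> set ws \<subseteq> S"
  by (induction rule: gal.induct) auto

lemma gal_append: "gal C us D \<Longrightarrow> gal D ws E \<Longrightarrow> gal C (us @ ws) E"
  by (induction rule: gal.induct) (auto intro: gal.intros)

lemma gal_rev: "gal C ws D \<Longrightarrow> gal D (rev ws) C"
proof (induction rule: gal.induct)
  case (Cons C s D ws E)
  have "D \<in> Ch" using Cons gal_Ch by blast
  then have "gal D [s] C" using adj_sym[of C D s] Cons by (auto intro!: gal.intros)
  then show ?case using gal_append Cons by simp
qed (simp add: gal.intros)

lemma gal_reduced: "gal C ws D \<Longrightarrow> reduced ws \<Longrightarrow> \<delta> C D = wprod G ws"
proof (induction rule: gal.induct)
  case (Cons C s D ws E)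
  have D: "D \<in> Ch" "E \<in> Ch" using Cons gal_Ch by blast+
  have "reduced ws" "len (wprod G ws) < len (s \<otimes> wprod G ws)" using Cons by (auto simp: reduced_Cons_iff)
  then show ?case using left_step_up[of D E C s] Cons D by simp
qed simp

lemma gal_exists: "C \<in> Ch \<Longrightarrow> D \<in> Ch \<Longrightarrow> set ws \<subseteq> S \<Longrightarrow> \<delta> C D = wprod G ws \<Longrightarrow> gal C ws D"
proof (induction ws arbitrary: C)
  case Nil
  then have "C = D" using \<delta>_one_iff by simp
  then show ?case using Nil gal.Nil by simp
next
  case (Cons s ws)
  obtain C' where C': "C' \<in> Ch" "\<delta> C' C = s" "\<delta> C' D = s \<otimes> \<delta> C D"
    using left_exists[of C D s] Cons.prems by auto
  have "gal C' ws D" using Cons C' by auto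
  then show ?case using adj_sym[of C' C s] C' Cons.prems by (auto intro: gal.Cons)
qed

lemma \<delta>_inv: assumes "C \<in> Ch" "D \<in> Ch" shows "\<delta> D C = inv (\<delta> C D)"
proof -
  obtain ws where ws: "reduced ws" "wprod G ws = \<delta> C D"
    by (rule reduced_exists[of "\<delta> C D"]) (use assms in auto)
  have "gal C ws D" using gal_exists[OF assms, of ws] ws by (simp add: reduced_def)
  then have "\<delta> D C = wprod G (rev ws)" using gal_rev gal_reduced reduced_rev ws by blast
  then show ?thesis using ws wprod_rev by (simp add: reduced_def)
qed

lemma right_step: assumes "C \<in> Ch" "D \<in> Ch" "D' \<in> Ch" "s \<in> S" "\<delta> D D' = s"
  shows "\<delta> C D' = \<delta> C D \<otimes> s \<or> \<delta> C D' = \<delta> C D"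
proof -
  have "\<delta> D' C = s \<otimes> \<delta> D C \<or> \<delta> D' C = \<delta> D C" using left_step[of D C D' s] adj_sym[of D D' s] assms by blast
  then have "inv (\<delta> D' C) = inv (s \<otimes> \<delta> D C) \<or> inv (\<delta> D' C) = inv (\<delta> D C)" by auto
  then show ?thesis using assms \<delta>_inv[of D' C] \<delta>_inv[of D C] by (auto simp: inv_mult_group)
qed

lemma right_step_up: assumes "C \<in> Ch" "D \<in> Ch" "D' \<in> Ch" "s \<in> S" "\<delta> D D' = s"
    and "len (\<delta> C D) < len (\<delta> C D \<otimes> s)"
  shows "\<delta> C D' = \<delta> C D \<otimes> s"
proof -
  have i: "\<delta> D C = inv (\<delta> C D)" using assms \<delta>_inv by blast
  have "len (s \<otimes> \<delta> D C) = len (\<delta> C D \<otimes> s)"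
    using len_inv[of "\<delta> C D \<otimes> s"] assms i by (simp add: inv_mult_group del: len_inv)
  then have "\<delta> D' C = s \<otimes> \<delta> D C" using left_step_up[of D C D' s] adj_sym[of D D' s] assms i by simp
  then have "inv (\<delta> D' C) = \<delta> C D \<otimes> s" using i assms by (simp add: inv_mult_group)
  then show ?thesis using \<delta>_inv[of D' C] assms by simp
qed

lemma adj_trans: assumes "C \<in> Ch" "D \<in> Ch" "E \<in> Ch" "s \<in> S" "\<delta> C D = s" "\<delta> C E = s" "D \<noteq> E"
  shows "\<delta> D E = s"
proof -
  have "\<delta> D E = s \<otimes> \<delta> C E \<or> \<delta> D E = \<delta> C E" using left_step[of C E D s] adj_sym[of C D s] assms by blast
  then show ?thesis using assms \<delta>_one_iff[of D E] by auto
qed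

lemma third_chamber: assumes "C \<in> Ch" "s \<in> S" "D \<in> Ch"
  obtains E where "E \<in> Ch" "\<delta> C E = s" "E \<noteq> D"
proof -
  obtain D1 D2 where "D1 \<in> Ch" "D2 \<in> Ch" "D1 \<noteq> D2" "\<delta> C D1 = s" "\<delta> C D2 = s"
    using thk assms unfolding thick_def by blast
  then show ?thesis using that by metis
qed

lemma neighbour_chamber: assumes "C \<in> Ch" "s \<in> S" obtains E where "E \<in> Ch" "\<delta> C E = s"
  using third_chamber[OF assms assms(1)] by blast

lemma gal_left_mult: "set ws \<subseteq> S \<Longrightarrow> C \<in> Ch \<Longrightarrow> D \<in> Ch \<Longrightarrow>
    \<exists>E. gal C ws E \<and> \<delta> E D = inv (wprod G ws) \<otimes> \<delta> C D"
proof (induction ws arbitrary: C)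
  case Nil then show ?case by (auto intro!: exI[of _ C] gal.Nil)
next
  case (Cons s ws)
  obtain C' where C': "C' \<in> Ch" "\<delta> C' C = s" "\<delta> C' D = s \<otimes> \<delta> C D"
    using left_exists[of C D s] Cons.prems by auto
  obtain E where E: "gal C' ws E" "\<delta> E D = inv (wprod G ws) \<otimes> \<delta> C' D"
    using Cons.IH[of C'] Cons.prems C' by force
  have "gal C (s # ws) E" using E C' Cons.prems adj_sym[of C' C s] by (auto intro: gal.Cons)
  moreover have "\<delta> E D = inv (wprod G (s # ws)) \<otimes> \<delta> C D"
    using E C' Cons.prems by (simp add: inv_mult_group m_assoc)
  ultimately show ?case by blast
qed

text \<open>A substitute for picking a chamber in an apartment through \<open>C\<close> and
  \<open>D\<close>: both distances take the values they would have there.\<close>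

lemma apartment_chamber: assumes "C \<in> Ch" "D \<in> Ch" "v \<in> carrier G"
  obtains E where "E \<in> Ch" "\<delta> C E = v" "\<delta> E D = inv v \<otimes> \<delta> C D"
proof -
  obtain ws where ws: "reduced ws" "wprod G ws = v"
    by (rule reduced_exists[of v]) (use assms in auto)
  obtain E where E: "gal C ws E" "\<delta> E D = inv v \<otimes> \<delta> C D"
    using gal_left_mult[of ws C D] ws assms by (auto simp: reduced_def)
  then show ?thesis using that[of E] gal_reduced[OF E(1) ws(1)] gal_Ch ws by auto
qed

subsection \<open>Points of the long root geometry\<close>

text \<open>The root \<open>pos C D\<close> encodes the position of the point of \<open>D\<close> as seen from the chamber \<open>C\<close>.\<close>
definition pt :: "'c \<Rightarrow> 'c set" where "pt C = residue G Ch \<delta> K C"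
definition pos :: "'c \<Rightarrow> 'c \<Rightarrow> 'a \<Rightarrow> int" where "pos C D = act (\<delta> C D) phi"
definition ip :: "'c \<Rightarrow> 'c \<Rightarrow> int" where "ip C D = A phi (pos C D)"

lemma pos_Rt [simp]: "C \<in> Ch \<Longrightarrow> D \<in> Ch \<Longrightarrow> pos C D \<in> Rt"
  by (simp add: pos_def)

lemma generate_K_word: assumes "h \<in> generate G K" obtains ws where "set ws \<subseteq> K" "wprod G ws = h"
proof -
  have "\<exists>ws. set ws \<subseteq> K \<and> wprod G ws = h" using assms
  proof (induction rule: generate.induct)
    case one show ?case by (rule exI[of _ "[]"]) simp
  next
    case (incl k) then show ?case using K_sub by (intro exI[of _ "[k]"]) auto
  next
    case (inv k) then show ?case using K_sub by (intro exI[of _ "[k]"]) auto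
  next
    case (eng a b)
    then obtain us vs where "set us \<subseteq> K" "wprod G us = a" "set vs \<subseteq> K" "wprod G vs = b" by auto
    then show ?case using K_sub(1) set_S_carrier wprod_append[of us vs] by (intro exI[of _ "us @ vs"]) auto
  qed
  then show ?thesis using that by blast
qed

lemma gal_K_pos: "gal D ws D' \<Longrightarrow> set ws \<subseteq> K \<Longrightarrow> C \<in> Ch \<Longrightarrow> pos C D' = pos C D"
proof (induction rule: gal.induct)
  case (Cons D s E ws F)
  have E: "E \<in> Ch" using Cons gal_Ch by blast
  have "\<delta> C E = \<delta> C D \<otimes> s \<or> \<delta> C E = \<delta> C D" using right_step[of C D E s] Cons E by simp
  then have "pos C E = pos C D" using Cons by (auto simp: pos_def act_mult)
  then show ?case using Cons by simp
qed simp

lemma pos_cong: assumes "C \<in> Ch" "D \<in> Ch" "D' \<in> pt D" shows "pos C D' = pos C D"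
proof -
  have D': "D' \<in> Ch" "\<delta> D D' \<in> generate G K" using assms by (auto simp: pt_def residue_def)
  obtain ws where ws: "set ws \<subseteq> K" "wprod G ws = \<delta> D D'" using generate_K_word D' by blast
  then have "gal D ws D'" using gal_exists[of D D' ws] assms D' K_sub by auto
  then show ?thesis using gal_K_pos ws assms by blast
qed

lemma mem_pt_iff: assumes "C \<in> Ch" "D \<in> Ch" shows "D \<in> pt C \<longleftrightarrow> pos C D = phi"
  using assms stabilizer_phi[of "\<delta> C D"] generate_K_act_phi by (auto simp: pt_def residue_def pos_def)

lemma pt_self [simp]: "C \<in> Ch \<Longrightarrow> C \<in> pt C" by (simp add: mem_pt_iff pos_def)

lemma pt_Ch: "D \<in> pt C \<Longrightarrow> D \<in> Ch" by (simp add: pt_def residue_def)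

lemma pos_swap: assumes "C \<in> Ch" "D \<in> Ch" shows "ip C D = ip D C"
  using assms A_act_inv[of "\<delta> C D" phi phi] by (simp add: ip_def pos_def \<delta>_inv[of C D] A_sym[of phi])

lemma pt_sym: assumes "C \<in> Ch" "D \<in> pt C" shows "C \<in> pt D"
proof -
  have D: "D \<in> Ch" using assms pt_Ch by blast
  then have p: "act (\<delta> C D) phi = phi" using assms mem_pt_iff by (simp add: pos_def)
  have "act (inv (\<delta> C D)) (act (\<delta> C D) phi) = phi" using assms D by (intro act_inv_act) auto
  then have "pos D C = phi" using p \<delta>_inv[of C D] assms D by (simp add: pos_def)
  then show ?thesis using mem_pt_iff assms D by blast
qed

lemma pt_eq: assumes "C \<in> Ch" "D \<in> pt C" shows "pt D = pt C"
proof -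
  have sub: "pt D \<subseteq> pt C" if "C \<in> Ch" "D \<in> pt C" for C D
  proof
    fix E assume E: "E \<in> pt D"
    have "D \<in> Ch" using that pt_Ch by blast
    then have "pos C E = phi" using pos_cong[of C D E] E that mem_pt_iff by auto
    then show "E \<in> pt C" using mem_pt_iff[of C E] that(1) pt_Ch[OF E] by blast
  qed
  from sub[OF assms] sub[of D C] pt_sym[OF assms] pt_Ch assms show ?thesis by blast
qed

lemma pt_eq_iff: "C \<in> Ch \<Longrightarrow> D \<in> Ch \<Longrightarrow> pt C = pt D \<longleftrightarrow> ip C D = 2"
  using pt_eq mem_pt_iff A_Rt_eq_2[of phi "pos C D"] pt_self by (metis ip_def phi_Rt pos_Rt)

lemma ip_cong: assumes "C \<in> Ch" "D \<in> Ch" "C' \<in> pt C" "D' \<in> pt D" shows "ip C' D' = ip C D"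
proof -
  have Ch: "C' \<in> Ch" "D' \<in> Ch" using assms pt_Ch by blast+
  have "ip C' D' = ip C' D" using pos_cong[of C' D D'] assms Ch by (simp add: ip_def)
  also have "\<dots> = ip D C" using pos_cong[of D C C'] assms Ch pos_swap[of C' D] by (simp add: ip_def)
  finally show ?thesis using pos_swap assms by simp
qed

text \<open>Varying \<open>C\<close> inside its point lets the subgroup generated by
  \<open>K\<close> act on the left of the distance; this is how positions are normalized
  below.\<close>

lemma move_left: assumes "C \<in> Ch" "D \<in> Ch" "v \<in> generate G K"
  obtains C' where "C' \<in> pt C" "\<delta> C' D = v \<otimes> \<delta> C D"
proof -
  have v: "v \<in> carrier G" using assms generate_K_sub by auto
  have "inv v \<in> generate G K" using generate_m_inv_closed[of K v] assms K_sub(1) S_sub by auto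
  then obtain ws where ws: "set ws \<subseteq> K" "wprod G ws = inv v" using generate_K_word by blast
  then obtain E where E: "gal C ws E" "\<delta> E D = inv (inv v) \<otimes> \<delta> C D"
    using gal_left_mult[of ws C D] assms K_sub by auto
  have "pos C E = phi" using gal_K_pos[OF E(1) ws(1) assms(1)] assms by (simp add: pos_def)
  then have "E \<in> pt C" using mem_pt_iff assms gal_Ch E by blast
  then show ?thesis using that E v by simp
qed

lemma move_right: assumes "C \<in> Ch" "D \<in> Ch" "v \<in> generate G K"
  obtains D' where "D' \<in> pt D" "\<delta> C D' = \<delta> C D \<otimes> v"
proof -
  have v: "v \<in> carrier G" using assms generate_K_sub by auto
  have "inv v \<in> generate G K" using generate_m_inv_closed[of K v] assms K_sub(1) S_sub by auto
  then obtain D' where D': "D' \<in> pt D" "\<delta> D' C = inv v \<otimes> \<delta> D C" using move_left[of D C "inv v"] assms by blast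
  then have "\<delta> C D' = \<delta> C D \<otimes> v" using \<delta>_inv[of D' C] \<delta>_inv[of C D] pt_Ch assms v by (simp add: inv_mult_group)
  then show ?thesis using that D' by blast
qed

text \<open>By hypothesis \<open>j\<close> times the distance fixes \<open>phi\<close>, so the
  distance is \<open>j\<close> times an element of the subgroup generated by \<open>K\<close>, and
  that element is absorbed by changing \<open>D\<close> inside its point.\<close>

lemma pos_adjacent_point: assumes "C \<in> Ch" "D \<in> Ch" "j \<in> J" "pos C D = phi - e j"
  obtains D' where "D' \<in> pt D" "\<delta> C D' = j"
proof -
  define k where "k = j \<otimes> \<delta> C D"
  have j: "j \<in> S" using assms J_sub by auto
  have k: "k \<in> carrier G" using assms j by (simp add: k_def)
  have "act k phi = rf j (phi - e j)" using assms j by (simp add: k_def act_S_mult pos_def)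
  then have "act k phi = phi" using assms j by (simp add: rf_phi_J)
  then have "k \<in> generate G K" using stabilizer_phi k by blast
  then have "inv k \<in> generate G K" using generate_m_inv_closed[of K k] K_sub(1) S_sub by auto
  then obtain D' where "D' \<in> pt D" "\<delta> C D' = \<delta> C D \<otimes> inv k" using move_right assms by blast
  moreover have "\<delta> C D = j \<otimes> k" using assms j by (simp add: k_def)
  ultimately show ?thesis using that j k by (simp add: m_assoc)
qed

section \<open>Collinear and special pairs of points\<close>

lemma lrg_points_pt: "lrg_points G S Ch \<delta> = pt ` Ch"
  by (auto simp: lrg_points_def pt_def polar_type_J K_def)

lemma collinear_iff: assumes "C \<in> Ch" "D \<in> Ch"
  shows "lrg_collinear G S Ch \<delta> (pt C) (pt D) \<longleftrightarrow> ip C D = 1"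
proof
  assume "lrg_collinear G S Ch \<delta> (pt C) (pt D)"
  then obtain C' D' where CD: "C' \<in> pt C" "D' \<in> pt D" "\<delta> C' D' \<in> J"
    by (auto simp: lrg_collinear_def polar_type_J)
  then have "ip C' D' = 1" using J_sub by (simp add: ip_def pos_def rf_phi_J)
  then show "ip C D = 1" using ip_cong[OF assms CD(1,2)] by simp
next
  assume 1: "ip C D = 1"
  obtain v j where v: "v \<in> generate G K" "j \<in> J" "act v (pos C D) = phi - e j"
    using level1_conjugate[of "pos C D"] 1 assms by (auto simp: ip_def A_sym)
  obtain C' where C': "C' \<in> pt C" "\<delta> C' D = v \<otimes> \<delta> C D" using move_left assms v by blast
  have vc: "v \<in> carrier G" using v generate_K_sub by auto
  have "pos C' D = phi - e j" using C' v vc assms by (simp add: pos_def act_mult)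
  then obtain D' where D': "D' \<in> pt D" "\<delta> C' D' = j" using pos_adjacent_point pt_Ch C' assms v by metis
  have "pt C \<noteq> pt D" using pt_eq_iff 1 assms by simp
  then show "lrg_collinear G S Ch \<delta> (pt C) (pt D)"
    using C' D' v assms by (auto simp: lrg_collinear_def lrg_points_pt polar_type_J)
qed

text \<open>Crossing one panel of polar type either keeps the position seen from \<open>C\<close> or
  replaces \<open>act w phi\<close> by \<open>act w (phi - e j)\<close>, which has inner product 1
  with it.\<close>

lemma common_neighbour_pos:
  assumes Ch: "C \<in> Ch" "D \<in> Ch" "E \<in> Ch" and "ip C E = 1" "ip E D = 1"
  shows "A (pos C E) phi = 1" "pos C D = pos C E \<or> A (pos C E) (pos C D) = 1"
proof -
  show "A (pos C E) phi = 1" using assms by (simp add: ip_def A_sym)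
  obtain E' D' where ED: "E' \<in> pt E" "D' \<in> pt D" "\<delta> E' D' \<in> J"
    using collinear_iff[of E D] assms by (auto simp: lrg_collinear_def polar_type_J)
  then have Ch': "E' \<in> Ch" "D' \<in> Ch" using pt_Ch by auto
  have p: "pos C E' = pos C E" "pos C D' = pos C D" using pos_cong[OF Ch(1,3) ED(1)] pos_cong[OF Ch(1,2) ED(2)] by auto
  have j: "\<delta> E' D' \<in> S" using ED J_sub by auto
  have "\<delta> C D' = \<delta> C E' \<otimes> \<delta> E' D' \<or> \<delta> C D' = \<delta> C E'" using right_step[of C E' D'] Ch Ch' j by simp
  then show "pos C D = pos C E \<or> A (pos C E) (pos C D) = 1"
  proof
    assume "\<delta> C D' = \<delta> C E' \<otimes> \<delta> E' D'"
    then have "pos C D' = act (\<delta> C E') (phi - e (\<delta> E' D'))"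
      using Ch Ch' j ED by (simp add: pos_def act_mult rf_phi_J)
    moreover have "A (pos C E') (act (\<delta> C E') (phi - e (\<delta> E' D'))) = A phi (phi - e (\<delta> E' D'))"
      unfolding pos_def using Ch Ch' by (intro A_act_act) auto
    ultimately show ?thesis using p ED by simp
  qed (use p in \<open>simp add: pos_def\<close>)
qed

lemma common_neighbour_exists:
  assumes Ch: "C \<in> Ch" "D \<in> Ch" and x: "x \<in> Rt" "A x phi = 1" "A x (pos C D) = 1"
  obtains E where "E \<in> Ch" "pos C E = x" "ip C E = 1" "ip E D = 1"
proof -
  obtain v where v: "v \<in> carrier G" "act v phi = x" using root_conjugate_phi x by blast
  obtain E where E: "E \<in> Ch" "\<delta> C E = v" "\<delta> E D = inv v \<otimes> \<delta> C D" using apartment_chamber Ch v by blast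
  have p: "pos C E = x" using E v by (simp add: pos_def)
  moreover have "ip C E = 1" using p x by (simp add: ip_def A_sym)
  moreover have "ip E D = A phi (act (inv v) (pos C D))" using E v Ch by (simp add: ip_def pos_def act_mult)
  then have "ip E D = 1" using x v by (simp flip: A_act_inv)
  ultimately show ?thesis using that E by blast
qed

text \<open>For inner product -1 the only possible position of a common neighbour is
  \<open>phi + pos C D\<close>, and a panel shows that only one point has it. Conversely, a unique
  common neighbour excludes inner product -2, where there is none, and 0, where a second one
  exists.\<close>

lemma special_iff: assumes Ch: "C \<in> Ch" "D \<in> Ch"
  shows "lrg_pos2' G S Ch \<delta> (pt C) (pt D) \<longleftrightarrow> ip C D = - 1"
proof
  assume m1: "ip C D = - 1"
  have r: "phi + pos C D \<in> Rt" using Rt_add[of phi "pos C D"] m1 Ch by (simp add: ip_def)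
  have r1: "A (phi + pos C D) phi = 1" "A (phi + pos C D) (pos C D) = 1"
    using m1 Ch A_sym[of phi "pos C D"] by (auto simp: ip_def)
  obtain E where E: "E \<in> Ch" "pos C E = phi + pos C D" "ip C E = 1" "ip E D = 1"
    using common_neighbour_exists[OF Ch r r1] .
  have uniq: "pos C0 F = phi + pos C0 D" if "C0 \<in> pt C" "F \<in> Ch" "ip C F = 1" "ip F D = 1" for C0 F
  proof -
    have C0: "C0 \<in> Ch" "ip C0 F = 1" "ip C0 D = - 1" using ip_cong[of C F C0 F] ip_cong[of C D C0 D] that Ch m1 pt_Ch by auto
    note n = common_neighbour_pos[OF C0(1) Ch(2) that(2) C0(2) that(4)]
    have "A (pos C0 D) phi = - 1" using C0 by (simp add: ip_def A_sym)
    then have "pos C0 D \<noteq> pos C0 F" using n(1) by auto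
    then have "A (pos C0 F) (phi + pos C0 D) = 2" using n by auto
    moreover have "phi + pos C0 D \<in> Rt" using Rt_add[of phi "pos C0 D"] C0 Ch by (simp add: ip_def)
    moreover have "pos C0 F \<in> Rt" using C0 that by simp
    ultimately show ?thesis using A_Rt_eq_2 by blast
  qed
  \<comment> \<open>After this normalization every common neighbour has a chamber in the
    \<open>j\<close>-panel of \<open>C0\<close>.\<close>
  obtain v j where v: "v \<in> generate G K" "j \<in> J" "act v (phi + pos C D) = phi - e j"
    using level1_conjugate[OF r] r1 by blast
  have vc: "v \<in> carrier G" using v generate_K_sub by auto
  have j: "j \<in> S" using v J_sub by auto
  obtain C0 where C0: "C0 \<in> pt C" "\<delta> C0 D = v \<otimes> \<delta> C D" using move_left Ch v by blast
  have C0h: "C0 \<in> Ch" using C0 pt_Ch by blast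
  have "act v (phi + pos C D) = phi + pos C0 D" using C0 v vc Ch generate_K_act_phi by (simp add: pos_def act_mult)
  then have p0: "phi + pos C0 D = phi - e j" using v by simp
  then have p1: "pos C0 D = - e j" by (metis add_left_cancel diff_conv_add_uminus)
  define w where "w = \<delta> C0 D"
  have w: "w \<in> carrier G" using C0h Ch by (simp add: w_def)
  have "act (inv w) (act w phi) = phi" using w by simp
  then have "- act (inv w) (e j) = phi" using p1 w j by (simp add: pos_def w_def)
  then have "nonneg (- act (inv w) (e j))" using A_phi_pos_nonneg[of phi] by simp
  then have "\<not> nonneg (act (inv w) (e j))" using Rt_neg_iff[of "act (inv w) (e j)"] w j by (simp add: RtI)
  then have desc: "len (j \<otimes> w) < len w" using left_ascent_iff[OF w j] len_mult_left[OF j w] by auto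
  \<comment> \<open>\<open>E0\<close> is the chamber of that panel nearest to \<open>D\<close>. All
    others are at distance \<open>w\<close> from \<open>D\<close>, hence at inner product -1, so the
    chamber of a common neighbour must be \<open>E0\<close>.\<close>
  obtain E0 where E0: "E0 \<in> Ch" "\<delta> E0 C0 = j" "\<delta> E0 D = j \<otimes> w" using left_exists[of C0 D j] C0h Ch j by (auto simp: w_def)
  have all: "pt F = pt E0" if F: "F \<in> Ch" "ip C F = 1" "ip F D = 1" for F
  proof -
    have "pos C0 F = phi - e j" using uniq[OF C0(1) F] p0 by simp
    then obtain F' where F': "F' \<in> pt F" "\<delta> C0 F' = j" using pos_adjacent_point C0h F v by blast
    have Fh: "F' \<in> Ch" using F' pt_Ch by blast
    have "F' = E0"
    proof (rule ccontr)
      assume "F' \<noteq> E0"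
      then have a: "\<delta> F' E0 = j" using adj_trans[of C0 F' E0 j] adj_sym C0h Fh E0 F' j by metis
      have "\<delta> F' D = j \<otimes> (j \<otimes> w)" using left_step_up[of E0 D F' j] E0 Fh Ch a j desc w by simp
      then have "\<delta> F' D = w" using j w by simp
      then have "ip F' D = ip C0 D" by (simp add: ip_def pos_def w_def)
      moreover have "ip F' D = 1" using ip_cong[of F D F' D] F F' Ch by simp
      moreover have "ip C0 D = - 1" using ip_cong[of C D C0 D] C0 Ch m1 by simp
      ultimately show False by simp
    qed
    then show ?thesis using pt_eq F F' by metis
  qed
  have "\<exists>!z. z \<in> lrg_points G S Ch \<delta> \<and> lrg_collinear G S Ch \<delta> (pt C) z \<and> lrg_collinear G S Ch \<delta> z (pt D)"
  proof (rule ex1I[of _ "pt E"])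
    show "pt E \<in> lrg_points G S Ch \<delta> \<and> lrg_collinear G S Ch \<delta> (pt C) (pt E) \<and> lrg_collinear G S Ch \<delta> (pt E) (pt D)"
      using E Ch collinear_iff by (auto simp: lrg_points_pt)
    fix z assume "z \<in> lrg_points G S Ch \<delta> \<and> lrg_collinear G S Ch \<delta> (pt C) z \<and> lrg_collinear G S Ch \<delta> z (pt D)"
    then obtain F where "F \<in> Ch" "z = pt F" "ip C F = 1" "ip F D = 1"
      using Ch collinear_iff by (auto simp: lrg_points_pt)
    then show "z = pt E" using all[of F] all[of E] E by simp
  qed
  moreover have "pt C \<noteq> pt D" using pt_eq_iff m1 Ch by simp
  ultimately show "lrg_pos2' G S Ch \<delta> (pt C) (pt D)"
    using m1 Ch collinear_iff unfolding lrg_pos2'_def by (auto simp: lrg_points_pt)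
next
  assume p2: "lrg_pos2' G S Ch \<delta> (pt C) (pt D)"
  then have ex1: "\<exists>!z. z \<in> lrg_points G S Ch \<delta> \<and> lrg_collinear G S Ch \<delta> (pt C) z \<and> lrg_collinear G S Ch \<delta> z (pt D)"
    unfolding lrg_pos2'_def by blast
  have ne: "ip C D \<noteq> 2" "ip C D \<noteq> 1" using p2 pt_eq_iff collinear_iff Ch unfolding lrg_pos2'_def by auto
  from ex1 obtain E where E: "E \<in> Ch" "ip C E = 1" "ip E D = 1"
    using Ch collinear_iff by (auto simp: lrg_points_pt)
  note n = common_neighbour_pos[OF Ch E]
  have R: "pos C E \<in> Rt" "pos C D \<in> Rt" using E Ch by auto
  have ne2: "pos C D \<noteq> pos C E" using n(1) ne by (auto simp: ip_def A_sym)
  then have n2: "A (pos C E) (pos C D) = 1" using n(2) by blast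
  have "ip C D \<noteq> - 2"
  proof
    assume "ip C D = - 2"
    then have "pos C D = - phi" using A_Rt_eq_m2[of phi "pos C D"] R by (auto simp: ip_def)
    then show False using n(1) n2 by simp
  qed
  moreover have "ip C D \<noteq> 0"
  proof
    assume 0: "ip C D = 0"
    \<comment> \<open>The position of a second common neighbour: it pairs to 1 with
      \<open>phi\<close> and \<open>pos C D\<close>, but to 0 with \<open>pos C E\<close>.\<close>
    define x where "x = phi - pos C E + pos C D"
    have "phi - pos C E \<in> Rt" using Rt_diff[of phi "pos C E"] n(1) R by (simp add: A_sym)
    moreover have "A (phi - pos C E) (pos C D) = - 1" using 0 n2 by (simp add: ip_def)
    ultimately have xR: "x \<in> Rt" unfolding x_def using Rt_add R by blast
    have "A (pos C D) phi = 0" "A phi (pos C D) = 0" using 0 A_sym[of phi "pos C D"] by (simp_all add: ip_def)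
    then have x1: "A x phi = 1" "A x (pos C D) = 1" "A (pos C E) x = 0"
      using n(1) n2 R by (simp_all add: x_def)
    then obtain F where F: "F \<in> Ch" "pos C F = x" "ip C F = 1" "ip F D = 1"
      using common_neighbour_exists[OF Ch xR] by blast
    have "pt F \<in> lrg_points G S Ch \<delta> \<and> lrg_collinear G S Ch \<delta> (pt C) (pt F) \<and> lrg_collinear G S Ch \<delta> (pt F) (pt D)"
      "pt E \<in> lrg_points G S Ch \<delta> \<and> lrg_collinear G S Ch \<delta> (pt C) (pt E) \<and> lrg_collinear G S Ch \<delta> (pt E) (pt D)"
      using E F Ch collinear_iff by (auto simp: lrg_points_pt)
    then have "pt F = pt E" using ex1 by blast
    then have "pos C F = pos C E" using pos_cong[of C E F] F E Ch pt_self by metis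
    then show False using F x1(3) R by simp
  qed
  ultimately show "ip C D = - 1" using A_Rt_le[of phi "pos C D"] A_Rt_ge[of phi "pos C D"] ne R by (auto simp: ip_def)
qed

end

section \<open>Automorphisms\<close>

locale laced_automorphism = laced_building G S Ch \<delta> for G (structure) and S and Ch :: "'c set" and \<delta> +
  fixes \<theta> :: "'c \<Rightarrow> 'c" and \<sigma> :: "'a \<Rightarrow> 'a"
  assumes aut: "automorphism_with_companion G S Ch \<delta> \<theta> \<sigma>"
begin

lemma \<theta>_Ch [simp, intro]: "C \<in> Ch \<Longrightarrow> \<theta> C \<in> Ch"
  using aut unfolding automorphism_with_companion_def bij_betw_def by auto

lemma \<theta>_onto: "D \<in> Ch \<Longrightarrow> \<exists>C\<in>Ch. \<theta> C = D"
proof -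
  assume "D \<in> Ch"
  moreover have "\<theta> ` Ch = Ch" using aut unfolding automorphism_with_companion_def bij_betw_def by blast
  ultimately have "D \<in> \<theta> ` Ch" by simp
  then show ?thesis by blast
qed

lemma \<delta>_\<theta>: "C \<in> Ch \<Longrightarrow> D \<in> Ch \<Longrightarrow> \<delta> (\<theta> C) (\<theta> D) = \<sigma> (\<delta> C D)"
  using aut unfolding automorphism_with_companion_def by blast

lemma \<sigma>_iso: "\<sigma> \<in> iso G G" and \<sigma>_image: "\<sigma> ` S = S"
  using aut unfolding automorphism_with_companion_def by blast+

lemma \<sigma>_closed [simp]: "w \<in> carrier G \<Longrightarrow> \<sigma> w \<in> carrier G"
  and \<sigma>_mult: "v \<in> carrier G \<Longrightarrow> w \<in> carrier G \<Longrightarrow> \<sigma> (v \<otimes> w) = \<sigma> v \<otimes> \<sigma> w"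
  and \<sigma>_inj: "inj_on \<sigma> (carrier G)"
  using \<sigma>_iso unfolding iso_def hom_def bij_betw_def by auto

lemma \<sigma>_S [simp, intro]: "s \<in> S \<Longrightarrow> \<sigma> s \<in> S"
  using \<sigma>_image by auto

lemma \<sigma>_one [simp]: "\<sigma> \<one> = \<one>"
  using \<sigma>_iso hom_one[of \<sigma> G G] is_group unfolding iso_def by simp

lemma \<sigma>_bij_S: "bij_betw \<sigma> S S"
  unfolding bij_betw_def using \<sigma>_image inj_on_subset[OF \<sigma>_inj S_sub] by simp

definition \<tau> :: "'a \<Rightarrow> 'a" where "\<tau> = inv_into S \<sigma>"

lemma \<tau>_S [simp]: "s \<in> S \<Longrightarrow> \<tau> s \<in> S" and \<sigma>_\<tau> [simp]: "s \<in> S \<Longrightarrow> \<sigma> (\<tau> s) = s"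
  and \<tau>_\<sigma> [simp]: "s \<in> S \<Longrightarrow> \<tau> (\<sigma> s) = s"
  using \<sigma>_bij_S \<sigma>_image unfolding \<tau>_def
  by (auto intro: inv_into_into f_inv_into_f inv_into_f_f simp: bij_betw_def)

text \<open>The linear map of the diagram automorphism, sending \<open>e s\<close> to
  \<open>e (\<sigma> s)\<close>; \<open>sigi\<close> is its adjoint and, on \<open>Lat\<close>, its
  inverse. The default 0 keeps the values in \<open>Lat\<close>.\<close>

definition sig :: "('a \<Rightarrow> int) \<Rightarrow> 'a \<Rightarrow> int" where "sig x = (\<lambda>t. if t \<in> S then x (\<tau> t) else 0)"
definition sigi :: "('a \<Rightarrow> int) \<Rightarrow> 'a \<Rightarrow> int" where "sigi x = (\<lambda>t. if t \<in> S then x (\<sigma> t) else 0)"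

lemma sig_linear [simp]: "sig (x + y) = sig x + sig y" "sig (x - y) = sig x - sig y" "sig (- x) = - sig x"
    "sig (scl k x) = scl k (sig x)"
  and sigi_linear [simp]: "sigi (x + y) = sigi x + sigi y" "sigi (x - y) = sigi x - sigi y" "sigi (- x) = - sigi x"
    "sigi (scl k x) = scl k (sigi x)"
  by (auto simp: sig_def sigi_def scl_def fun_eq_iff)

lemma sig_e [simp]: "s \<in> S \<Longrightarrow> sig (e s) = e (\<sigma> s)"
  by (auto simp: sig_def e_def fun_eq_iff)

lemma sigi_sig [simp]: "x \<in> Lat \<Longrightarrow> sigi (sig x) = x" and sig_sigi [simp]: "x \<in> Lat \<Longrightarrow> sig (sigi x) = x"
  by (auto simp: sig_def sigi_def Lat_def fun_eq_iff)

lemma cart_\<sigma>: "s \<in> S \<Longrightarrow> t \<in> S \<Longrightarrow> cart (\<sigma> s) (\<sigma> t) = cart s t"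
  using inj_onD[OF \<sigma>_inj, of s t] inj_onD[OF \<sigma>_inj, of "s \<otimes> t" "t \<otimes> s"] \<sigma>_mult[of s t] \<sigma>_mult[of t s]
  by (auto simp: cart_def)

lemma A_sig: "A (sig x) y = A x (sigi y)"
proof -
  have "A (sig x) y = (\<Sum>s\<in>S. \<Sum>t\<in>S. sig x (\<sigma> s) * y (\<sigma> t) * cart (\<sigma> s) (\<sigma> t))"
    unfolding A_def
    by (subst sum.reindex_bij_betw[OF \<sigma>_bij_S, symmetric], rule sum.cong[OF HOL.refl],
        rule sum.reindex_bij_betw[OF \<sigma>_bij_S, symmetric])
  also have "\<dots> = A x (sigi y)"
    unfolding A_def by (intro sum.cong HOL.refl) (auto simp: sig_def sigi_def cart_\<sigma>)
  finally show ?thesis .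
qed

lemma A_sig_sig [simp]: "A (sig x) (sig y) = A x y"
proof -
  have "A x (sigi (sig y)) = A x y"
    unfolding A_def by (intro sum.cong HOL.refl) (auto simp: sig_def sigi_def)
  then show ?thesis by (simp add: A_sig)
qed

lemma sig_rf: "s \<in> S \<Longrightarrow> sig (rf s x) = rf (\<sigma> s) (sig x)"
  using A_sig_sig[of "e s" x] by (simp add: rf_def)

lemma sigi_rf: "s \<in> S \<Longrightarrow> sigi (rf (\<sigma> s) x) = rf s (sigi x)"
  using A_sig[of "e s" x] by (simp add: rf_def flip: sig_e)

lemma sig_act: "w \<in> carrier G \<Longrightarrow> sig (act w x) = act (\<sigma> w) (sig x)"
  by (induction w rule: W_induct) (simp_all add: act_S_mult sig_rf \<sigma>_mult)

lemma sig_Rt [simp]: "x \<in> Rt \<Longrightarrow> sig x \<in> Rt"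
proof -
  assume "x \<in> Rt"
  then obtain w s where "w \<in> carrier G" "s \<in> S" "x = act w (e s)" unfolding Rt_def by blast
  then have "sig x = act (\<sigma> w) (e (\<sigma> s))" "\<sigma> w \<in> carrier G" "\<sigma> s \<in> S" by (auto simp: sig_act)
  then show ?thesis using RtI by simp
qed

lemma sigi_Rt [simp]: assumes "x \<in> Rt" shows "sigi x \<in> Rt"
proof -
  have "inj_on sig Rt" using Rt_Lat sigi_sig by (metis inj_onI)
  moreover have "sig ` Rt \<subseteq> Rt" by auto
  ultimately have "sig ` Rt = Rt" using finite_Rt endo_inj_surj by blast
  then obtain y where "y \<in> Rt" "x = sig y" using assms by blast
  then show ?thesis using Rt_Lat by simp
qed

lemma sig_phi [simp]: "sig phi = phi"
proof -
  have "0 \<le> A (sig phi) (e s)" if "s \<in> S" for s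
    using A_sig_sig[of phi "e (\<tau> s)"] phi_dominant that by (simp add: dominant_def)
  then show ?thesis using dominant_root_unique phi_dominant by (simp add: dominant_def)
qed

lemma sigi_phi [simp]: "sigi phi = phi"
  using sigi_sig[of phi] Rt_Lat by simp

subsection \<open>Displacements as isometries of the root lattice\<close>

text \<open>\<open>gm w\<close> is the isometry of the displacement \<open>w\<close>, and
  \<open>gi w\<close> is its inverse on \<open>Lat\<close>. Multiplying \<open>w\<close> by
  \<open>s\<close> on the left applies \<open>rf s\<close> after \<open>gm w\<close>; multiplying by
  \<open>\<sigma> s\<close> on the right applies \<open>rf s\<close> before it.\<close>

definition gm :: "'a \<Rightarrow> ('a \<Rightarrow> int) \<Rightarrow> 'a \<Rightarrow> int" where "gm w x = act w (sig x)"
definition gi :: "'a \<Rightarrow> ('a \<Rightarrow> int) \<Rightarrow> 'a \<Rightarrow> int" where "gi w x = sigi (act (inv w) x)"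

lemma gm_linear [simp]: "w \<in> carrier G \<Longrightarrow> gm w (x + y) = gm w x + gm w y"
    "w \<in> carrier G \<Longrightarrow> gm w (x - y) = gm w x - gm w y" "w \<in> carrier G \<Longrightarrow> gm w (- x) = - gm w x"
  and gi_linear [simp]: "w \<in> carrier G \<Longrightarrow> gi w (x + y) = gi w x + gi w y"
    "w \<in> carrier G \<Longrightarrow> gi w (x - y) = gi w x - gi w y" "w \<in> carrier G \<Longrightarrow> gi w (- x) = - gi w x"
  by (simp_all add: gm_def gi_def)

lemma gm_gi [simp]: "w \<in> carrier G \<Longrightarrow> x \<in> Lat \<Longrightarrow> gm w (gi w x) = x"
  and gi_gm [simp]: "w \<in> carrier G \<Longrightarrow> x \<in> Lat \<Longrightarrow> gi w (gm w x) = x"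
  by (simp_all add: gm_def gi_def)

lemma gm_Rt [simp]: "w \<in> carrier G \<Longrightarrow> x \<in> Rt \<Longrightarrow> gm w x \<in> Rt"
  and gi_Rt [simp]: "w \<in> carrier G \<Longrightarrow> x \<in> Rt \<Longrightarrow> gi w x \<in> Rt"
  by (simp_all add: gm_def gi_def)

lemma A_gm_gm [simp]: "w \<in> carrier G \<Longrightarrow> A (gm w x) (gm w y) = A x y"
  by (simp add: gm_def)

lemma A_gm: "w \<in> carrier G \<Longrightarrow> A (gm w x) y = A x (gi w y)"
  by (simp add: gm_def gi_def A_act_inv A_sig)

lemma A_gi: "w \<in> carrier G \<Longrightarrow> A (gi w x) y = A x (gm w y)"
  using A_gm[of w y x] A_sym by simp

lemma gm_left: "w \<in> carrier G \<Longrightarrow> s \<in> S \<Longrightarrow> gm (s \<otimes> w) x = rf s (gm w x)"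
  by (simp add: gm_def act_S_mult)

lemma gm_right: "w \<in> carrier G \<Longrightarrow> s \<in> S \<Longrightarrow> gm (w \<otimes> \<sigma> s) x = gm w (rf s x)"
  by (simp add: gm_def act_mult sig_rf)

lemma gi_left: "w \<in> carrier G \<Longrightarrow> s \<in> S \<Longrightarrow> gi (s \<otimes> w) x = gi w (rf s x)"
  by (simp add: gi_def inv_mult_group act_mult)

lemma gi_right: "w \<in> carrier G \<Longrightarrow> s \<in> S \<Longrightarrow> gi (w \<otimes> \<sigma> s) x = rf s (gi w x)"
  by (simp add: gi_def inv_mult_group act_S_mult sigi_rf)

lemma gm_eq_iff: "w \<in> carrier G \<Longrightarrow> x \<in> Rt \<Longrightarrow> y \<in> Rt \<Longrightarrow> gm w x = y \<longleftrightarrow> gi w y = x"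
  using gm_gi gi_gm Rt_Lat by metis

lemma sigi_nonneg: "nonneg (sigi x) \<longleftrightarrow> nonneg x" if "x \<in> Lat"
proof -
  have "nonneg (sigi x) \<Longrightarrow> 0 \<le> x t" for t
    using that unfolding nonneg_def sigi_def Lat_def
    by (cases "t \<in> S") (auto dest: spec[of _ "\<tau> t"])
  then show ?thesis by (auto simp: nonneg_def sigi_def)
qed

text \<open>In the names of the panel rules, the first up or down is the sign of
  \<open>gi w (e s)\<close>, which governs multiplication on the left; the second is the sign of
  \<open>gm w (e s)\<close>, which governs the right.\<close>

lemma left_up_iff: "w \<in> carrier G \<Longrightarrow> s \<in> S \<Longrightarrow> len w < len (s \<otimes> w) \<longleftrightarrow> nonneg (gi w (e s))"
  by (simp add: left_ascent_iff gi_def sigi_nonneg)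

lemma right_up_iff: "w \<in> carrier G \<Longrightarrow> s \<in> S \<Longrightarrow> len w < len (w \<otimes> \<sigma> s) \<longleftrightarrow> nonneg (gm w (e s))"
  by (simp add: right_ascent_iff gm_def)

lemma rf_not_nonneg: "x \<in> Rt \<Longrightarrow> \<not> nonneg x \<Longrightarrow> s \<in> S \<Longrightarrow> x \<noteq> - e s \<Longrightarrow> \<not> nonneg (rf s x)"
  using rf_nonneg[of "- x" s] Rt_neg_iff[of x] Rt_neg_iff[of "rf s x"] by (metis Rt_neg Rt_rf add.inverse_inverse rf_neg)

lemma nonneg_neg_e [simp]: "s \<in> S \<Longrightarrow> \<not> nonneg (- e s)"
  using Rt_neg_iff[of "e s"] by simp

section \<open>Displacements along a panel\<close>

abbreviation dsp :: "'c \<Rightarrow> 'a" where "dsp C \<equiv> \<delta> C (\<theta> C)"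
definition DD :: "'a set" where "DD = dsp ` Ch"

lemma DD_carrier [simp, intro]: "w \<in> DD \<Longrightarrow> w \<in> carrier G"
  by (auto simp: DD_def)

lemma DD_disp: "disp Ch \<delta> \<theta> = DD"
  by (auto simp: DD_def disp_def)

lemma \<theta>_adj: "C \<in> Ch \<Longrightarrow> D \<in> Ch \<Longrightarrow> \<delta> C D = s \<Longrightarrow> \<delta> (\<theta> C) (\<theta> D) = \<sigma> s"
  by (simp add: \<delta>_\<theta>)

lemma dsp_neighbour:
  assumes "C \<in> Ch" "D \<in> Ch" "s \<in> S" "\<delta> C D = s"
  shows "dsp D \<in> {dsp C, s \<otimes> dsp C, dsp C \<otimes> \<sigma> s, s \<otimes> dsp C \<otimes> \<sigma> s}"
  using left_step[of C "\<theta> C" D s] right_step[of D "\<theta> C" "\<theta> D" "\<sigma> s"] adj_sym[of C D s] \<theta>_adj[of C D s] assms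
  by auto

text \<open>The left step lengthens. After it the image of \<open>e s\<close> is reflected, which
  stays positive unless it was \<open>e s\<close> itself, so the right step lengthens too.\<close>

lemma dsp_up_up:
  assumes C: "C \<in> Ch" "D \<in> Ch" "s \<in> S" "\<delta> C D = s"
    and "nonneg (gi (dsp C) (e s))" "nonneg (gm (dsp C) (e s))" "gm (dsp C) (e s) \<noteq> e s"
  shows "dsp D = s \<otimes> dsp C \<otimes> \<sigma> s"
proof -
  have w: "dsp C \<in> carrier G" using C by simp
  have 1: "\<delta> D (\<theta> C) = s \<otimes> dsp C"
    using left_step_up[of C "\<theta> C" D s] adj_sym[of C D s] C assms left_up_iff[of "dsp C" s] by simp
  have "nonneg (gm (s \<otimes> dsp C) (e s))" using rf_nonneg[of "gm (dsp C) (e s)" s] assms w by (simp add: gm_left)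
  then show ?thesis using right_step_up[of D "\<theta> C" "\<theta> D" "\<sigma> s"] \<theta>_adj[of C D s] C w 1 right_up_iff[of "s \<otimes> dsp C" s] by simp
qed

text \<open>The preimage \<open>D1\<close> of the chamber \<open>E\<close> of the image panel
  nearest to \<open>C\<close> gets the two-sided product. A third chamber, given by thickness, gets
  the left product.\<close>

lemma dsp_up_down:
  assumes C: "C \<in> Ch" "s \<in> S"
    and "nonneg (gi (dsp C) (e s))" "\<not> nonneg (gm (dsp C) (e s))"
  shows "\<exists>D\<in>Ch. \<delta> C D = s \<and> dsp D = s \<otimes> dsp C" "\<exists>D\<in>Ch. \<delta> C D = s \<and> dsp D = s \<otimes> dsp C \<otimes> \<sigma> s"
proof -
  define w where "w = dsp C"
  have w: "w \<in> carrier G" using C by (simp add: w_def)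
  have ne: "gm w (e s) \<noteq> e s" using assms by (auto simp: w_def)
  have l: "nonneg (gi w (e s))" "\<not> nonneg (gm w (e s))" using assms by (auto simp: w_def)
  obtain E where E: "E \<in> Ch" "\<delta> E (\<theta> C) = \<sigma> s" "\<delta> (\<theta> C) E = \<sigma> s" "\<delta> E C = \<sigma> s \<otimes> \<delta> (\<theta> C) C"
    using left_exists[of "\<theta> C" C "\<sigma> s"] adj_sym C by (metis \<sigma>_S \<theta>_Ch)
  then obtain D1 where D1: "D1 \<in> Ch" "\<theta> D1 = E" using \<theta>_onto by blast
  have CE: "\<delta> C E = w \<otimes> \<sigma> s" using E \<delta>_inv[of E C] \<delta>_inv[of C "\<theta> C"] C w by (simp add: inv_mult_group w_def)
  have "gi w (e s) \<noteq> e s" using ne gm_eq_iff w C by force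
  then have "nonneg (gi (w \<otimes> \<sigma> s) (e s))" using rf_nonneg[of "gi w (e s)" s] l w C by (simp add: gi_right)
  then have up: "len (w \<otimes> \<sigma> s) < len (s \<otimes> (w \<otimes> \<sigma> s))" using left_up_iff w C by simp
  have DE: "\<delta> D E = s \<otimes> w \<otimes> \<sigma> s" if "D \<in> Ch" "\<delta> C D = s" for D
    using left_step_up[of C E D s] adj_sym[of C D s] that C E CE up w by (simp add: m_assoc)
  have "\<sigma> (\<delta> C D1) = \<sigma> s" using \<delta>_\<theta>[of C D1] D1 E C by simp
  then have CD1: "\<delta> C D1 = s" using inj_onD[OF \<sigma>_inj] D1 C by auto
  then have "dsp D1 = s \<otimes> dsp C \<otimes> \<sigma> s" using DE[of D1] D1 by (simp add: w_def)
  then show "\<exists>D\<in>Ch. \<delta> C D = s \<and> dsp D = s \<otimes> dsp C \<otimes> \<sigma> s" using D1 CD1 by blast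
  obtain D2 where D2: "D2 \<in> Ch" "\<delta> C D2 = s" "D2 \<noteq> D1" using third_chamber C D1 by metis
  have "\<delta> D1 D2 = s" using adj_trans[of C D1 D2 s] D1 D2 CD1 C by simp
  then have a: "\<delta> E (\<theta> D2) = \<sigma> s" using \<theta>_adj D1 D2 by auto
  have y: "s \<otimes> w \<otimes> \<sigma> s \<otimes> \<sigma> s = s \<otimes> w" using w C by simp
  have "\<not> nonneg (rf s (gm w (e s)))"
  proof (rule rf_not_nonneg)
    show "gm w (e s) \<noteq> - e s"
    proof
      assume "gm w (e s) = - e s"
      then have "gi w (- e s) = e s" using gm_eq_iff[of w "e s" "- e s"] w C by simp
      then have "gi w (e s) = - e s" using w by (metis add.inverse_inverse gi_linear(3))
      then show False using l C by simp
    qed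
  qed (use l w C in auto)
  then have "nonneg (gm (s \<otimes> w \<otimes> \<sigma> s) (e s))"
    using Rt_neg_iff[of "rf s (gm w (e s))"] w C by (simp add: gm_left gm_right)
  then have "len (s \<otimes> w \<otimes> \<sigma> s) < len (s \<otimes> w \<otimes> \<sigma> s \<otimes> \<sigma> s)" using right_up_iff[of "s \<otimes> w \<otimes> \<sigma> s" s] w C by simp
  then have "dsp D2 = s \<otimes> w" using right_step_up[of D2 E "\<theta> D2" "\<sigma> s"] DE[of D2] D2 E a C y by simp
  then show "\<exists>D\<in>Ch. \<delta> C D = s \<and> dsp D = s \<otimes> dsp C" using D2 by (auto simp: w_def)
qed

text \<open>The mirror image: the chamber \<open>C0\<close> of the panel nearest to
  \<open>\<theta> C\<close> gets the two-sided product, and a third chamber gets the right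
  product.\<close>

lemma dsp_down_up:
  assumes C: "C \<in> Ch" "s \<in> S"
    and "\<not> nonneg (gi (dsp C) (e s))" "nonneg (gm (dsp C) (e s))"
  shows "\<exists>D\<in>Ch. \<delta> C D = s \<and> dsp D = dsp C \<otimes> \<sigma> s" "\<exists>D\<in>Ch. \<delta> C D = s \<and> dsp D = s \<otimes> dsp C \<otimes> \<sigma> s"
proof -
  define w where "w = dsp C"
  have w: "w \<in> carrier G" using C by (simp add: w_def)
  have l: "\<not> nonneg (gi w (e s))" "nonneg (gm w (e s))" using assms by (auto simp: w_def)
  have ne: "gm w (e s) \<noteq> e s" using gm_eq_iff[of w "e s" "e s"] l w C by auto
  obtain C0 where C0: "C0 \<in> Ch" "\<delta> C0 C = s" "\<delta> C0 (\<theta> C) = s \<otimes> w" "\<delta> C C0 = s"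
    using left_exists[of C "\<theta> C" s] adj_sym C unfolding w_def by blast
  have "nonneg (gm (s \<otimes> w) (e s))" using rf_nonneg[of "gm w (e s)" s] l ne w C by (simp add: gm_left)
  then have "len (s \<otimes> w) < len (s \<otimes> w \<otimes> \<sigma> s)" using right_up_iff w C by simp
  then have "dsp C0 = s \<otimes> w \<otimes> \<sigma> s" using right_step_up[of C0 "\<theta> C" "\<theta> C0" "\<sigma> s"] \<theta>_adj[of C C0 s] C0 C by simp
  then show "\<exists>D\<in>Ch. \<delta> C D = s \<and> dsp D = s \<otimes> dsp C \<otimes> \<sigma> s" using C0 by (auto simp: w_def)
  obtain D where D: "D \<in> Ch" "\<delta> C D = s" "D \<noteq> C0" using third_chamber C C0 by metis
  have "\<delta> D C0 = s" using adj_trans[of C D C0 s] D C0 C by simp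
  moreover have "len (s \<otimes> w) < len (s \<otimes> (s \<otimes> w))" using left_up_iff[of w s] l len_mult_left[of s w] w C by auto
  ultimately have "\<delta> D (\<theta> C) = w" using left_step_up[of C0 "\<theta> C" D s] D C0 C w by simp
  moreover have "len w < len (w \<otimes> \<sigma> s)" using right_up_iff l w C by simp
  ultimately have "dsp D = w \<otimes> \<sigma> s" using right_step_up[of D "\<theta> C" "\<theta> D" "\<sigma> s"] \<theta>_adj[of C D s] D C by simp
  then show "\<exists>D\<in>Ch. \<delta> C D = s \<and> dsp D = dsp C \<otimes> \<sigma> s" using D by (auto simp: w_def)
qed

text \<open>The chambers of the panel nearest to its image and to its preimage decide: if they differ, both one-sided
  products occur; if they agree, that chamber has the two-sided product.\<close>
lemma dsp_down_down:
  assumes C: "C \<in> Ch" "s \<in> S"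
    and "\<not> nonneg (gi (dsp C) (e s))" "\<not> nonneg (gm (dsp C) (e s))" "gm (dsp C) (e s) \<noteq> - e s"
  shows "(\<exists>D\<in>Ch. \<delta> C D = s \<and> dsp D = s \<otimes> dsp C \<otimes> \<sigma> s) \<or>
    (\<exists>D\<in>Ch. \<delta> C D = s \<and> dsp D = s \<otimes> dsp C) \<and> (\<exists>D\<in>Ch. \<delta> C D = s \<and> dsp D = dsp C \<otimes> \<sigma> s)"
proof -
  define w where "w = dsp C"
  have w: "w \<in> carrier G" using C by (simp add: w_def)
  have l: "\<not> nonneg (gi w (e s))" "\<not> nonneg (gm w (e s))" "gm w (e s) \<noteq> - e s" using assms by (auto simp: w_def)
  obtain D where D: "D \<in> Ch" "\<delta> D C = s" "\<delta> D (\<theta> C) = s \<otimes> w" "\<delta> C D = s"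
    using left_exists[of C "\<theta> C" s] adj_sym C unfolding w_def by blast
  obtain E where E: "E \<in> Ch" "\<delta> E (\<theta> C) = \<sigma> s" "\<delta> (\<theta> C) E = \<sigma> s" "\<delta> E C = \<sigma> s \<otimes> \<delta> (\<theta> C) C"
    using left_exists[of "\<theta> C" C "\<sigma> s"] adj_sym C by (metis \<sigma>_S \<theta>_Ch)
  then obtain D' where D': "D' \<in> Ch" "\<theta> D' = E" using \<theta>_onto by blast
  have CE: "\<delta> C E = w \<otimes> \<sigma> s" using E \<delta>_inv[of E C] \<delta>_inv[of C "\<theta> C"] C w by (simp add: inv_mult_group w_def)
  have "\<sigma> (\<delta> C D') = \<sigma> s" using \<delta>_\<theta>[of C D'] D' E C by simp
  then have CD': "\<delta> C D' = s" using inj_onD[OF \<sigma>_inj] D' C by auto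
  have ne: "gi w (e s) \<noteq> - e s"
  proof
    assume "gi w (e s) = - e s"
    then have "gm w (- e s) = e s" using gm_eq_iff[of w "- e s" "e s"] w C by simp
    then show False using l(3) w by (metis add.inverse_inverse gm_linear(3))
  qed
  \<comment> \<open>If the one-sided products agreed, \<open>gm w\<close> would send
    \<open>e s\<close> to \<open>e s\<close> or \<open>- e s\<close>, which is excluded. Hence the
    two descriptions of the distance from \<open>D\<close> to \<open>E\<close> leave only the
    two-sided product.\<close>
  have neq: "s \<otimes> w \<noteq> w \<otimes> \<sigma> s"
  proof
    assume "s \<otimes> w = w \<otimes> \<sigma> s"
    then have "rf s (gm w (e s)) = gm w (- e s)" using gm_left[of w s "e s"] gm_right[of w s "e s"] w C by simp
    then have "A (e s) (rf s (gm w (e s))) = - A (e s) (gm w (e s))" using w by simp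
    then have eqn: "gm w (e s) - scl (A (e s) (gm w (e s))) (e s) = - gm w (e s)"
      using \<open>rf s (gm w (e s)) = gm w (- e s)\<close> w by (simp add: rf_def)
    have "A (gm w (e s)) (gm w (e s) - scl (A (e s) (gm w (e s))) (e s)) = - 2" unfolding eqn using w C by simp
    then have "A (e s) (gm w (e s)) * A (e s) (gm w (e s)) = 4" using w C A_sym[of "gm w (e s)" "e s"] by simp
    then have "A (e s) (gm w (e s)) = 2 \<or> A (e s) (gm w (e s)) = - 2"
      using A_Rt_cases[of "e s" "gm w (e s)"] w C by force
    then have "gm w (e s) = e s \<or> gm w (e s) = - e s"
      using A_Rt_eq_2[of "e s" "gm w (e s)"] A_Rt_eq_m2[of "e s" "gm w (e s)"] w C by (metis Rt_e add.inverse_inverse gm_Rt)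
    then show False using l by auto
  qed
  have "\<not> nonneg (rf s (gi w (e s)))" using rf_not_nonneg ne l w C by simp
  then have "\<not> len (w \<otimes> \<sigma> s) < len (s \<otimes> (w \<otimes> \<sigma> s))" using left_up_iff[of "w \<otimes> \<sigma> s" s] w C by (simp add: gi_right)
  then have short: "len (s \<otimes> w \<otimes> \<sigma> s) < len (w \<otimes> \<sigma> s)" using len_mult_left[of s "w \<otimes> \<sigma> s"] w C by (auto simp: m_assoc)
  have "\<not> nonneg (rf s (gm w (e s)))" using rf_not_nonneg l w C by simp
  then have "\<not> len (s \<otimes> w) < len (s \<otimes> w \<otimes> \<sigma> s)" using right_up_iff[of "s \<otimes> w" s] w C by (simp add: gm_left)
  then have short2: "len (s \<otimes> w \<otimes> \<sigma> s) < len (s \<otimes> w)" using len_mult_right[of "\<sigma> s" "s \<otimes> w"] w C by auto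
  have "\<delta> D E = s \<otimes> (w \<otimes> \<sigma> s) \<or> \<delta> D E = w \<otimes> \<sigma> s" using left_step[of C E D s] C D E CE by simp
  moreover have "\<delta> D E = s \<otimes> w \<otimes> \<sigma> s \<or> \<delta> D E = s \<otimes> w" using right_step[of D "\<theta> C" E "\<sigma> s"] C D E by simp
  ultimately have DE: "\<delta> D E = s \<otimes> w \<otimes> \<sigma> s" using neq w C by (auto simp: m_assoc)
  show ?thesis
  proof (cases "D = D'")
    case True
    then show ?thesis using DE D' CD' by (auto simp: w_def)
  next
    case False
    then have a: "\<delta> D D' = s" "\<delta> D' D = s" using adj_trans[of C D D' s] adj_trans[of C D' D s] C D D' CD' by auto
    then have a': "\<delta> E (\<theta> D) = \<sigma> s" using \<theta>_adj[of D' D s] D D' by simp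
    have "dsp D = s \<otimes> w \<otimes> \<sigma> s \<otimes> \<sigma> s" using right_step_up[of D E "\<theta> D" "\<sigma> s"] D E a' C DE short2 w by simp
    then have 1: "dsp D = s \<otimes> w" using w C by simp
    have "dsp D' = s \<otimes> (s \<otimes> w \<otimes> \<sigma> s)"
      using left_step_up[of D E D' s] D E a D' C DE short w by (simp add: m_assoc)
    then have "dsp D' = w \<otimes> \<sigma> s" using w C by (simp add: m_assoc)
    then show ?thesis using 1 D D' CD' by (auto simp: w_def)
  qed
qed

lemma DD_up_up: "w \<in> DD \<Longrightarrow> s \<in> S \<Longrightarrow> nonneg (gi w (e s)) \<Longrightarrow> nonneg (gm w (e s)) \<Longrightarrow> gm w (e s) \<noteq> e s \<Longrightarrow>
    s \<otimes> w \<otimes> \<sigma> s \<in> DD"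
  unfolding DD_def using dsp_up_up neighbour_chamber by (smt (verit) imageE imageI)

lemma DD_up_down: "w \<in> DD \<Longrightarrow> s \<in> S \<Longrightarrow> nonneg (gi w (e s)) \<Longrightarrow> \<not> nonneg (gm w (e s)) \<Longrightarrow>
    s \<otimes> w \<in> DD \<and> s \<otimes> w \<otimes> \<sigma> s \<in> DD"
  unfolding DD_def using dsp_up_down by (smt (verit) imageE imageI)

lemma DD_down_up: "w \<in> DD \<Longrightarrow> s \<in> S \<Longrightarrow> \<not> nonneg (gi w (e s)) \<Longrightarrow> nonneg (gm w (e s)) \<Longrightarrow>
    w \<otimes> \<sigma> s \<in> DD \<and> s \<otimes> w \<otimes> \<sigma> s \<in> DD"
  unfolding DD_def using dsp_down_up by (smt (verit) imageE imageI)

lemma DD_down_down: "w \<in> DD \<Longrightarrow> s \<in> S \<Longrightarrow> \<not> nonneg (gi w (e s)) \<Longrightarrow> \<not> nonneg (gm w (e s)) \<Longrightarrow>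
    gm w (e s) \<noteq> - e s \<Longrightarrow> s \<otimes> w \<otimes> \<sigma> s \<in> DD \<or> s \<otimes> w \<in> DD \<and> w \<otimes> \<sigma> s \<in> DD"
  unfolding DD_def using dsp_down_down by (smt (verit) imageE imageI)

section \<open>The kangaroo condition as a parity\<close>

lemma pt_\<theta>: assumes "C \<in> Ch" shows "\<theta> ` pt C = pt (\<theta> C)"
proof -
  have iff: "\<theta> D \<in> pt (\<theta> C) \<longleftrightarrow> D \<in> pt C" if "D \<in> Ch" for D
  proof -
    have "pos (\<theta> C) (\<theta> D) = sig (pos C D)" using assms that by (simp add: pos_def \<delta>_\<theta> sig_act)
    then have "pos (\<theta> C) (\<theta> D) = phi \<longleftrightarrow> pos C D = phi"
      using sigi_sig[of "pos C D"] Rt_Lat assms that by (metis pos_Rt sig_phi sigi_phi)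
    then show ?thesis using mem_pt_iff assms that by simp
  qed
  show ?thesis
  proof
    show "\<theta> ` pt C \<subseteq> pt (\<theta> C)" using iff pt_Ch by blast
    show "pt (\<theta> C) \<subseteq> \<theta> ` pt C" using iff pt_Ch \<theta>_onto by (metis imageI subsetI)
  qed
qed

lemma ip_dsp: "C \<in> Ch \<Longrightarrow> ip C (\<theta> C) = A phi (gm (dsp C) phi)"
  by (simp add: ip_def pos_def gm_def)

theorem kangaroo_iff: "polar_1_2'_kangaroo G S Ch \<delta> \<theta> \<longleftrightarrow> (\<forall>w\<in>DD. even (A phi (gm w phi)))"
proof -
  have "\<not> lrg_pos1 G S Ch \<delta> (pt C) (\<theta> ` pt C) \<and> \<not> lrg_pos2' G S Ch \<delta> (pt C) (\<theta> ` pt C) \<longleftrightarrow>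
      even (A phi (gm (dsp C) phi))" if "C \<in> Ch" for C
  proof -
    have "odd (A phi (gm (dsp C) phi)) \<longleftrightarrow> ip C (\<theta> C) = 1 \<or> ip C (\<theta> C) = - 1"
      using odd_A_Rt[of phi "gm (dsp C) phi"] that by (auto simp: ip_dsp)
    then show ?thesis
      using that collinear_iff[of C "\<theta> C"] special_iff[of C "\<theta> C"] by (simp add: lrg_pos1_def pt_\<theta>) blast
  qed
  then show ?thesis unfolding polar_1_2'_kangaroo_def lrg_points_pt by (auto simp: DD_def)
qed

end

context laced_automorphism
begin

section \<open>Pure roots\<close>

definition pure :: "('a \<Rightarrow> int) \<Rightarrow> bool" where
  "pure x \<longleftrightarrow> (\<forall>w\<in>DD. even (A x (gm w x)))"

lemma pureD: "pure x \<Longrightarrow> w \<in> DD \<Longrightarrow> even (A x (gm w x))"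
  by (simp add: pure_def)

lemma gm_scl: "w \<in> carrier G \<Longrightarrow> gm w (scl k x) = scl k (gm w x)"
  by (simp add: gm_def)

lemma gm_neg_iff: "w \<in> carrier G \<Longrightarrow> x \<in> Rt \<Longrightarrow> y \<in> Rt \<Longrightarrow> gm w x = - y \<longleftrightarrow> gi w y = - x"
  using gm_eq_iff[of w x "- y"] minus_equation_iff[of "gi w y" x] by auto

lemma nonneg_neg_sum: "x \<in> Rt \<Longrightarrow> y \<in> Rt \<Longrightarrow> \<not> nonneg x \<Longrightarrow> \<not> nonneg y \<Longrightarrow> s \<in> S \<Longrightarrow> x + y \<noteq> - e s"
  using nonneg_sum_ne_e[of "- x" "- y" s] Rt_neg_iff by (metis Rt_neg minus_add_distrib add.commute add.inverse_inverse)

lemma not_nonneg_sum: "x \<in> Rt \<Longrightarrow> y \<in> Rt \<Longrightarrow> x + y \<in> Rt \<Longrightarrow> \<not> nonneg x \<Longrightarrow> \<not> nonneg y \<Longrightarrow> \<not> nonneg (x + y)"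
  using nonneg_add[of "- x" "- y"] Rt_neg_iff[of x] Rt_neg_iff[of y] Rt_neg_iff[of "x + y"]
  by (simp add: minus_add_distrib add.commute)

text \<open>Some node \<open>s\<close> contributes to the expansion of \<open>A y y\<close>. If its
  pairing with \<open>y\<close> is even, then \<open>y\<close> is \<open>e s\<close> or
  \<open>- e s\<close>, and a neighbour of \<open>s\<close> pairs oddly.\<close>

lemma odd_simple_exists: assumes "y \<in> Rt" obtains q where "q \<in> S" "odd (A y (e q))"
proof -
  have "(\<Sum>s\<in>S. y s * A (e s) y) \<noteq> 0" using assms by (simp flip: A_expand)
  then obtain s where s: "s \<in> S" "y s * A (e s) y \<noteq> 0" by (meson sum.neutral)
  show ?thesis
  proof (cases "odd (A (e s) y)")
    case True then show ?thesis using that s A_sym by metis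
  next
    case False
    then have "A (e s) y = 2 \<or> A (e s) y = - 2" using A_Rt_cases[of "e s" y] s assms by force
    then have y: "y = e s \<or> y = - e s"
      using A_Rt_eq_2[of "e s" y] A_Rt_eq_m2[of "e s" y] s assms by (metis Rt_e add.inverse_inverse)
    obtain r where "r \<in> S" "A (e s) (e r) = - 1" using neighbour_exists s by blast
    then show ?thesis using that[of r] y by auto
  qed
qed

text \<open>If \<open>e q\<close> pairs oddly with \<open>e s\<close>, use the hypothesis for
  \<open>e q\<close>. Otherwise take a root \<open>x\<close> pairing oddly with both, found by
  walking along the Coxeter graph; comparing the hypothesis for \<open>x\<close> and
  \<open>rf q x\<close> isolates \<open>A y (e q)\<close> modulo 2.\<close>

lemma parity_span:
  assumes s: "s \<in> S" and H: "\<And>x. x \<in> Rt \<Longrightarrow> even (A x (e s) * A x y)" and q: "q \<in> S"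
  shows "even (A y (e q))"
proof -
  have from_wit: "even (A y (e q))" if "q \<in> S" "x \<in> Rt" "odd (A x (e s))" "odd (A x (e q))" for q x
  proof (cases "odd (A (e q) (e s))")
    case True then show ?thesis using H[of "e q"] that A_sym[of y "e q"] by simp
  next
    case False
    have "odd (A (rf q x) (e s))" using False that by (simp add: rf_def)
    then have "even (A (rf q x) y)" using H[of "rf q x"] that by simp
    moreover have "even (A x y)" using H[of x] that by simp
    ultimately show ?thesis using that A_sym[of x "e q"] A_sym[of y "e q"] by (simp add: rf_def)
  qed
  have "\<exists>x\<in>Rt. odd (A x (e s)) \<and> odd (A x (e q))" using s q
  proof (induction rule: S_connected_induct)
    case 1
    obtain r where "r \<in> S" "A (e s) (e r) = - 1" using neighbour_exists s by blast
    then show ?case using A_sym[of "e r" "e s"] by (intro bexI[of _ "e r"]) auto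
  next
    case (2 q r)
    then obtain x where x: "x \<in> Rt" "odd (A x (e s))" "odd (A x (e q))" by blast
    consider "odd (A x (e r))" | "even (A x (e r))" "odd (A (e q) (e s))" | "even (A x (e r))" "even (A (e q) (e s))" by blast
    then show ?case
    proof cases
      case 3
      have "odd (A (rf q x) (e s))" "odd (A (rf q x) (e r))" using 2 3 x A_sym[of "e q" x] by (auto simp: rf_def)
      then show ?thesis using x 2 by (intro bexI[of _ "rf q x"]) auto
    next
      case 1 then show ?thesis using x by blast
    next
      case b: 2
      then show ?thesis using 2 by (intro bexI[of _ "e q"]) auto
    qed
  qed
  then show ?thesis using from_wit q by blast
qed

text \<open>Subtracting the parity conditions of two displacements that differ by one factor leaves
  \<open>A x (e s) * A x y\<close>, even for all roots \<open>x\<close>, where \<open>y\<close> is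
  \<open>gi w (e s)\<close> or \<open>gm w (e s)\<close>. Then \<open>parity_span\<close>
  contradicts \<open>odd_simple_exists\<close>.\<close>

lemma all_pure_steps:
  assumes p: "\<And>x. x \<in> Rt \<Longrightarrow> pure x" and w: "w \<in> DD" and s: "s \<in> S"
  shows "s \<otimes> w \<notin> DD" "w \<otimes> \<sigma> s \<notin> DD"
proof -
  have c: "w \<in> carrier G" using w by auto
  have contra: False if "y \<in> Rt" "\<And>x. x \<in> Rt \<Longrightarrow> even (A x (e s) * A x y)" for y
    using odd_simple_exists[OF that(1)] parity_span[OF s that(2)] by blast
  show "s \<otimes> w \<notin> DD"
  proof
    assume "s \<otimes> w \<in> DD"
    then have "even (A x (rf s (gm w x)))" "even (A x (gm w x))" if "x \<in> Rt" for x
      using pureD[OF p[OF that]] w c s by (force simp: gm_left)+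
    then have "even (A x (e s) * A x (gi w (e s)))" if "x \<in> Rt" for x
      using that A_gi[OF c, of "e s" x] A_sym[of x "gi w (e s)"] by (force simp: rf_def mult.commute)
    then show False using contra[of "gi w (e s)"] c s by simp
  qed
  show "w \<otimes> \<sigma> s \<notin> DD"
  proof
    assume "w \<otimes> \<sigma> s \<in> DD"
    then have "even (A x (gm w (rf s x)))" "even (A x (gm w x))" if "x \<in> Rt" for x
      using pureD[OF p[OF that]] w c s by (force simp: gm_right)+
    moreover have "A x (gm w (rf s x)) = A x (gm w x) - A x (e s) * A x (gm w (e s))" for x
      using c by (simp add: rf_def gm_scl A_sym[of "e s" x])
    ultimately have "even (A x (e s) * A x (gm w (e s)))" if "x \<in> Rt" for x
      using that by force
    then show False using contra[of "gm w (e s)"] c s by simp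
  qed
qed

text \<open>The only obstruction to moving an impure root \<open>x\<close> up to \<open>x + e t\<close>: on the panel both one-sided products
  occur as displacements, but the two-sided one does not.\<close>
definition stuck :: "'a \<Rightarrow> ('a \<Rightarrow> int) \<Rightarrow> 'a \<Rightarrow> bool" where
  "stuck w x t \<longleftrightarrow> \<not> nonneg (gi w (e t)) \<and> \<not> nonneg (gm w (e t)) \<and> gm w (e t) \<noteq> - e t \<and>
     t \<otimes> w \<in> DD \<and> w \<otimes> \<sigma> t \<in> DD \<and>
     odd (A x (gm w (e t))) \<and> odd (A (e t) (gm w x)) \<and> odd (A (e t) (gm w (e t)))"

text \<open>\<open>rf t\<close> exchanges \<open>x\<close> and \<open>x + e t\<close>, so a
  two-sided step would carry the odd value to a pure root. Only one branch of
  \<open>DD_down_down\<close> survives, and purity of \<open>x + e t\<close> at \<open>w\<close> and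
  at both one-sided products gives the three parities.\<close>

lemma impure_stuck:
  assumes w: "w \<in> DD" and x: "x \<in> Rt" and t: "t \<in> S" and xt: "A x (e t) = - 1"
    and p: "pure (x + e t)" and odd: "odd (A x (gm w x))"
  shows "stuck w x t"
proof -
  have c: "w \<in> carrier G" using w by auto
  define a where "a = e t"
  define d where "d = x + a"
  have A0: "A x a = - 1" "A a x = - 1" "A a a = 2" using xt t A_sym[of x] by (auto simp: a_def)
  have rd: "rf t d = x" using A0 t by (simp add: rf_def d_def flip: a_def)
  have pd: "even (A d (gm v d))" if "v \<in> DD" for v using p that by (simp add: pure_def d_def a_def)
  have "A d (gm (t \<otimes> w \<otimes> \<sigma> t) d) = A (rf t d) (gm w (rf t d))" using c t by (simp add: gm_left gm_right A_rf)
  then have no: "t \<otimes> w \<otimes> \<sigma> t \<notin> DD" using pd odd rd by metis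
  have d0: "even (A d (gm w d))" using pd w by blast
  \<comment> \<open>In the parallel cases the two mixed terms cancel modulo 2, so
    \<open>x + e t\<close> would have an odd value at \<open>w\<close> just like
    \<open>x\<close>.\<close>
  have np: "gm w a \<noteq> a" "gm w a \<noteq> - a"
  proof -
    have "A a (gm w x) = A (gi w a) x" using A_gi c by simp
    moreover have "gi w a = a" if "gm w a = a" using that gm_eq_iff[of w a a] c t by (simp add: a_def)
    moreover have "gi w a = - a" if "gm w a = - a" using that gm_neg_iff[of w a a] c t by (simp add: a_def)
    ultimately show "gm w a \<noteq> a" "gm w a \<noteq> - a" using d0 odd A0 c by (auto simp: d_def)
  qed
  have dd: "\<not> nonneg (gi w a)" "\<not> nonneg (gm w a)"
    using no DD_up_up[OF w t] DD_up_down[OF w t] DD_down_up[OF w t] np unfolding a_def by blast+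
  have both: "t \<otimes> w \<in> DD" "w \<otimes> \<sigma> t \<in> DD" using DD_down_down[OF w t] dd np no unfolding a_def by blast+
  have "A d (gm (t \<otimes> w) d) = A x (gm w d)" using c t rd by (simp add: gm_left flip: A_rf)
  then have 1: "odd (A x (gm w a))" using pd[OF both(1)] odd c by (simp add: d_def)
  have "A d (gm (w \<otimes> \<sigma> t) d) = A d (gm w x)" using c t rd by (simp add: gm_right)
  then have 2: "odd (A a (gm w x))" using pd[OF both(2)] odd by (simp add: d_def)
  have "odd (A a (gm w a))" using d0 odd 1 2 c by (simp add: d_def)
  then show ?thesis using dd np both 1 2 by (simp add: stuck_def a_def)
qed

text \<open>Expand the value of \<open>x + e t + e q\<close> at \<open>w\<close> into nine terms.
  Impurity of \<open>x\<close> and stuckness at both nodes make seven of them odd. Purity of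
  \<open>x + e q\<close> at the two one-sided products for \<open>t\<close> makes the terms mixing
  \<open>e t\<close> and \<open>e q\<close> odd as well, and a sum of nine odd numbers is
  odd.\<close>

lemma two_raising:
  assumes w: "w \<in> DD" and x: "x \<in> Rt" and t: "t \<in> S" "q \<in> S" "A (e t) (e q) = 0"
    and xt: "A x (e t) = - 1" "A x (e q) = - 1"
    and p: "pure (x + e t)" "pure (x + e q)" "pure (x + e t + e q)" and odd: "odd (A x (gm w x))"
  shows False
proof -
  have c: "w \<in> carrier G" using w by auto
  define a where "a = e t"
  define k where "k = e q"
  have st: "stuck w x t" "stuck w x q" using impure_stuck assms by blast+
  have A0: "A a x = - 1" "A a a = 2" "A a k = 0" using xt t A_sym[of x] by (auto simp: a_def k_def)
  have rk: "rf t (x + k) = x + a + k" using A0 by (simp add: rf_def algebra_simps flip: a_def)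
  have o: "t \<otimes> w \<in> DD" "w \<otimes> \<sigma> t \<in> DD" "odd (A x (gm w x))" "odd (A x (gm w a))" "odd (A a (gm w x))" "odd (A a (gm w a))"
      "odd (A x (gm w k))" "odd (A k (gm w x))" "odd (A k (gm w k))"
    using st odd by (auto simp: stuck_def a_def k_def)
  have pk: "even (A (x + k) (gm v (x + k)))" "even (A (x + a + k) (gm v (x + a + k)))" if "v \<in> DD" for v
    using p that by (auto simp: pure_def a_def k_def)
  have "A (x + k) (gm (t \<otimes> w) (x + k)) = A (x + a + k) (gm w (x + k))"
    unfolding gm_left[OF c t(1)] A_rf[OF t(1), symmetric] rk ..
  then have 1: "odd (A a (gm w k))" using pk(1)[OF o(1)] o c by simp
  have "A (x + k) (gm (w \<otimes> \<sigma> t) (x + k)) = A (x + k) (gm w (x + a + k))"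
    unfolding gm_right[OF c t(1)] rk ..
  then have 2: "odd (A k (gm w a))" using pk(1)[OF o(2)] o c by simp
  show False using pk(2)[OF w] 1 2 o c by simp
qed

lemma nonneg_sum_two: assumes "x \<in> Rt" "y \<in> Rt" "nonneg x" "nonneg y" "s \<in> S" "t \<in> S" "s \<noteq> t" "x + y = e s + e t"
  shows "x = e s \<or> x = e t"
proof -
  have eq: "x u + y u = e s u + e t u" for u using fun_cong[OF assms(8), of u] by simp
  have nn: "0 \<le> x u" "0 \<le> y u" for u using assms by (auto simp: nonneg_def)
  have out: "x u = 0" "y u = 0" if "u \<noteq> s" "u \<noteq> t" for u using eq[of u] nn[of u] that by (auto simp: e_def)
  have s1: "x s + y s = 1" "x t + y t = 1" using eq[of s] eq[of t] assms(7) by (auto simp: e_def)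
  consider "x s = 0" | "x t = 0" | "y s = 0" "y t = 0" using s1 nn[of s] nn[of t] by linarith
  then show ?thesis
  proof cases
    case 1
    then have "x u = 0" if "u \<noteq> t" for u using out(1) that by (cases "u = s") auto
    then show ?thesis using Rt_multiple[of x t] assms by blast
  next
    case 2
    then have "x u = 0" if "u \<noteq> s" for u using out(1) that by (cases "u = t") auto
    then show ?thesis using Rt_multiple[of x s] assms by blast
  next
    case 3
    then have "y u = 0" for u using out(2) by (cases "u = s"; cases "u = t") auto
    then have "y = 0" by (simp add: fun_eq_iff)
    then show ?thesis using Rt_nonzero assms by blast
  qed
qed

text \<open>The configuration of a stuck root x in a plane residue of type t, r with x orthogonal to r. Walking from
  the projection in the t-panel through an r-, a t- and an r-panel leads to a chamber where the
  higher root x + e t, or x + e t + e r, is impure.\<close>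
lemma plane_stuck_walk:
  assumes w: "w \<in> DD" and x: "x \<in> Rt" and tr: "t \<in> S" "r \<in> S" "A (e t) (e r) = - 1"
    and xt: "A x (e t) = - 1" "A x (e r) = 0"
    and p: "pure (x + e t)" "pure (x + e t + e r)" and odd: "odd (A x (gm w x))"
    and st: "stuck w x t" and b0: "even (A x (gm w (e r)))"
    and dn: "gm w (e r) = e r \<or> \<not> nonneg (gm w (e r)) \<and> \<not> nonneg (gi w (e r))"
  shows False
proof -
  have c: "w \<in> carrier G" using w by auto
  define a where "a = e t"
  define q where "q = e r"
  define d where "d = x + a"
  define u where "u = d + q"
  have tr_ne: "t \<noteq> r" using tr by auto
  have A0: "A x a = - 1" "A a x = - 1" "A a a = 2" "A q q = 2" "A a q = - 1" "A q a = - 1" "A x q = 0" "A q x = 0"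
    using xt tr A_sym[of x] A_sym[of "e r" "e t"] by (auto simp: a_def q_def)
  have R [simp]: "a \<in> Rt" "q \<in> Rt" "x \<in> Rt" "a + q \<in> Rt" "q + a \<in> Rt"
    using x tr A0 Rt_add[of a q] by (auto simp: a_def q_def add.commute)
  have rf_a: "rf t y = y - scl (A a y) a" and rf_q: "rf r y = y - scl (A q y) q" for y
    by (auto simp: rf_def a_def q_def)
  have rs [simp]: "rf t x = d" "rf t d = x" "rf r x = x" "rf t a = - a" "rf t q = q + a" "rf r a = a + q" "rf r q = - q"
      "rf r d = u" "rf r u = d" "rf t u = u"
    using A0 tr by (simp_all add: rf_a rf_q d_def u_def scl_2 algebra_simps)
  have mv: "A y (rf t z) = A (rf t y) z" "A y (rf r z) = A (rf r y) z" for y z using tr by (auto simp: A_rf)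
  have pd: "even (A d (gm v d))" "even (A u (gm v u))" if "v \<in> DD" for v
    using p that by (auto simp: pure_def d_def u_def a_def q_def)
  have na: "\<not> nonneg (gm w a)" "\<not> nonneg (gi w a)" "gm w a \<noteq> - a"
    and o: "odd (A x (gm w a))" "odd (A a (gm w x))" "odd (A a (gm w a))" "even (A x (gm w q))" "odd (A x (gm w x))"
    using st b0 odd by (auto simp: stuck_def a_def q_def)
  define h where "h = t \<otimes> w"
  have h: "h \<in> DD" "h \<in> carrier G" using st c tr by (auto simp: h_def stuck_def)
  have gmh: "gm h y = rf t (gm w y)" and gih: "gi h y = gi w (rf t y)" for y
    using c tr by (auto simp: h_def gm_left gi_left)
  have nna: "\<not> nonneg (- a)" "\<not> nonneg (- q)" and pa: "nonneg a" "nonneg q" using tr by (auto simp: a_def q_def)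
  \<comment> \<open>\<open>rf r\<close> exchanges \<open>d\<close> and \<open>u\<close>, so purity
    of \<open>d\<close> forbids this step. Four of the six branches below end by making it
    nevertheless.\<close>
  have step_r: "r \<otimes> v \<notin> DD" if "v \<in> carrier G" "odd (A u (gm v d))" for v
  proof
    assume "r \<otimes> v \<in> DD"
    then have "even (A d (gm (r \<otimes> v) d))" using pd by blast
    then show False using that tr by (simp add: gm_left mv)
  qed
  have eqv: "gi w y = z \<longleftrightarrow> gm w z = y" if "y \<in> Rt" "z \<in> Rt" for y z using gm_eq_iff[OF c that(2,1)] by auto
  show False
  proof (cases "gm w q = q")
    \<comment> \<open>With \<open>e r\<close> fixed, two steps suffice: at
      \<open>h \<sigma> r\<close> the value of \<open>u\<close> becomes the pairing of
      \<open>u\<close> with \<open>gm w d\<close>, where the term of \<open>q\<close> with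
      \<open>gm w a\<close> joins four odd terms.\<close>
    case True
    then have gq: "gi w q = q" using eqv[of q q] by simp
    have "nonneg (gm h q)" using True pa by (simp add: gmh nonneg_add)
    moreover have "\<not> nonneg (gi h q)"
    proof
      assume nn: "nonneg (gi h q)"
      have "gi h q + - gi w a = q" using gq c by (simp add: gih)
      then have "gi h q + - gi w a = e r" by (simp only: q_def)
      then show False using nonneg_sum_ne_e[of "gi h q" "- gi w a" r] nn na h c tr Rt_neg_iff[of "gi w a"] by simp
    qed
    ultimately have "h \<otimes> \<sigma> r \<in> DD" using DD_down_up[OF h(1) tr(2)] by (simp flip: q_def)
    then have "even (A u (gm (h \<otimes> \<sigma> r) u))" using pd by blast
    then have "even (A u (gm w d))" using h tr by (simp add: gm_right gmh mv)
    moreover have "A q (gm w x) = 0" "A q (gm w a) = - 1"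
      using A_gi[OF c, of q] gq A0 by (auto simp flip: A_gi[OF c])
    ultimately show False using o c by (simp add: u_def d_def)
  next
    case False
    then have nq: "\<not> nonneg (gm w q)" "\<not> nonneg (gi w q)" using dn by (auto simp: q_def)
    \<comment> \<open>The next facts control the signs along the walk: simple roots are
      indecomposable, and parities rule out coincidences in which a reflection would flip a
      sign.\<close>
    have NS: "gm w a + gm w q \<noteq> - a" "gm w a + gm w q \<noteq> - q" "gi w a + gi w q \<noteq> - a" "gi w a + gi w q \<noteq> - q"
      using nonneg_neg_sum na nq c R tr unfolding a_def q_def by (metis gm_Rt, metis gm_Rt, metis gi_Rt, metis gi_Rt)
    have X1: "gm w q \<noteq> - a" "gm w q \<noteq> - (q + a)" "gm w a \<noteq> - q"
      using o A0 by auto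
    have sumR: "gm w a + gm w q \<in> Rt" "gi w a + gi w q \<in> Rt"
      using gm_Rt[OF c R(4)] gi_Rt[OF c R(4)] unfolding gm_linear(1)[OF c] gi_linear(1)[OF c] .
    have neg_sum: "\<not> nonneg (gm w (a + q))" "\<not> nonneg (gi w (a + q))"
      using not_nonneg_sum[of "gm w a" "gm w q"] not_nonneg_sum[of "gi w a" "gi w q"] na nq c R sumR by simp_all
    have Sx: "gm w a \<noteq> - (a + q)" using gm_neg_iff[OF c, of a "a + q"] NS(3) c by simp
    have Sx2: "gm w (a + q) \<noteq> - (a + q)"
    proof
      assume "gm w (a + q) = - (a + q)"
      moreover have "- gm w a + - gm w q = - gm w (a + q)" using c by simp
      ultimately have "- gm w a + - gm w q = a + q" by simp
      then have "- gm w a + - gm w q = e t + e r" by (simp only: a_def q_def)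
      then have "- gm w a = e t \<or> - gm w a = e r"
        using nonneg_sum_two[of "- gm w a" "- gm w q" t r] na nq tr tr_ne c R Rt_neg_iff[of "gm w a"] Rt_neg_iff[of "gm w q"] by simp
      then show False using na X1 unfolding a_def q_def by (metis add.inverse_inverse)
    qed
    have rfn: "\<not> nonneg (rf t y)" if "y \<in> Rt" "\<not> nonneg y" "y \<noteq> - a" for y
      using rf_not_nonneg that tr by (simp add: a_def)
    have rfnr: "\<not> nonneg (rf r y)" if "y \<in> Rt" "\<not> nonneg y" "y \<noteq> - q" for y
      using rf_not_nonneg that tr by (simp add: q_def)
    have rfp: "nonneg (rf t y)" if "y \<in> Rt" "nonneg y" "y \<noteq> a" for y using rf_nonneg that tr by (simp add: a_def)
    have inj_t: "rf t y = z \<longleftrightarrow> y = rf t z" and inj_r: "rf r y = z \<longleftrightarrow> y = rf r z" for y z using tr by auto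
    have Rgm: "gm w a \<in> Rt" "gm w q \<in> Rt" "gm w (a + q) \<in> Rt" "gi w a \<in> Rt" "gi w q \<in> Rt" "gi w (a + q) \<in> Rt"
      by (rule gm_Rt[OF c R(1)] gm_Rt[OF c R(2)] gm_Rt[OF c R(4)] gi_Rt[OF c R(1)] gi_Rt[OF c R(2)] gi_Rt[OF c R(4)])+
    have Rtr: "rf t y \<in> Rt" "rf r y \<in> Rt" if "y \<in> Rt" for y using that tr by auto
    have hq: "\<not> nonneg (gm h q)" "\<not> nonneg (gi h q)" "gm h q \<noteq> - q"
      using rfn[of "gm w q"] nq X1 Rgm neg_sum by (simp_all add: gmh gih inj_t add.commute)
    have rta: "\<not> nonneg (rf r (rf t (gm w a)))"
      using rfnr[of "rf t (gm w a)"] rfn[of "gm w a"] na Sx Rgm Rtr by (simp add: inj_t add.commute)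
    have "r \<otimes> h \<otimes> \<sigma> r \<in> DD \<or> r \<otimes> h \<in> DD"
      using DD_down_down[OF h(1) tr(2)] hq by (auto simp flip: q_def)
    then show False
    proof
      assume k: "r \<otimes> h \<in> DD"
      define k where "k = r \<otimes> h"
      have kD: "k \<in> DD" "k \<in> carrier G" using k by (auto simp: k_def)
      have gmk: "gm k y = rf r (rf t (gm w y))" and gik: "gi k y = gi w (rf t (rf r y))" for y
        using h tr by (auto simp: k_def gm_left gi_left gmh gih)
      have ka: "\<not> nonneg (gm k a)" "\<not> nonneg (gi k a)" "gm k a \<noteq> - a"
        using rta nq X1 c by (simp_all add: gmk gik inj_t inj_r)
      have kq: "\<not> nonneg (gm k q)" "nonneg (gi k q)"
        using rfnr[of "gm h q"] hq h Rt_neg_iff[of "gi w (a + q)"] Rgm Rtr(1)[OF Rgm(2)] neg_sum c by (simp_all add: gmk gik gmh add.commute)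
      have kR: "gm k a \<in> Rt" "gm k q \<in> Rt" "gi k a \<in> Rt" "gi k q \<in> Rt" "gm k (q + a) \<in> Rt"
        by (rule gm_Rt[OF kD(2) R(1)] gm_Rt[OF kD(2) R(2)] gm_Rt[OF kD(2) R(5)] gi_Rt[OF kD(2) R(1)] gi_Rt[OF kD(2) R(2)])+
      have "gm k q + gm k a \<in> Rt" using kR(5) unfolding gm_linear(1)[OF kD(2)] .
      then have kqa: "\<not> nonneg (gm k (q + a))" using not_nonneg_sum[of "gm k q" "gm k a"] ka kq kR kD by simp
      have "t \<otimes> k \<otimes> \<sigma> t \<in> DD \<or> k \<otimes> \<sigma> t \<in> DD"
        using DD_down_down[OF kD(1) tr(1)] ka by (auto simp flip: a_def)
      then show False
      proof
        assume z: "k \<otimes> \<sigma> t \<in> DD"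
        define z where "z = k \<otimes> \<sigma> t"
        have zD: "z \<in> DD" "z \<in> carrier G" using z by (auto simp: z_def)
        have gmz: "gm z y = gm k (rf t y)" and giz: "gi z y = rf t (gi k y)" for y
          using kD tr by (auto simp: z_def gm_right gi_right)
        have "gi k q \<noteq> a" using gm_eq_iff[OF kD(2), of a q] ka(1) pa R by metis
        then have "nonneg (gi z q)" using rfp[of "gi k q"] kq kR by (simp add: giz)
        moreover have "\<not> nonneg (gm z q)" using kqa by (simp add: gmz)
        ultimately have "r \<otimes> z \<in> DD" using DD_up_down[OF zD(1) tr(2)] by (simp flip: q_def)
        \<comment> \<open>The reflections picked up on the way carry \<open>u\<close> and
          \<open>d\<close> back to \<open>x\<close>, so the odd value at \<open>w\<close>
          reappears.\<close>
        moreover have "A u (gm z d) = A x (gm w x)" by (simp add: gmz gmk mv)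
        ultimately show False using step_r[OF zD(2)] o by simp
      next
        assume z: "t \<otimes> k \<otimes> \<sigma> t \<in> DD"
        define z where "z = t \<otimes> k \<otimes> \<sigma> t"
        have zD: "z \<in> DD" "z \<in> carrier G" using z by (auto simp: z_def)
        have gmz: "gm z y = rf t (gm k (rf t y))" and giz: "gi z y = rf t (gi k (rf t y))" for y
          using kD tr by (auto simp: z_def gm_right gi_right gm_left gi_left)
        have "gi k (q + a) = - gi w a" using c by (simp add: gik)
        moreover have "- gi w a \<noteq> a" using gm_neg_iff[OF c, of a a] na minus_equation_iff[of "gi w a" a] by auto
        ultimately have "nonneg (gi z q)" using rfp[of "- gi w a"] na Rgm Rt_neg_iff[of "gi w a"] by (simp add: giz)
        moreover have "gm k (q + a) \<noteq> - a"
          using nonneg_neg_sum[of "gm k q" "gm k a" t] ka kq kR kD tr by (simp add: a_def)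
        then have "\<not> nonneg (gm z q)" using rfn[of "gm k (q + a)"] kqa kR by (simp add: gmz)
        ultimately have "r \<otimes> z \<in> DD" using DD_up_down[OF zD(1) tr(2)] by (simp flip: q_def)
        moreover have "A u (gm z d) = A x (gm w x)" by (simp add: gmz gmk mv)
        ultimately show False using step_r[OF zD(2)] o by simp
      qed
    next
      assume k: "r \<otimes> h \<otimes> \<sigma> r \<in> DD"
      define k where "k = r \<otimes> h \<otimes> \<sigma> r"
      have kD: "k \<in> DD" "k \<in> carrier G" using k by (auto simp: k_def)
      have gmk: "gm k y = rf r (rf t (gm w (rf r y)))" and gik: "gi k y = rf r (gi w (rf t (rf r y)))" for y
        using h tr by (auto simp: k_def gm_left gi_left gm_right gi_right gmh gih)
      have kR: "gm k a \<in> Rt" "gm k q \<in> Rt" "gi k a \<in> Rt" "gi k q \<in> Rt" "gm k (q + a) \<in> Rt"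
        by (rule gm_Rt[OF kD(2) R(1)] gm_Rt[OF kD(2) R(2)] gm_Rt[OF kD(2) R(5)] gi_Rt[OF kD(2) R(1)] gi_Rt[OF kD(2) R(2)])+
      show False
      proof (cases "gm w q = - q")
        \<comment> \<open>One further step to \<open>t k\<close> is enough here: the value of
          \<open>d\<close> becomes its pairing with \<open>gm w u\<close>, and the term
          \<open>A a (gm w q) = 1\<close> makes it odd.\<close>
        case True
        then have gq: "gi w q = - q" using gm_neg_iff[OF c, of q q] by simp
        have "nonneg (gi k a)" using gq pa c by (simp add: gik)
        moreover have "\<not> nonneg (gm k a)"
        proof
          assume nn: "nonneg (gm k a)"
          have "gm k a + - rf r (rf t (gm w a)) = - a" using True c by (simp add: gmk)
          moreover have "nonneg (- rf r (rf t (gm w a)))" using rta Rt_neg_iff[of "rf r (rf t (gm w a))"] Rtr Rgm by blast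
          ultimately show False using nonneg_add[OF nn] nna by metis
        qed
        ultimately have tk: "t \<otimes> k \<in> DD" using DD_up_down[OF kD(1) tr(1)] by (simp flip: a_def)
        have "A d (gm (t \<otimes> k) d) = A d (gm w u)" using kD tr by (simp add: gm_left gmk mv)
        then have "even (A d (gm w u))" using pd(1)[OF tk] by simp
        moreover have "A a (gm w q) = 1" using True A0 by simp
        ultimately show False using o c by (simp add: u_def d_def)
      next
        case nqm: False
        have gqm: "gi w q \<noteq> - q"
          using nqm gm_neg_iff[OF c, of q q] by simp
        have "\<not> nonneg (gi k a)" using rfnr[of "gi w q"] nq gqm Rgm by (simp add: gik)
        moreover have "rf t (gm w (a + q)) \<noteq> - q" "gm w (a + q) \<noteq> - a" "rf t (gm w (a + q)) \<noteq> - a - q"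
        proof -
          have m: "rf t (- q) = - (a + q)" "rf t (- a - q) = - q" using tr by (simp_all add: algebra_simps)
          have g: "gm w (a + q) \<noteq> - q" "gm w (a + q) \<noteq> - a" using NS(1,2) c by simp_all
          have n: "rf t y \<noteq> - q" "rf t y \<noteq> - a - q" if "y \<noteq> - (a + q)" "y \<noteq> - q" for y
            using that inj_t[of y "- q"] inj_t[of y "- a - q"] unfolding m by blast+
          show "rf t (gm w (a + q)) \<noteq> - q" "gm w (a + q) \<noteq> - a" "rf t (gm w (a + q)) \<noteq> - a - q"
            using n[OF Sx2 g(1)] g(2) by blast+
        qed
        then have kam: "\<not> nonneg (gm k a)" "gm k a \<noteq> - a"
          using rfnr[of "rf t (gm w (a + q))"] rfn[of "gm w (a + q)"] neg_sum Rgm Rtr by (simp_all add: gmk inj_r)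
        ultimately have "t \<otimes> k \<otimes> \<sigma> t \<in> DD \<or> k \<otimes> \<sigma> t \<in> DD"
          using DD_down_down[OF kD(1) tr(1)] by (auto simp flip: a_def)
        moreover have gkqa: "gm k (q + a) = rf r (rf t (gm w a))" using c by (simp add: gmk)
        moreover have gkq: "nonneg (gi k q)"
        proof -
          have "gi w (a + q) \<noteq> - q" using NS c by simp
          then have "\<not> nonneg (rf r (gi w (a + q)))" using rfnr neg_sum Rgm by blast
          moreover have "gi k q = - rf r (gi w (a + q))" using c by (simp add: gik add.commute)
          ultimately show ?thesis using Rt_neg_iff[of "rf r (gi w (a + q))"] Rgm Rtr by simp
        qed
        ultimately show False
        proof (elim disjE)
          assume z: "k \<otimes> \<sigma> t \<in> DD"
          define z where "z = k \<otimes> \<sigma> t"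
          have zD: "z \<in> DD" "z \<in> carrier G" using z by (auto simp: z_def)
          have gmz: "gm z y = gm k (rf t y)" and giz: "gi z y = rf t (gi k y)" for y
            using kD tr by (auto simp: z_def gm_right gi_right)
          have "gi k q \<noteq> a" using gm_eq_iff[OF kD(2), of a q] kam pa R by auto
          then have "nonneg (gi z q)" using rfp[of "gi k q"] gkq kR by (simp add: giz)
          moreover have "\<not> nonneg (gm z q)" using rta gkqa by (simp add: gmz)
          ultimately have "r \<otimes> z \<in> DD" using DD_up_down[OF zD(1) tr(2)] by (simp flip: q_def)
          moreover have "A u (gm z d) = A x (gm w x)" by (simp add: gmz gmk mv)
          ultimately show False using step_r[OF zD(2)] o by simp
        next
          assume z: "t \<otimes> k \<otimes> \<sigma> t \<in> DD"
          define z where "z = t \<otimes> k \<otimes> \<sigma> t"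
          have zD: "z \<in> DD" "z \<in> carrier G" using z by (auto simp: z_def)
          have gmz: "gm z y = rf t (gm k (rf t y))" and giz: "gi z y = rf t (gi k (rf t y))" for y
            using kD tr by (auto simp: z_def gm_right gi_right gm_left gi_left)
          have gk: "gi k (q + a) = - rf r (gi w a)" using c by (simp add: gik)
          have "gi w a \<noteq> - q" using gm_neg_iff[OF c, of q a] X1 by simp
          then have "\<not> nonneg (rf r (gi w a))" using rfnr na Rgm by blast
          moreover have "- rf r (gi w a) \<noteq> a"
          proof
            assume "- rf r (gi w a) = a"
            then have "rf r (gi w a) = - a" by (metis add.inverse_inverse)
            then have "gi w a = - (a + q)" by (simp add: inj_r)
            then have "gm w (a + q) = - a" using gm_neg_iff[OF c, of "a + q" a] by simp
            then show False using NS(1) c by simp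
          qed
          ultimately have "nonneg (gi z q)"
            using rfp[of "- rf r (gi w a)"] Rt_neg_iff[of "rf r (gi w a)"] Rgm Rtr gk by (simp add: giz del: rf_neg)
          moreover have "rf r (rf t (gm w a)) \<noteq> - a" using X1 by (simp add: inj_t inj_r)
          then have "\<not> nonneg (gm z q)" using rfn[of "rf r (rf t (gm w a))"] rta Rgm Rtr gkqa by (simp add: gmz)
          ultimately have "r \<otimes> z \<in> DD" using DD_up_down[OF zD(1) tr(2)] by (simp flip: q_def)
          moreover have "A u (gm z d) = A x (gm w x)" by (simp add: gmz gmk mv)
          ultimately show False using step_r[OF zD(2)] o by simp
        qed
      qed
    qed
  qed
qed

text \<open>\<open>rf r\<close> fixes \<open>x\<close>, so steps along \<open>r\<close>-panels
  preserve the odd value. They serve to reach the sign hypotheses of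
  \<open>plane_stuck_walk\<close>.\<close>

lemma plane_stuck:
  assumes w: "w \<in> DD" and x: "x \<in> Rt" and tr: "t \<in> S" "r \<in> S" "A (e t) (e r) = - 1"
    and xt: "A x (e t) = - 1" "A x (e r) = 0"
    and p: "pure (x + e t)" "pure (x + e t + e r)" and odd: "odd (A x (gm w x))"
  shows False
proof -
  define q where "q = e r"
  have q: "q \<in> Rt" using tr by (simp add: q_def)
  have rs: "rf r x = x" "rf r q = - q" "rf r (e t) = e t + q"
    using xt tr A_sym[of x "e r"] A_sym[of "e t" "e r"] by (simp_all add: rf_def q_def scl_2 scl_neg)
  have walk: False if "v \<in> DD" "odd (A x (gm v x))" "even (A x (gm v q))"
    "gm v q = q \<or> \<not> nonneg (gm v q) \<and> \<not> nonneg (gi v q)" for v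
    using plane_stuck_walk[OF that(1) x tr xt p that(2) impure_stuck[OF that(1) x tr(1) xt(1) p(1) that(2)]] that(3,4)
    by (simp add: q_def)
  \<comment> \<open>\<open>x\<close> is stuck before and after a step along the
    \<open>r\<close>-panel. Comparing the odd terms for \<open>e t\<close>, which
    \<open>rf r\<close> turns into \<open>e t + q\<close>, supplies the evenness that the walk
    requires.\<close>
  have generic: False if v: "v \<in> DD" "odd (A x (gm v x))" "\<not> nonneg (gm v q)" "\<not> nonneg (gi v q)" "gm v q \<noteq> - q" for v
  proof -
    have c: "v \<in> carrier G" using v by auto
    have o: "odd (A x (gm v' (e t)))" if "v' \<in> DD" "odd (A x (gm v' x))" for v'
      using impure_stuck[OF that(1) x tr(1) xt(1) p(1) that(2)] by (simp add: stuck_def)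
    have "r \<otimes> v \<otimes> \<sigma> r \<in> DD \<or> v \<otimes> \<sigma> r \<in> DD"
      using DD_down_down[OF v(1) tr(2)] v by (auto simp: q_def)
    then have "odd (A x (gm v (e t + q)))"
    proof
      assume z: "r \<otimes> v \<otimes> \<sigma> r \<in> DD"
      then show ?thesis using o[OF z] v(2) c tr rs by (simp add: gm_left gm_right flip: A_rf)
    next
      assume z: "v \<otimes> \<sigma> r \<in> DD"
      then show ?thesis using o[OF z] v(2) c tr rs by (simp add: gm_right)
    qed
    then have "even (A x (gm v q))" using o[OF v(1,2)] c by simp
    then show False using walk v by blast
  qed
  have c: "w \<in> carrier G" using w by auto
  have R: "gm w q \<in> Rt" "gi w q \<in> Rt" using c q by auto
  have x0: "A x q = 0" using xt by (simp add: q_def)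
  have gi1: "gm w q = q \<longleftrightarrow> gi w q = q" and gi2: "gm w q = - q \<longleftrightarrow> gi w q = - q"
    using gm_eq_iff[OF c q q] gm_neg_iff[OF c q q] by auto
  have nnq: "\<not> nonneg (- q)" "nonneg q" using tr by (auto simp: q_def)
  show False
  proof (cases "gm w q = q \<or> gm w q = - q")
    case True
    then show False using walk[OF w odd] x0 gi2 nnq by auto
  next
    case np: False
    have neg: "\<not> nonneg (- rf r y)" if "y \<in> Rt" "nonneg y" "y \<noteq> q" for y
      using rf_nonneg[of y r] that tr Rt_neg_iff[of "rf r y"] by (auto simp: q_def)
    have neg': "\<not> nonneg (rf r y)" if "y \<in> Rt" "\<not> nonneg y" "y \<noteq> - q" for y
      using rf_not_nonneg that tr by (simp add: q_def)
    have rfq: "rf r y = - q \<longleftrightarrow> y = q" "rf r y = q \<longleftrightarrow> y = - q" for y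
      using rs(2) tr by (metis rf_neg rf_rf add.inverse_inverse)+
    consider "nonneg (gi w q)" "nonneg (gm w q)" | "nonneg (gi w q)" "\<not> nonneg (gm w q)"
      | "\<not> nonneg (gi w q)" "nonneg (gm w q)" | "\<not> nonneg (gi w q)" "\<not> nonneg (gm w q)" by blast
    then show False
    proof cases
      case 1
      then have z: "r \<otimes> w \<otimes> \<sigma> r \<in> DD" using DD_up_up[OF w tr(2)] np by (simp flip: q_def)
      have "gm (r \<otimes> w \<otimes> \<sigma> r) q = - rf r (gm w q)" "gi (r \<otimes> w \<otimes> \<sigma> r) q = - rf r (gi w q)"
        using c tr rs by (simp_all add: gm_left gm_right gi_left gi_right)
      moreover have "odd (A x (gm (r \<otimes> w \<otimes> \<sigma> r) x))" using odd c tr rs by (simp add: gm_left gm_right flip: A_rf)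
      ultimately show False using generic[OF z] neg 1 R np gi1 rfq by simp
    next
      case 2
      then have z: "r \<otimes> w \<in> DD" using DD_up_down[OF w tr(2)] by (simp flip: q_def)
      have "gm (r \<otimes> w) q = rf r (gm w q)" "gi (r \<otimes> w) q = - gi w q"
        using c tr rs by (simp_all add: gm_left gi_left)
      moreover have "odd (A x (gm (r \<otimes> w) x))" using odd c tr rs by (simp add: gm_left flip: A_rf)
      ultimately show False using generic[OF z] neg' 2 R np rfq Rt_neg_iff[of "gi w q"] by simp
    next
      case 3
      then have z: "w \<otimes> \<sigma> r \<in> DD" using DD_down_up[OF w tr(2)] by (simp flip: q_def)
      have "gm (w \<otimes> \<sigma> r) q = - gm w q" "gi (w \<otimes> \<sigma> r) q = rf r (gi w q)"
        using c tr rs by (simp_all add: gm_right gi_right)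
      moreover have "odd (A x (gm (w \<otimes> \<sigma> r) x))" using odd c tr rs by (simp add: gm_right)
      ultimately show False using generic[OF z] neg' 3 R np gi2 Rt_neg_iff[of "gm w q"] by simp
    next
      case 4
      then show False using generic[OF w odd] np by blast
    qed
  qed
qed

subsection \<open>The root below the highest root\<close>

lemma A_gi_phi_phi: "w \<in> carrier G \<Longrightarrow> A (gi w phi) phi = A (gm w phi) phi"
  using A_gm[of w phi phi] A_sym[of phi] by simp

text \<open>\<open>gi h (e j)\<close> is positive. If \<open>gm h (e j)\<close> is negative,
  \<open>j h\<close> gives \<open>phi\<close> an odd value. Otherwise the two-sided product gives it
  the value \<open>n - 1\<close> with \<open>n = A (e j) (gm h (e j))\<close>; purity and
  \<open>phi_perp_le\<close> force \<open>n = - 1\<close>, so \<open>gm h\<close> negates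
  \<open>phi - e j\<close>, and pairing with \<open>e j\<close> is contradictory.\<close>

lemma far_zero_impossible:
  assumes p: "pure phi" and h: "h \<in> DD" and j: "j \<in> J"
    and u: "A (gm h phi) phi = 0" "A (gm h phi) (e j) = 1" "A (gi h phi) (e j) = 0"
  shows False
proof -
  have c: "h \<in> carrier G" using h by auto
  have jS: "j \<in> S" using j J_sub by auto
  have R: "gm h (e j) \<in> Rt" using c jS by simp
  have "A (gi h (e j)) phi = 1" using A_gi[OF c] u A_sym[of "e j"] by simp
  then have up: "nonneg (gi h (e j))" using A_phi_pos_nonneg c jS by simp
  have perp: "A (gm h (e j)) phi = 0" using A_gm[OF c] u A_sym[of "e j"] by simp
  then have ne: "gm h (e j) \<noteq> e j" using j by auto
  show False
  proof (cases "nonneg (gm h (e j))")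
    case True
    then have z: "j \<otimes> h \<otimes> \<sigma> j \<in> DD" using DD_up_up h jS up ne by blast
    define n where "n = A (e j) (gm h (e j))"
    have val: "A phi (gm (j \<otimes> h \<otimes> \<sigma> j) phi) = A (phi - e j) (gm h (phi - e j))"
      using c jS j by (simp add: gm_left gm_right rf_phi_J flip: A_rf)
    also have "\<dots> = n - 1" using c u perp A_sym[of phi] A_sym[of "e j" "gm h phi"] by (simp add: n_def)
    finally have "odd n" using pureD[OF p z] by simp
    moreover have "n \<le> 0" using phi_perp_le[OF True perp j] A_sym[of "e j"] by (simp add: n_def)
    ultimately have n: "n = - 1" using odd_A_Rt[of "e j" "gm h (e j)"] R jS by (auto simp: n_def)
    have r: "phi - e j \<in> Rt" using Rt_diff[of phi "e j"] j jS by simp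
    have "A (phi - e j) (gm h (phi - e j)) = - 2"
      using c u perp n A_sym[of phi] A_sym[of "e j" "gm h phi"] by (simp add: n_def)
    then have "phi - e j = - gm h (phi - e j)" using A_Rt_eq_m2[OF r gm_Rt[OF c r]] by blast
    then have "A (e j) (phi - e j) = - A (e j) (gm h (phi - e j))" by (metis A_neg2)
    then show False using c j jS u n A_sym[of "e j" "gm h phi"] by (simp add: n_def)
  next
    case False
    then have z: "j \<otimes> h \<in> DD" using DD_up_down h jS up by blast
    have "A phi (gm (j \<otimes> h) phi) = A (phi - e j) (gm h phi)"
      using c jS j by (simp add: gm_left rf_phi_J flip: A_rf)
    then show False using pureD[OF p z] u A_sym[of phi] A_sym[of "e j" "gm h phi"] by simp
  qed
qed

text \<open>A negative pairing means that \<open>s\<close> shortens on the left, so some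
  displacement with the left factor \<open>s\<close> occurs. Whether the right factor is present
  stays open; hence the alternative for \<open>gi\<close>.\<close>

lemma raise_position:
  assumes h: "h \<in> DD" and s: "s \<in> K" and neg: "A (gm h phi) (e s) < 0"
  obtains h' where "h' \<in> DD" "gm h' phi = rf s (gm h phi)" "gi h' phi = gi h phi \<or> gi h' phi = rf s (gi h phi)"
proof -
  have c: "h \<in> carrier G" and sS: "s \<in> S" using h s K_sub by auto
  have v: "A (gi h (e s)) phi < 0" using A_gi[OF c] neg A_sym[of "e s"] by simp
  then have 1: "\<not> nonneg (gi h (e s))" using A_dominant_nonneg[OF phi_dominant, of "gi h (e s)"] by auto
  have 2: "gm h (e s) \<noteq> - e s" using gm_neg_iff[OF c, of "e s" "e s"] v s sS by auto
  have "s \<otimes> h \<otimes> \<sigma> s \<in> DD \<or> s \<otimes> h \<in> DD" using DD_down_up[OF h sS 1] DD_down_down[OF h sS 1 _ 2] by blast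
  then show ?thesis
    using that[of "s \<otimes> h \<otimes> \<sigma> s"] that[of "s \<otimes> h"] c s sS by (auto simp: gm_left gm_right gi_left gi_right)
qed

text \<open>Unlike in \<open>raise_position\<close>, both images of \<open>phi\<close> are
  reflected. A positive pairing is a left ascent and gives a two-sided step; for pairing 0 the
  reflection fixes \<open>gm h phi\<close>, so a right step alone is also good enough.\<close>

lemma move_position:
  assumes h: "h \<in> DD" and s: "s \<in> K" and nn: "0 \<le> A (gm h phi) (e s)"
  obtains h' where "h' \<in> DD" "gm h' phi = rf s (gm h phi)" "gi h' phi = rf s (gi h phi)"
proof -
  note concl = that
  have c: "h \<in> carrier G" and sS: "s \<in> S" using h s K_sub by auto
  have v: "A (gi h (e s)) phi = A (gm h phi) (e s)" "A (gm h (e s)) phi = A (gi h phi) (e s)"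
    using A_gi[OF c] A_gm[OF c] A_sym[of "e s"] by simp_all
  have par: "A (gm h phi) (e s) = 0 \<and> A (gi h phi) (e s) = 0" if "gm h (e s) = e s \<or> gm h (e s) = - e s"
    using that gm_eq_iff[OF c, of "e s" "e s"] gm_neg_iff[OF c, of "e s" "e s"] v s sS by auto
  have both: thesis if "s \<otimes> h \<otimes> \<sigma> s \<in> DD"
    using that concl[of "s \<otimes> h \<otimes> \<sigma> s"] c s sS by (simp add: gm_left gm_right gi_left gi_right)
  have pos: "0 < A y phi \<Longrightarrow> y \<in> Rt \<Longrightarrow> nonneg y" and negy: "A y phi < 0 \<Longrightarrow> \<not> nonneg y" for y
    using A_phi_pos_nonneg A_dominant_nonneg[OF phi_dominant, of y] by auto
  have R: "gi h (e s) \<in> Rt" "gm h (e s) \<in> Rt" using c sS by auto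
  show thesis
  proof (cases "A (gm h phi) (e s) = 0")
    case False
    then have "nonneg (gi h (e s))" using pos v nn R by simp
    then show thesis using both DD_up_up[OF h sS] DD_up_down[OF h sS] par False by blast
  next
    case z: True
    consider "A (gi h phi) (e s) = 0" | "0 < A (gi h phi) (e s)" | "A (gi h phi) (e s) < 0" by linarith
    then show thesis
    proof cases
      case 1
      then have "rf s (gm h phi) = gm h phi" "rf s (gi h phi) = gi h phi"
        using z A_sym[of "e s"] by (simp_all add: rf_def)
      then show thesis using that[of h] h by simp
    next
      case 2
      then have "nonneg (gm h (e s))" using pos v R by simp
      then show thesis using both DD_up_up[OF h sS] DD_down_up[OF h sS] par 2 by fastforce
    next
      case 3
      then have n: "\<not> nonneg (gm h (e s))" using negy v by simp
      have np: "gm h (e s) \<noteq> - e s" using par 3 by auto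
      have "s \<otimes> h \<otimes> \<sigma> s \<in> DD \<or> h \<otimes> \<sigma> s \<in> DD" using DD_up_down[OF h sS _ n] DD_down_down[OF h sS _ n np] by blast
      then show thesis
      proof
        assume "h \<otimes> \<sigma> s \<in> DD"
        moreover have "rf s (gm h phi) = gm h phi" using z A_sym[of "e s"] by (simp add: rf_def)
        ultimately show thesis using that[of "h \<otimes> \<sigma> s"] c s sS by (simp add: gm_right gi_right)
      qed (use both in blast)
    qed
  qed
qed

text \<open>Moving the displacement along panels of \<open>K\<close> lowers the root \<open>b\<close> to a simple root in \<open>J\<close>; the last
  hypothesis is invariant and keeps every step admissible.\<close>
lemma lower_to_far:
  assumes p: "pure phi" and "h \<in> DD" "b \<in> Rt" "A b phi = 1" "A (gm h phi) phi = 0"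
    and "A (gm h phi) b = 1" "A (gi h phi) b = 0"
    and "\<And>k. k \<in> Rt \<Longrightarrow> A k phi = 0 \<Longrightarrow> 0 < A b k \<Longrightarrow> 0 \<le> A (gm h phi) k"
  shows False
  using assms(2-)
proof (induction "nat (ht b)" arbitrary: h b rule: less_induct)
  case less
  show ?case
  proof (cases "\<forall>k\<in>K. A b (e k) \<le> 0")
    case True
    then obtain j where "j \<in> J" "b = e j" using level1_antidominant less.prems by metis
    then show ?thesis using far_zero_impossible[OF p] less.prems by blast
  next
    case False
    then obtain s where s: "s \<in> K" "0 < A b (e s)" by force
    have sS: "s \<in> S" using s K_sub by auto
    then have "0 \<le> A (gm h phi) (e s)" using less.prems(7)[of "e s"] s by simp
    then obtain h' where h': "h' \<in> DD" "gm h' phi = rf s (gm h phi)" "gi h' phi = rf s (gi h phi)"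
      using move_position less.prems s by blast
    have A1: "A (rf s b) phi = 1" using less.prems s sS by (simp add: A_rf)
    have nn: "nonneg (rf s b)" using A_phi_pos_nonneg A1 less.prems sS by simp
    then have "0 \<le> ht (rf s b)" by (simp add: ht_def nonneg_def sum_nonneg)
    moreover have "ht (rf s b) < ht b" using ht_rf[OF sS, of b] s A_sym[of b] by simp
    ultimately have lt: "nat (ht (rf s b)) < nat (ht b)" by linarith
    show ?thesis
    proof (rule less.hyps[OF lt h'(1)])
      fix k assume k: "k \<in> Rt" "A k phi = 0" "0 < A (rf s b) k"
      then have "0 \<le> A (gm h phi) (rf s k)" using less.prems(7)[of "rf s k"] s sS by (simp add: A_rf)
      then show "0 \<le> A (gm h' phi) k" using h' sS by (simp add: A_rf)
    qed (use less.prems h' A1 s sS in \<open>simp_all add: A_rf\<close>)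
  qed
qed

text \<open>For such a displacement with \<open>gm h phi\<close> of maximal height,
  \<open>raise_position\<close> makes \<open>gm h phi\<close> dominant for \<open>K\<close>. This
  gives the sign hypothesis of \<open>lower_to_far\<close> for \<open>phi - e j\<close>, since the
  roots tested there are positive and supported on \<open>K\<close>.\<close>

lemma near_zero_impossible:
  assumes p: "pure phi" and j: "j \<in> J" and h: "h \<in> DD"
    and u: "A (gm h phi) phi = 0" "A (gm h phi) (e j) = - 1" "A (gi h phi) (e j) = 0"
  shows False
proof -
  define X where "X = {h \<in> DD. A (gm h phi) phi = 0 \<and> A (gm h phi) (e j) = - 1 \<and> A (gi h phi) (e j) = 0}"
  have "finite ((\<lambda>h. ht (gm h phi)) ` X)" using fin by (intro finite_imageI finite_subset[of X "carrier G"]) (auto simp: X_def)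
  moreover have "(\<lambda>h. ht (gm h phi)) ` X \<noteq> {}" using u h by (auto simp: X_def)
  ultimately obtain h where hX: "h \<in> X" and max: "\<And>h'. h' \<in> X \<Longrightarrow> ht (gm h' phi) \<le> ht (gm h phi)"
    using Max_in Max_ge by (smt (verit) imageE imageI)
  define u where "u = gm h phi"
  have h: "h \<in> DD" "A u phi = 0" "A u (e j) = - 1" "A (gi h phi) (e j) = 0" using hX by (auto simp: X_def u_def)
  have c: "h \<in> carrier G" and jS: "j \<in> S" using h j J_sub by auto
  have uR: "u \<in> Rt" using c by (simp add: u_def)
  have dom: "0 \<le> A u (e s)" if s: "s \<in> K" for s
  proof (rule ccontr)
    assume "\<not> ?thesis"
    then have neg: "A u (e s) < 0" by simp
    have sS: "s \<in> S" "s \<noteq> j" using s j K_sub by (auto simp: K_def)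
    have "A u (e s) \<noteq> - 2"
      using A_Rt_eq_m2[OF uR, of "e s"] h A_e_le[of s j] sS jS by auto
    then have m1: "A u (e s) = - 1" using neg A_Rt_ge[OF uR, of "e s"] sS by simp
    have sj: "A (e s) (e j) = 0"
    proof (rule ccontr)
      assume "A (e s) (e j) \<noteq> 0"
      then have "A (e s) (e j) = - 1" using sS jS by (auto simp: A_ee cart_def split: if_splits)
      then have "A (u + e s) (e j) = - 2" using h by simp
      then have "u + e s = - e j" using A_Rt_eq_m2[of "u + e s" "e j"] Rt_add[OF uR, of "e s"] m1 sS jS by simp
      then have "A (u + e s) phi = - 1" using j by simp
      then show False using h s by simp
    qed
    obtain h' where h': "h' \<in> DD" "gm h' phi = rf s u" "gi h' phi = gi h phi \<or> gi h' phi = rf s (gi h phi)"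
      using raise_position[OF h(1) s] neg by (auto simp: u_def)
    have rfj: "rf s (e j) = e j" using sj by (simp add: rf_def)
    have "h' \<in> X" using h' h s sS rfj by (auto simp: X_def A_rf)
    then show False using max[of h'] h' ht_rf[of s u] sS neg A_sym[of u "e s"] by (simp flip: u_def)
  qed
  have b: "phi - e j \<in> Rt" "A (phi - e j) phi = 1" using Rt_diff[of phi "e j"] j jS by auto
  show False
  proof (rule lower_to_far[OF p h(1) b])
    fix k assume k: "k \<in> Rt" "A k phi = 0" "0 < A (phi - e j) k"
    then have kj: "A k (e j) < 0" using A_sym[of phi k] A_sym[of "e j" k] by simp
    then have "nonneg k" using phi_perp_neg_ge[of k j] k j Rt_neg_iff[of k] by fastforce
    then have "A k u = (\<Sum>i\<in>K. k i * A (e i) u)" using phi_perp_K_sum k by blast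
    also have "\<dots> \<ge> 0" using dom \<open>nonneg k\<close> by (intro sum_nonneg mult_nonneg_nonneg) (auto simp: nonneg_def A_sym[of _ u])
    finally show "0 \<le> A (gm h phi) k" using A_sym[of k u] by (simp add: u_def)
  qed (use h A_gi_phi_phi[OF c] in \<open>auto simp: u_def\<close>)
qed

text \<open>Parities make \<open>phi\<close> and \<open>e j\<close> orthogonal to the image of
  \<open>phi\<close>, and \<open>phi\<close> orthogonal to the image of \<open>e j\<close>; the
  values 2 and -2 would force equality up to sign. Stuckness provides the displacement
  \<open>w \<sigma> j\<close>, which is in one of the two configurations just excluded.\<close>

lemma below_phi_stuck_impossible:
  assumes p: "pure phi" and w: "w \<in> DD" and j: "j \<in> J" and st: "stuck w (phi - e j) j"
    and odd: "odd (A (phi - e j) (gm w (phi - e j)))"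
  shows False
proof -
  have c: "w \<in> carrier G" and jS: "j \<in> S" using w j J_sub by auto
  define a where "a = e j"
  define v where "v = gm w phi"
  define y where "y = gm w a"
  have R: "a \<in> Rt" "v \<in> Rt" "y \<in> Rt" using c jS by (auto simp: a_def v_def y_def)
  have vy: "A v y = 1" "A y v = 1" and pa: "A phi a = 1" "A a phi = 1" using c j by (auto simp: v_def y_def a_def)
  have o: "odd (A (phi - a) (v - y))" "odd (A (phi - a) y)" "odd (A a (v - y))" "odd (A a y)"
    using st odd c by (auto simp: stuck_def v_def y_def a_def)
  have e: "even (A phi v)" using pureD[OF p w] by (simp add: v_def)
  have av: "A a v = 0"
  proof (cases rule: A_Rt_cases[OF R(1,2)])
    case 1 then show ?thesis using e pa by auto
  next
    case 5 then have "v = - a" by simp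
    then show ?thesis using e pa by auto
  qed (use o in auto)
  have pv: "A phi v = 0"
  proof (cases rule: A_Rt_cases[OF phi_Rt R(2)])
    case 1 then show ?thesis using av pa by auto
  next
    case 5 then have "v = - phi" by simp
    then show ?thesis using av pa by auto
  qed (use e in auto)
  have py: "A phi y = 0"
  proof (cases rule: A_Rt_cases[OF phi_Rt R(3)])
    case 1 then show ?thesis using pv vy by auto
  next
    case 5 then have "y = - phi" by simp
    then show ?thesis using pv vy by auto
  qed (use o in auto)
  define h where "h = w \<otimes> \<sigma> j"
  have h: "h \<in> DD" using st by (simp add: h_def stuck_def)
  have gmh: "gm h phi = v - y" using c j jS by (simp add: h_def gm_right rf_phi_J v_def y_def a_def)
  have "A (gi w phi) a = 0" using A_gi[OF c] py by (simp add: y_def)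
  then have gih: "A (gi h phi) a = 0" using c jS A_sym[of "gi w phi"] by (simp add: h_def gi_right rf_def a_def)
  have 0: "A (gm h phi) phi = 0" using gmh pv py A_sym[of phi] by simp
  have "A (gm h phi) a = - A a y" using gmh av A_sym[of a] by simp
  then have "A (gm h phi) a = 1 \<or> A (gm h phi) a = - 1" using odd_A_Rt[OF R(1,3)] o by auto
  then show False using far_zero_impossible[OF p h j] near_zero_impossible[OF p j h] 0 gih by (auto simp: a_def)
qed

theorem pure_phi_all_pure:
  assumes p: "pure phi" and x0: "x0 \<in> Rt" shows "pure x0"
proof (rule ccontr)
  assume "\<not> pure x0"
  define X where "X = {x \<in> Rt. \<not> pure x}"
  have "finite (ht ` X)" "ht ` X \<noteq> {}" using finite_Rt x0 \<open>\<not> pure x0\<close> by (auto simp: X_def)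
  then obtain x where xX: "x \<in> X" and max: "\<And>y. y \<in> X \<Longrightarrow> ht y \<le> ht x"
    using Max_in Max_ge by (smt (verit) imageE imageI)
  have x: "x \<in> Rt" "\<not> pure x" using xX by (auto simp: X_def)
  have higher: "pure y" if "y \<in> Rt" "ht x < ht y" for y using max[of y] that by (force simp: X_def)
  \<comment> \<open>\<open>- x\<close> is as impure as \<open>x\<close>, so maximal height makes
    \<open>x\<close> positive.\<close>
  have nn: "nonneg x"
  proof (rule ccontr)
    assume "\<not> nonneg x"
    then have n: "nonneg (- x)" using x Rt_neg_iff by blast
    have "x \<noteq> 0" using x Rt_nonzero by auto
    then obtain t where t: "x t \<noteq> 0" by (auto simp: fun_eq_iff)
    then have "t \<in> S" using Rt_Lat[OF x(1)] by (auto simp: Lat_def)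
    then have "0 < ht (- x)" unfolding ht_def using n t
      by (intro sum_pos2[of S t]) (auto simp: nonneg_def order_less_le)
    then have "pure (- x)" using higher[of "- x"] x by simp
    then show False using x by (auto simp: pure_def)
  qed
  obtain w where w: "w \<in> DD" "odd (A x (gm w x))" using x by (auto simp: pure_def)
  have raise: "A x (e t) = - 1" "x + e t \<in> Rt" "pure (x + e t)" if t: "t \<in> S" "A x (e t) < 0" for t
  proof -
    have "A x (e t) \<noteq> - 2" using A_Rt_eq_m2[OF x(1), of "e t"] t nn by auto
    then show 1: "A x (e t) = - 1" using A_Rt_ge[OF x(1), of "e t"] t by simp
    then show "x + e t \<in> Rt" using Rt_add x t by simp
    then show "pure (x + e t)" using higher t by simp
  qed
  have "x \<noteq> phi" using x p by auto
  then obtain t where t: "t \<in> S" "A x (e t) < 0" using raising_exists x by blast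
  note rt = raise[OF t]
  \<comment> \<open>A violating node \<open>s\<close> orthogonal to \<open>t\<close> gives two
    raising directions. One adjacent to \<open>t\<close> gives the plane configuration or makes the
    positive root \<open>x + e t\<close> equal to \<open>- e s\<close>.\<close>
  have "0 \<le> A (x + e t) (e s)" if s: "s \<in> S" for s
  proof (rule ccontr)
    assume "\<not> ?thesis"
    then have neg: "A x (e s) + A (e t) (e s) < 0" by simp
    have st: "s \<noteq> t" using neg rt t by auto
    then consider "A (e t) (e s) = 0" | "A (e t) (e s) = - 1" using s t using A_e_cases by blast
    then show False
    proof cases
      case 1
      then have "A x (e s) < 0" using neg by simp
      note rs = raise[OF s this]
      have "x + e t + e s \<in> Rt" using Rt_add[OF rt(2), of "e s"] rs 1 s by simp
      then have "pure (x + e t + e s)" using higher t s by simp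
      then show False using two_raising[OF w(1) x(1) t(1) s 1 rt(1) rs(1) rt(3) rs(3)] w by blast
    next
      case 2
      then have "A x (e s) \<le> 0" using neg by simp
      then consider "A x (e s) = 0" | "A x (e s) < 0" by linarith
      then show False
      proof cases
        case a: 1
        have "x + e t + e s \<in> Rt" using Rt_add[OF rt(2), of "e s"] a 2 s by simp
        then have "pure (x + e t + e s)" using higher t s by simp
        then show False using plane_stuck[OF w(1) x(1) t(1) s 2 rt(1) a rt(3)] w by blast
      next
        case b: 2
        then have "A (x + e t) (e s) = - 2" using raise[OF s] 2 by simp
        then have "x + e t = - e s" using A_Rt_eq_m2[OF rt(2)] s by simp
        moreover have "nonneg (x + e t)" using nn nonneg_add by simp
        ultimately show False using s by simp
      qed
    qed
  qed
  then have "x + e t = phi" using dominant_root_unique phi_dominant rt by (simp add: dominant_def)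
  then have xe: "x = phi - e t" by (metis add_diff_cancel_right')
  have "A (x + e t) (e t) = 1" using rt t by simp
  then have "A phi (e t) = 1" using \<open>x + e t = phi\<close> by simp
  then have tJ: "t \<in> J" unfolding J_def using t(1) A_sym[of phi "e t"] by force
  have "stuck w x t" using impure_stuck[OF w(1) x(1) t(1) rt(1) rt(3) w(2)] .
  then show False using below_phi_stuck_impossible[OF p w(1) tJ] w xe by blast
qed

section \<open>From parities back to twisted conjugacy\<close>

lemma twisted_class_step:
  assumes "w \<in> carrier G" "v \<in> twisted_conj_class G \<sigma> w" "s \<in> S" shows "s \<otimes> v \<otimes> \<sigma> s \<in> twisted_conj_class G \<sigma> w"
proof -
  obtain u where u: "u \<in> carrier G" "v = inv u \<otimes> w \<otimes> \<sigma> u" using assms by (auto simp: twisted_conj_class_def)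
  then have "s \<otimes> v \<otimes> \<sigma> s = inv (u \<otimes> s) \<otimes> w \<otimes> \<sigma> (u \<otimes> s)"
    using assms by (simp add: inv_mult_group \<sigma>_mult m_assoc)
  then show ?thesis using u assms unfolding twisted_conj_class_def by blast
qed

theorem pure_phi_uniclass: assumes p: "pure phi" shows "uniclass G Ch \<delta> \<theta> \<sigma>"
proof -
  obtain C where C: "C \<in> Ch" using bld unfolding building_def by blast
  have "dsp D \<in> twisted_conj_class G \<sigma> (dsp C)" if "gal E ws D" "dsp E \<in> twisted_conj_class G \<sigma> (dsp C)" for E ws D
    using that
  proof (induction rule: gal.induct)
    case (Cons E s F ws D)
    have F: "F \<in> Ch" using Cons gal_Ch by blast
    then have "dsp F \<in> {dsp E, s \<otimes> dsp E, dsp E \<otimes> \<sigma> s, s \<otimes> dsp E \<otimes> \<sigma> s}" using dsp_neighbour[of E F s] Cons by simp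
    moreover have "s \<otimes> dsp E \<notin> DD" "dsp E \<otimes> \<sigma> s \<notin> DD"
      using all_pure_steps[OF pure_phi_all_pure[OF p], of "dsp E" s] Cons by (auto simp: DD_def)
    moreover have "dsp F \<in> DD" using F by (auto simp: DD_def)
    ultimately have "dsp F = dsp E \<or> dsp F = s \<otimes> dsp E \<otimes> \<sigma> s" by auto
    then have "dsp F \<in> twisted_conj_class G \<sigma> (dsp C)" using twisted_class_step Cons C by auto
    then show ?case using Cons by simp
  qed simp
  moreover have "\<exists>ws. gal C ws D" if "D \<in> Ch" for D
    using reduced_exists[of "\<delta> C D"] gal_exists[of C D] C that unfolding reduced_def by (metis \<delta>_closed)
  moreover have "dsp C \<in> twisted_conj_class G \<sigma> (dsp C)"
    unfolding twisted_conj_class_def using C by (auto intro!: exI[of _ "\<one>"])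
  ultimately have "DD \<subseteq> twisted_conj_class G \<sigma> (dsp C)" unfolding DD_def by blast
  then show ?thesis unfolding uniclass_def DD_disp using C by blast
qed

end

context laced_automorphism
begin

section \<open>Uniclass automorphisms\<close>

lemma pos_factor: "0 \<le> a \<Longrightarrow> 0 < a * b \<Longrightarrow> 0 < a \<and> 0 < b" for a b :: int
  by (auto simp: zero_less_mult_iff)

lemma len_parity: "s \<in> S \<Longrightarrow> w \<in> carrier G \<Longrightarrow> even (len (s \<otimes> w)) \<longleftrightarrow> odd (len w)"
  "s \<in> S \<Longrightarrow> w \<in> carrier G \<Longrightarrow> even (len (w \<otimes> s)) \<longleftrightarrow> odd (len w)"
  using len_mult_left[of s w] len_mult_right[of s w] by (metis even_Suc)+

lemma twisted_class_parity:
  assumes "u \<in> carrier G" "w \<in> carrier G" shows "even (len (inv u \<otimes> w \<otimes> \<sigma> u)) \<longleftrightarrow> even (len w)"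
  using assms
proof (induction u arbitrary: w rule: W_induct)
  case (mult s u)
  have "inv (s \<otimes> u) \<otimes> w \<otimes> \<sigma> (s \<otimes> u) = inv u \<otimes> (s \<otimes> w \<otimes> \<sigma> s) \<otimes> \<sigma> u"
    using mult by (simp add: inv_mult_group \<sigma>_mult m_assoc)
  then show ?case using mult by (simp add: len_parity)
qed simp

lemma uniclass_no_step:
  assumes "uniclass G Ch \<delta> \<theta> \<sigma>" "w \<in> DD" "s \<in> S" shows "s \<otimes> w \<notin> DD" "w \<otimes> \<sigma> s \<notin> DD"
proof -
  obtain w0 where "w0 \<in> carrier G" "DD \<subseteq> twisted_conj_class G \<sigma> w0"
    using assms(1) unfolding uniclass_def DD_disp by blast
  then have p: "even (len v) \<longleftrightarrow> even (len w0)" if "v \<in> DD" for v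
    using that twisted_class_parity unfolding twisted_conj_class_def by blast
  show "s \<otimes> w \<notin> DD" "w \<otimes> \<sigma> s \<notin> DD"
    using p[of w] p[of "s \<otimes> w"] p[of "w \<otimes> \<sigma> s"] len_parity assms by (metis DD_carrier \<sigma>_S)+
qed

lemma act_faithful: assumes "w \<in> carrier G" "\<And>t. t \<in> S \<Longrightarrow> act w (e t) = e t" shows "w = \<one>"
proof (rule ccontr)
  assume "w \<noteq> \<one>"
  then obtain t where "t \<in> S" "len (w \<otimes> t) < len w" using right_descent_exists assms by blast
  then show False using right_ascent_iff[of w t] assms by simp
qed

lemma gm_faithful: assumes "v \<in> carrier G" "w \<in> carrier G" "\<And>x. gm v x = gm w x" shows "v = w"
proof -
  have "act (inv w \<otimes> v) (e t) = e t" if "t \<in> S" for t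
    using assms(3)[of "e (\<tau> t)"] that assms(1,2) by (simp add: gm_def act_mult)
  then have "inv w \<otimes> v = \<one>" using act_faithful assms by simp
  then show ?thesis using assms by (metis inv_closed inv_equality inv_inv)
qed

text \<open>\<open>gm w\<close> preserves the line of \<open>e s\<close>, hence commutes with
  \<open>rf s\<close>; the claim follows because the action is faithful.\<close>

lemma parallel_fixed:
  assumes w: "w \<in> carrier G" "s \<in> S" and "gm w (e s) = e s \<or> gm w (e s) = - e s"
  shows "s \<otimes> w \<otimes> \<sigma> s = w"
proof (rule gm_faithful)
  fix x
  note inv = A_gm_gm[OF w(1), of "e s" x]
  have scl: "gm w (scl k y) = scl k (gm w y)" for k y using w by (simp add: gm_def)
  have "gm w (rf s x) = rf s (gm w x)" using assms(3)
  proof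
    assume eq: "gm w (e s) = e s"
    then have "A (e s) (gm w x) = A (e s) x" using inv by (simp only:)
    then show ?thesis using eq w scl by (simp add: rf_def)
  next
    assume eq: "gm w (e s) = - e s"
    then have "A (- e s) (gm w x) = A (e s) x" using inv by (simp only:)
    then have "A (e s) (gm w x) = - A (e s) x" by simp
    then show ?thesis using eq w scl by (simp add: rf_def scl_neg) (simp add: scl_def fun_eq_iff)
  qed
  then show "gm (s \<otimes> w \<otimes> \<sigma> s) x = gm w x" using w by (simp add: gm_left gm_right)
qed (use w in auto)

context
  assumes uni: "uniclass G Ch \<delta> \<theta> \<sigma>"
begin

lemmas no_step = uniclass_no_step[OF uni]

lemma DD_step: assumes w: "w \<in> DD" and s: "s \<in> S" shows "s \<otimes> w \<otimes> \<sigma> s \<in> DD"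
proof (cases "gm w (e s) = e s \<or> gm w (e s) = - e s")
  case True then show ?thesis using parallel_fixed w s by simp
next
  case False
  then show ?thesis using DD_up_up[OF w s] DD_up_down[OF w s] DD_down_up[OF w s] DD_down_down[OF w s] no_step[OF w s] by blast
qed

lemma DD_conjugate: assumes "v \<in> carrier G" "w \<in> DD" shows "inv v \<otimes> w \<otimes> \<sigma> v \<in> DD"
  using assms
proof (induction v arbitrary: w rule: W_induct)
  case (mult s v)
  have "inv (s \<otimes> v) \<otimes> w \<otimes> \<sigma> (s \<otimes> v) = inv v \<otimes> (s \<otimes> w \<otimes> \<sigma> s) \<otimes> \<sigma> v"
    using mult by (simp add: inv_mult_group \<sigma>_mult m_assoc DD_carrier)
  then show ?case using mult DD_step by simp
qed simp

text \<open>Displacements are closed under twisted conjugation, so a configuration of roots may be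
  moved by any \<open>v\<close>, in particular onto simple roots.\<close>

lemma conjugate_obtain: assumes w: "w \<in> DD" and v: "v \<in> carrier G"
  obtains w' where "w' \<in> DD" "\<And>x. gm w' (act v x) = act v (gm w x)" "\<And>x. x \<in> Rt \<Longrightarrow> gi w' (act v x) = act v (gi w x)"
proof -
  define w' where "w' = inv (inv v) \<otimes> w \<otimes> \<sigma> (inv v)"
  have c: "w \<in> carrier G" using w by auto
  have w': "w' \<in> DD" unfolding w'_def by (rule DD_conjugate[OF inv_closed[OF v] w])
  have 1: "gm w' (act v x) = act v (gm w x)" for x
  proof -
    have "gm w' (act v x) = act v (act w (act (\<sigma> (inv v)) (sig (act v x))))"
      using c v by (simp add: w'_def gm_def act_mult)
    also have "act (\<sigma> (inv v)) (sig (act v x)) = sig (act (inv v) (act v x))" using v by (simp only: sig_act inv_closed)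
    finally show ?thesis using v by (simp add: gm_def)
  qed
  have "gi w' (act v x) = act v (gi w x)" if x: "x \<in> Rt" for x
  proof -
    have "gm w' (act v (gi w x)) = act v x" using 1[of "gi w x"] c x Rt_Lat by simp
    then show ?thesis using gm_eq_iff[of w' "act v (gi w x)" "act v x"] w' c v x by auto
  qed
  then show ?thesis using that w' 1 by blast
qed

text \<open>Among the elements making \<open>y\<close> dominant take one minimizing the absolute
  height of the image of \<open>x\<close>. Simple roots in the support of that image are orthogonal
  to the dominant vector, so their reflections keep it dominant, and one of them lowers the height
  unless the image is simple up to sign.\<close>

lemma orthogonal_simple_conjugate:
  assumes x: "x \<in> Rt" and xy: "A y x = 0"
  obtains v s where "v \<in> carrier G" "s \<in> S" "act v x = e s" "dominant (act v y)"
proof -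
  define V where "V = {v \<in> carrier G. dominant (act v y)}"
  have "finite ((\<lambda>v. \<bar>ht (act v x)\<bar>) ` V)" using fin by (intro finite_imageI finite_subset[of V "carrier G"]) (auto simp: V_def)
  moreover have "(\<lambda>v. \<bar>ht (act v x)\<bar>) ` V \<noteq> {}" using dominant_conjugate[of y] unfolding V_def by blast
  ultimately obtain v where v: "v \<in> V" and min: "\<And>u. u \<in> V \<Longrightarrow> \<bar>ht (act v x)\<bar> \<le> \<bar>ht (act u x)\<bar>"
    using Min_in Min_le by (smt (verit) imageE imageI)
  have vc: "v \<in> carrier G" "dominant (act v y)" using v by (auto simp: V_def)
  define z where "z = act v y"
  have zx: "A z (act v x) = 0" using xy vc by (simp add: z_def)
  obtain r where r: "r = act v x \<or> r = - act v x" "nonneg r" using Rt_cases[of "act v x"] vc x by auto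
  have rR: "r \<in> Rt" and zr: "A r z = 0" using r vc x zx A_sym[of z] by auto
  have orth: "A (e s) z = 0" if "s \<in> S" "0 < r s" for s
  proof -
    have "(\<Sum>s\<in>S. r s * A (e s) z) = 0" using zr by (simp add: A_expand[of r])
    then have "\<forall>s\<in>S. r s * A (e s) z = 0"
      using vc r by (subst (asm) sum_nonneg_eq_0_iff) (auto simp: nonneg_def dominant_def z_def A_sym[of "e _"])
    then show ?thesis using that by auto
  qed
  have fixz: "rf s z = z" if "s \<in> S" "0 < r s" for s using orth[OF that] by (simp add: rf_def)
  have "(\<Sum>s\<in>S. r s * A (e s) r) > 0" using rR by (simp flip: A_expand)
  then obtain s where s: "s \<in> S" "0 < r s * A (e s) r"
    by (rule sum_pos_obtain)
  moreover have "0 \<le> r s" using r(2) by (simp add: nonneg_def)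
  ultimately have s2: "0 < r s" "0 < A (e s) r" using pos_factor by blast+
  have sv: "s \<otimes> v \<in> V" using vc s fixz[OF s(1) s2(1)] by (simp add: V_def act_S_mult z_def)
  have rs: "r = e s"
  proof (rule ccontr)
    assume "r \<noteq> e s"
    then have n: "nonneg (rf s r)" using rf_nonneg rR r s by blast
    have h: "0 \<le> ht (rf s r)" "ht (rf s r) < ht r"
      using n by (simp add: ht_def nonneg_def sum_nonneg) (use s2 ht_rf[OF s(1), of r] in simp)
    have "\<bar>ht (act (s \<otimes> v) x)\<bar> = ht (rf s r)" using r vc s h by (auto simp: act_S_mult)
    moreover have "\<bar>ht (act v x)\<bar> = ht r" using r h by auto
    ultimately show False using min[OF sv] h by simp
  qed
  then consider "act v x = e s" | "act v x = - e s" using r by (metis add.inverse_inverse)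
  then show ?thesis
  proof cases
    case 1 then show ?thesis using that vc s by blast
  next
    case 2
    then have "act (s \<otimes> v) x = e s" using vc s by (simp add: act_S_mult)
    then show ?thesis using that[of "s \<otimes> v" s] sv s by (auto simp: V_def)
  qed
qed

text \<open>Otherwise some conjugate has a simple root on whose panel exactly one of the two one-sided
  multiplications shortens: the vector gm w x - gi w x separates the two images.\<close>
lemma displacement_involution: assumes w: "w \<in> DD" and x: "x \<in> Rt"
  shows "gm w x = gi w x \<or> gm w x = x \<or> gm w x = - x"
proof (rule ccontr)
  assume H: "\<not> ?thesis"
  have c: "w \<in> carrier G" using w by auto
  define b where "b = gm w x"
  define b' where "b' = gi w x"
  have R: "b \<in> Rt" "b' \<in> Rt" using c x by (auto simp: b_def b'_def)
  have ne: "A b b' < 2" using A_Rt_eq_2[OF R] A_Rt_le[OF R] H by (force simp: b_def b'_def)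
  have "A (b - b') x = 0" using A_gm[OF c, of x x] A_sym[of x "gi w x"] by (simp add: b_def b'_def)
  then obtain v s where v: "v \<in> carrier G" "s \<in> S" "act v x = e s" "dominant (act v (b - b'))"
    using orthogonal_simple_conjugate[OF x] by blast
  obtain w' where w': "w' \<in> DD" "gm w' (act v x) = act v b" "gi w' (act v x) = act v b'"
    using conjugate_obtain[OF w v(1)] x b_def b'_def by metis
  have "A (act v b) (act v (b - b')) = A b (b - b')" "A (act v b') (act v (b - b')) = A b' (b - b')"
    using v(1) by (simp_all only: A_act_act)
  \<comment> \<open>As \<open>b\<close> and \<open>b'\<close> have equal norms and differ, they lie
    on opposite sides of the hyperplane orthogonal to \<open>b - b'\<close>; dominance turns this
    into opposite signs.\<close>
  then have pos: "0 < A (act v b) (act v (b - b'))" "A (act v b') (act v (b - b')) < 0"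
    using ne R A_sym[of b' b] by auto
  have "nonneg (gm w' (e s))"
  proof (rule ccontr)
    assume "\<not> nonneg (gm w' (e s))"
    then have "nonneg (- act v b)" using w' v R Rt_neg_iff[of "act v b"] by simp
    then show False using A_dominant_nonneg[OF v(4), of "- act v b"] pos v(1) by simp
  qed
  moreover have "\<not> nonneg (gi w' (e s))" using A_dominant_nonneg[OF v(4), of "act v b'"] pos w' v by auto
  ultimately have "w' \<otimes> \<sigma> s \<in> DD" using DD_down_up[OF w'(1) v(2)] by blast
  then show False using no_step[OF w'(1) v(2)] by blast
qed

section \<open>Pairs of roots with inner product -1\<close>

lemma simple_pair_descend:
  assumes y: "y \<in> Rt" "nonneg y" and s: "s \<in> S" and sy: "A (e s) y = - 1" and ns: "\<And>t. t \<in> S \<Longrightarrow> y \<noteq> e t"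
  obtains u where "u \<in> carrier G" "nonneg (act u (e s))" "nonneg (act u y)" "ht (act u (e s)) + ht (act u y) < 1 + ht y"
proof -
  have "(\<Sum>q\<in>S. y q * A (e q) y) > 0" using y by (simp flip: A_expand)
  then obtain q where q: "q \<in> S" "0 < y q * A (e q) y"
    by (rule sum_pos_obtain)
  moreover have "0 \<le> y q" using y(2) by (simp add: nonneg_def)
  ultimately have q2: "0 < A (e q) y" using pos_factor by blast
  then have "A (e q) y = 1" using A_Rt_le[of "e q" y] A_Rt_eq_2[of "e q" y] q y ns[OF q(1)] by force
  have qs: "q \<noteq> s" using q2 sy by auto
  have rq: "rf q y = y - e q" using \<open>A (e q) y = 1\<close> by (simp add: rf_def)
  have n: "nonneg (y - e q)" using rf_nonneg[of y q] y q ns[OF q(1)] rq by simp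
  consider "A (e q) (e s) = 0" | "A (e q) (e s) = - 1" using A_e_cases q s qs by blast
  then show ?thesis
  proof cases
    case 1
    then have "act q (e s) = e s" "act q y = y - e q" using q rq by (auto simp: rf_def)
    then show ?thesis using that[of q] q s n by simp
  next
    \<comment> \<open>\<open>s q\<close> sends \<open>e s\<close> to \<open>e q\<close> and lowers
      \<open>y\<close> by \<open>e q\<close>, so the simple root stays simple while the total height
      drops.\<close>
    case 2
    then have "act (s \<otimes> q) (e s) = e q" using q s A_sym[of "e q" "e s"] by (simp add: act_S_mult) (simp add: rf_def scl_2 scl_neg)
    moreover have "act (s \<otimes> q) y = y - e q" using 2 q s sy rq A_sym[of "e q" "e s"] by (simp add: act_S_mult) (simp add: rf_def)
    ultimately show ?thesis using that[of "s \<otimes> q"] q s n by simp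
  qed
qed

text \<open>Making \<open>x + y\<close> dominant makes both roots positive, since each has inner
  product 1 with the sum. At minimal total height, a simple root from the support of the sum that
  pairs positively with it must be one of the two, and \<open>simple_pair_descend\<close> then makes
  the other simple.\<close>

lemma simple_pair_conjugate:
  assumes x: "x \<in> Rt" and y: "y \<in> Rt" and xy: "A x y = - 1"
  obtains v s t where "v \<in> carrier G" "s \<in> S" "t \<in> S" "act v x = e s" "act v y = e t"
proof -
  define V where "V = {v \<in> carrier G. nonneg (act v x) \<and> nonneg (act v y)}"
  obtain v0 where v0: "v0 \<in> carrier G" "dominant (act v0 (x + y))" using dominant_conjugate by blast
  have pos: "nonneg (act v0 z)" if z: "z \<in> Rt" "A z (x + y) = 1" for z
  proof (rule ccontr)
    assume "\<not> ?thesis"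
    then have "nonneg (- act v0 z)" using Rt_neg_iff[of "act v0 z"] v0 z by simp
    moreover have "A (act v0 z) (act v0 (x + y)) = 1" using z v0(1) by (simp only: A_act_act)
    ultimately show False using A_dominant_nonneg[OF v0(2), of "- act v0 z"] v0(1) by simp
  qed
  have "v0 \<in> V" using pos[of x] pos[of y] x y xy A_sym[of y x] v0 by (simp add: V_def)
  then have ne: "(\<lambda>v. ht (act v x) + ht (act v y)) ` V \<noteq> {}" by auto
  moreover have "finite ((\<lambda>v. ht (act v x) + ht (act v y)) ` V)"
    using fin by (intro finite_imageI finite_subset[of V "carrier G"]) (auto simp: V_def)
  ultimately obtain v where v: "v \<in> V"
    and min: "\<And>u. u \<in> V \<Longrightarrow> ht (act v x) + ht (act v y) \<le> ht (act u x) + ht (act u y)"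
    using Min_in Min_le by (smt (verit) imageE imageI)
  define x1 where "x1 = act v x"
  define y1 where "y1 = act v y"
  have vc: "v \<in> carrier G" "nonneg x1" "nonneg y1" using v by (auto simp: V_def x1_def y1_def)
  have R: "x1 \<in> Rt" "y1 \<in> Rt" and a: "A x1 y1 = - 1" using vc x y xy by (auto simp: x1_def y1_def)
  have min': "ht x1 + ht y1 \<le> ht (act u x1) + ht (act u y1)" if "u \<in> carrier G" "nonneg (act u x1)" "nonneg (act u y1)" for u
    using min[of "u \<otimes> v"] that vc by (simp add: V_def x1_def y1_def act_mult)
  have "x1 + y1 \<in> Rt" using Rt_add R a by blast
  then have "(\<Sum>q\<in>S. (x1 + y1) q * A (e q) (x1 + y1)) > 0" by (simp only: Rt_A flip: A_expand)
  then obtain q where q: "q \<in> S" "0 < (x1 + y1) q * A (e q) (x1 + y1)" by (rule sum_pos_obtain)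
  moreover have "0 \<le> (x1 + y1) q" using vc by (simp add: nonneg_def)
  ultimately have q2: "0 < A (e q) (x1 + y1)" using pos_factor by blast
  have "x1 = e q \<or> y1 = e q"
  proof (rule ccontr)
    assume "\<not> ?thesis"
    then have "nonneg (act q x1)" "nonneg (act q y1)" using rf_nonneg R vc q by auto
    then show False using min'[of q] q q2 ht_rf[of q x1] ht_rf[of q y1] by simp
  qed
  then have "(\<exists>s\<in>S. x1 = e s) \<and> (\<exists>t\<in>S. y1 = e t)"
  proof
    assume xq: "x1 = e q"
    have "\<exists>t\<in>S. y1 = e t"
    proof (rule ccontr)
      assume "\<not> ?thesis"
      then obtain u where "u \<in> carrier G" "nonneg (act u (e q))" "nonneg (act u y1)" "ht (act u (e q)) + ht (act u y1) < 1 + ht y1"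
        using simple_pair_descend[of y1 q] R vc q a xq by blast
      then show False using min'[of u] xq q by simp
    qed
    then show ?thesis using xq q by blast
  next
    assume yq: "y1 = e q"
    have "\<exists>t\<in>S. x1 = e t"
    proof (rule ccontr)
      assume "\<not> ?thesis"
      then obtain u where "u \<in> carrier G" "nonneg (act u (e q))" "nonneg (act u x1)" "ht (act u (e q)) + ht (act u x1) < 1 + ht x1"
        using simple_pair_descend[of x1 q] R vc q a yq A_sym[of x1 "e q"] by metis
      then show False using min'[of u] yq q by simp
    qed
    then show ?thesis using yq q by blast
  qed
  then show ?thesis using that vc x1_def y1_def by metis
qed

section \<open>Hexagons in a residual projective plane\<close>

lemma uniclass_neighbour:
  assumes "C \<in> Ch" "D \<in> Ch" "s \<in> S" "\<delta> C D = s" shows "dsp D = dsp C \<or> dsp D = s \<otimes> dsp C \<otimes> \<sigma> s"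
proof -
  have DD: "dsp C \<in> DD" "dsp D \<in> DD" using assms by (auto simp: DD_def)
  then have "dsp D \<noteq> s \<otimes> dsp C" "dsp D \<noteq> dsp C \<otimes> \<sigma> s" using no_step[OF DD(1) assms(3)] by metis+
  then show ?thesis using dsp_neighbour[OF assms] by blast
qed

lemma uniclass_neighbour_parallel:
  assumes "C \<in> Ch" "D \<in> Ch" "s \<in> S" "\<delta> C D = s" "gm (dsp C) (e s) = e s \<or> gm (dsp C) (e s) = - e s"
  shows "dsp D = dsp C"
  using uniclass_neighbour[OF assms(1-4)] parallel_fixed[of "dsp C" s] assms by auto

lemma uniclass_descend:
  assumes "C \<in> Ch" "s \<in> S" "\<not> nonneg (gi (dsp C) (e s))" "\<not> nonneg (gm (dsp C) (e s))" "gm (dsp C) (e s) \<noteq> - e s"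
  obtains D where "D \<in> Ch" "\<delta> C D = s" "dsp D = s \<otimes> dsp C \<otimes> \<sigma> s"
proof -
  have "dsp C \<in> DD" using assms by (auto simp: DD_def)
  from no_step[OF this assms(2)] show ?thesis
    using dsp_down_down[OF assms(1,2,3,4,5)] that unfolding DD_def by (metis imageI)
qed

text \<open>Both words are reduced expressions of the same element, so the two galleries are the
  halves of a hexagon with common ends.\<close>

lemma braid_gallery:
  assumes g: "gal C [s, t, s] D" and st: "A (e s) (e t) = - 1" shows "gal C [t, s, t] D"
proof -
  have S: "s \<in> S" "t \<in> S" using gal_S[OF g] by auto
  have b: "s \<otimes> t \<otimes> s = t \<otimes> s \<otimes> t" using A_e_minus_one(2)[OF S st] .
  have ts: "A (e t) (e s) = - 1" using st A_sym by simp
  have r1: "reduced [s]" using S len_mult_left[of s \<one>] by (simp add: reduced_def)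
  have "len s < len (t \<otimes> s)" using left_ascent_iff[of s t] S st nonneg_add[of "e t" "e s"] by (simp add: rf_def)
  then have r2: "reduced [t, s]" using r1 len_mult_left[of t s] S by (auto simp: reduced_Cons_iff)
  have "act (inv (t \<otimes> s)) (e s) = e t"
    using S st ts by (simp add: inv_mult_group act_mult) (simp add: rf_def scl_2)
  then have "len (t \<otimes> s) < len (s \<otimes> (t \<otimes> s))" using left_ascent_iff[of "t \<otimes> s" s] S by simp
  then have "reduced [s, t, s]" using r2 len_mult_left[of s "t \<otimes> s"] S by (auto simp: reduced_Cons_iff)
  then have "\<delta> C D = wprod G [s, t, s]" using gal_reduced g by blast
  also have "\<dots> = wprod G [t, s, t]" using b S by (simp add: m_assoc)
  finally show ?thesis using gal_exists[of C D "[t, s, t]"] gal_Ch[OF g] S by simp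
qed

text \<open>In a projective plane on which the displacement acts as minus the diagram automorphism, walking
  around an apartment along projections yields two adjacent chambers of the wrong displacements.\<close>
lemma no_negative_swap:
  assumes D2: "D2 \<in> Ch" and S: "s \<in> S" "t \<in> S" and st: "A (e s) (e t) = - 1"
    and g: "gm (dsp D2) (e s) = - e t" "gm (dsp D2) (e t) = - e s"
  shows False
proof -
  define w2 where "w2 = dsp D2"
  have c: "w2 \<in> carrier G" using D2 by (simp add: w2_def)
  have ts: "A (e t) (e s) = - 1" using st A_sym by simp
  have ne: "s \<noteq> t" using st S by auto
  have ne': "e s \<noteq> e t" "e t \<noteq> e s" using ne by (auto simp: e_def fun_eq_iff)
  have gm2: "gm w2 (e s) = - e t" "gm w2 (e t) = - e s" using g by (auto simp: w2_def)
  have gi2: "gi w2 (e s) = - e t" "gi w2 (e t) = - e s"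
    using gm_eq_iff[OF c, of "- e t" "e s"] gm_eq_iff[OF c, of "- e s" "e t"] gm2 c S by auto
  have rs [simp]: "rf s (e t) = e t + e s" "rf t (e s) = e s + e t" using st ts by (auto simp: rf_def)
  have desc: "\<exists>E\<in>Ch. \<delta> D E = q \<and> dsp E = q \<otimes> w2 \<otimes> \<sigma> q" if D: "D \<in> Ch" "dsp D = w2" "q = s \<or> q = t" for D q
  proof -
    obtain E where "E \<in> Ch" "\<delta> D E = q" "dsp E = q \<otimes> dsp D \<otimes> \<sigma> q"
      by (rule uniclass_descend[of D q]) (use D gm2 gi2 S ne' in auto)
    then show ?thesis using D by auto
  qed
  define w1 where "w1 = t \<otimes> w2 \<otimes> \<sigma> t"
  have gm1: "gm w1 (e s) = - e s" "gm w1 (e t) = e s + e t" and gi1: "gi w1 (e t) = e s + e t"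
    using c S gm2 gi2 by (simp_all add: w1_def gm_left gm_right gi_left gi_right)
  obtain D1 where D1: "D1 \<in> Ch" "\<delta> D2 D1 = t" "dsp D1 = w1" using desc[of D2 t] D2 by (auto simp: w1_def w2_def)
  define y where "y = s \<otimes> w2 \<otimes> \<sigma> s"
  have gmy: "gm y (e s) = e t + e s" "gi y (e s) = e t + e s"
    using c S gm2 gi2 by (simp_all add: y_def gm_left gm_right gi_left gi_right)
  obtain D0 where D0: "D0 \<in> Ch" "\<delta> D2 D0 = s" "dsp D0 = y" using desc[of D2 s] D2 by (auto simp: y_def w2_def)
  \<comment> \<open>Thickness gives two chambers \<open>D2\<close> and \<open>D3\<close> of
    displacement \<open>w2\<close> in one \<open>s\<close>-panel; the hexagon is built around this
    pair.\<close>
  obtain D3 where D3: "D3 \<in> Ch" "\<delta> D0 D3 = s" "D3 \<noteq> D2" using third_chamber D0 S D2 by metis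
  have D23: "\<delta> D2 D3 = s" using adj_trans[of D0 D2 D3 s] adj_sym[of D2 D0 s] D0 D2 D3 S by metis
  have "e t + e s \<noteq> e s" using Rt_nonzero Rt_e[OF S(2)] by auto
  then have "dsp D3 = s \<otimes> y \<otimes> \<sigma> s" using dsp_up_up[of D0 D3 s] D0 D3 S gmy nonneg_add[of "e t" "e s"] by simp
  also have "\<dots> = w2" using c S by (simp add: y_def m_assoc)
  finally have d3: "dsp D3 = w2" .
  obtain D4 where D4: "D4 \<in> Ch" "\<delta> D3 D4 = t" "dsp D4 = w1" using desc[of D3 t] D3 d3 by (auto simp: w1_def)
  have "gal D1 [t, s, t] D4"
    using D1 D2 D23 D3 D4 S adj_sym[of D2 D1 t] by (auto intro!: gal.intros)
  then have "gal D1 [s, t, s] D4" using braid_gallery ts by blast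
  then obtain D5 D6 where D56: "D5 \<in> Ch" "D6 \<in> Ch" "\<delta> D1 D5 = s" "\<delta> D5 D6 = t" "\<delta> D6 D4 = s"
    by (auto elim!: gal.cases)
  \<comment> \<open>On the other half, the \<open>s\<close>-panels at \<open>D1\<close> and
    \<open>D4\<close> are parallel, so \<open>D5\<close> and \<open>D6\<close> inherit
    \<open>w1\<close>; but the \<open>t\<close>-panel between them forces \<open>w2\<close> on
    \<open>D6\<close>.\<close>
  have d5: "dsp D5 = w1" using uniclass_neighbour_parallel[of D1 D5 s] D1 D56 S gm1 by simp
  have d6: "dsp D6 = w1" using uniclass_neighbour_parallel[of D4 D6 s] adj_sym[of D6 D4 s] D4 D56 S gm1 by simp
  have "e s + e t \<noteq> e t" using Rt_nonzero Rt_e[OF S(1)] by auto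
  then have "dsp D6 = t \<otimes> w1 \<otimes> \<sigma> t" using dsp_up_up[of D5 D6 t] d5 D56 S gm1 gi1 nonneg_add[of "e s" "e t"] by simp
  also have "\<dots> = w2" using c S by (simp add: w1_def m_assoc)
  finally have "w1 = w2" using d6 by simp
  then show False using gm1 gm2 ne' by simp
qed

text \<open>In the hexagon, \<open>E\<close>, \<open>D2\<close> and \<open>D3\<close> have
  displacement \<open>a\<close>, and \<open>D4\<close> has \<open>u\<close>. On the other half
  \<open>E2\<close> has \<open>a\<close> again, while \<open>E3\<close> has
  \<open>t u \<sigma> t\<close>. As a neighbour of \<open>E2\<close>, the chamber \<open>E3\<close>
  should have \<open>a\<close> or \<open>u\<close>, but its isometry fixes \<open>e s\<close> and
  theirs do not.\<close>

lemma no_swap: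
  assumes D1: "D1 \<in> Ch" and S: "s \<in> S" "t \<in> S" and st: "A (e s) (e t) = - 1"
    and g: "gm (dsp D1) (e s) = e t" "gm (dsp D1) (e t) = e s"
  shows False
proof -
  define u where "u = dsp D1"
  have c: "u \<in> carrier G" using D1 by (simp add: u_def)
  have ts: "A (e t) (e s) = - 1" using st A_sym by simp
  have ne: "s \<noteq> t" using st S by auto
  have ne': "e s \<noteq> e t" "e t \<noteq> e s" using ne by (auto simp: e_def fun_eq_iff)
  have gmu: "gm u (e s) = e t" "gm u (e t) = e s" using g by (auto simp: u_def)
  have giu: "gi u (e s) = e t" "gi u (e t) = e s"
    using gm_eq_iff[OF c, of "e t" "e s"] gm_eq_iff[OF c, of "e s" "e t"] gmu S by auto
  have rs [simp]: "rf s (e t) = e t + e s" "rf t (e s) = e s + e t" using st ts by (auto simp: rf_def)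
  have up: "dsp D = q \<otimes> u \<otimes> \<sigma> q" if "C \<in> Ch" "D \<in> Ch" "dsp C = u" "\<delta> C D = q" "q = s \<or> q = t" for C D q
    using dsp_up_up[of C D q] that gmu giu S ne' by auto
  define a where "a = s \<otimes> u \<otimes> \<sigma> s"
  have gma: "gm a (e t) = e t" "gm a (e s) = - (e t + e s)" "gi a (e s) = - (e t + e s)"
    using c S gmu giu by (simp_all add: a_def gm_left gm_right gi_left gi_right add.commute)
  obtain D2 where D2: "D2 \<in> Ch" "\<delta> D1 D2 = s" using neighbour_chamber D1 S by blast
  obtain E where E: "E \<in> Ch" "\<delta> D1 E = s" "E \<noteq> D2" using third_chamber D1 S D2 by metis
  have d: "dsp D2 = a" "dsp E = a" using up[of D1 D2 s] up[of D1 E s] D1 D2 E by (auto simp: a_def u_def)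
  have ED2: "\<delta> E D2 = s" using adj_trans[of D1 E D2 s] D1 D2 E S by simp
  obtain D3 where D3: "D3 \<in> Ch" "\<delta> D2 D3 = t" using neighbour_chamber D2 S by blast
  have d3: "dsp D3 = a" using uniclass_neighbour_parallel[of D2 D3 t] D2 D3 S d gma by simp
  have "- (e t + e s) \<noteq> - e s" using Rt_nonzero Rt_e[OF S(2)] by auto
  moreover have "\<not> nonneg (- (e t + e s))" using Rt_neg_iff[of "e t + e s"] Rt_add[of "e t" "e s"] ts S nonneg_add[of "e t" "e s"] by simp
  ultimately obtain D4 where D4: "D4 \<in> Ch" "\<delta> D3 D4 = s" "dsp D4 = s \<otimes> a \<otimes> \<sigma> s"
    using uniclass_descend[of D3 s] D3 d3 S gma by metis
  have su: "s \<otimes> a \<otimes> \<sigma> s = u" using c S by (simp add: a_def m_assoc)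
  have "gal E [s, t, s] D4" using E ED2 D2 D3 D4 S by (auto intro!: gal.intros)
  then have "gal E [t, s, t] D4" using braid_gallery st by blast
  then obtain E2 E3 where E23: "E2 \<in> Ch" "E3 \<in> Ch" "\<delta> E E2 = t" "\<delta> E2 E3 = s" "\<delta> E3 D4 = t"
    by (auto elim!: gal.cases)
  have e2: "dsp E2 = a" using uniclass_neighbour_parallel[of E E2 t] E E23 S d gma by simp
  have e3: "dsp E3 = t \<otimes> u \<otimes> \<sigma> t" using up[of D4 E3 t] adj_sym[of E3 D4 t] D4 E23 S su by simp
  have gm3: "gm (dsp E3) (e s) = e s" using c S gmu unfolding e3 by (simp add: gm_left gm_right add.commute)
  have "dsp E3 = a \<or> dsp E3 = u" using uniclass_neighbour[of E2 E3 s] E23 S e2 su by simp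
  moreover have "- (e t + e s) \<noteq> e s" using \<open>\<not> nonneg (- (e t + e s))\<close> nonneg_e by metis
  ultimately show False using gm3 gma gmu ne' by auto
qed

theorem uniclass_pure: assumes w: "w \<in> DD" and x: "x \<in> Rt" shows "even (A x (gm w x))"
proof (rule ccontr)
  assume odd: "odd (A x (gm w x))"
  have c: "w \<in> carrier G" using w by auto
  have gR: "gm w x \<in> Rt" using c x by simp
  have "gm w x \<noteq> x" "gm w x \<noteq> - x" using odd x by auto
  then have "gm w x = gi w x" using displacement_involution[OF w x] by blast
  then have inv: "gm w (gm w x) = x" using c x Rt_Lat by simp
  \<comment> \<open>Conjugation moves \<open>x\<close> and \<open>y\<close> onto two adjacent simple
    roots, where the hexagon lemmas apply. Below, \<open>y\<close> is the image of \<open>x\<close>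
    or its negative, whichever has inner product -1 with \<open>x\<close>.\<close>
  have swap: False if v: "v \<in> carrier G" "s \<in> S" "t \<in> S" "act v x = e s" "act v y = e t"
    and y: "A x y = - 1" and g: "gm w x = y \<and> gm w y = x \<or> gm w x = - y \<and> gm w y = - x" for v s t y
  proof -
    obtain w' where w': "w' \<in> DD" "\<And>z. gm w' (act v z) = act v (gm w z)" using conjugate_obtain[OF w v(1)] by blast
    obtain C where C: "C \<in> Ch" "dsp C = w'" using w' by (auto simp: DD_def)
    have "A (act v x) (act v y) = - 1" using v(1) y by simp
    then have st: "A (e s) (e t) = - 1" using v by simp
    have "gm w' (e s) = e t \<and> gm w' (e t) = e s \<or> gm w' (e s) = - e t \<and> gm w' (e t) = - e s"
      using g w'(2)[of x] w'(2)[of y] v by auto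
    then show False using no_swap[OF C(1) v(2,3) st] no_negative_swap[OF C(1) v(2,3) st] C by auto
  qed
  consider "A x (gm w x) = - 1" | "A x (- gm w x) = - 1" using odd_A_Rt[OF x gR odd] by auto
  then show False
  proof cases
    case 1
    then show False using simple_pair_conjugate[OF x gR] swap[of _ _ _ "gm w x"] inv by metis
  next
    case 2
    moreover have "gm w (- gm w x) = - x" using inv c by simp
    ultimately show False using simple_pair_conjugate[of x "- gm w x"] x gR swap[of _ _ _ "- gm w x"]
      by (metis Rt_neg add.inverse_inverse)
  qed
qed

end

end

theorem theoremA:
  fixes G :: "('w, 'b) monoid_scheme" and S :: "'w set"
    and Ch :: "'c set" and \<delta> :: "'c \<Rightarrow> 'c \<Rightarrow> 'w"
    and \<theta> :: "'c \<Rightarrow> 'c" and \<sigma> :: "'w \<Rightarrow> 'w"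
  assumes "building G S Ch \<delta>"
    and "thick G S Ch \<delta>"
    and "spherical G S"
    and "irreducible_cox G S"
    and "simply_laced G S"
    and "card S \<ge> 2"
    and "automorphism_with_companion G S Ch \<delta> \<theta> \<sigma>"
  shows "uniclass G Ch \<delta> \<theta> \<sigma> \<longleftrightarrow> polar_1_2'_kangaroo G S Ch \<delta> \<theta>"
proof -
  have cs: "coxeter_system G S" using assms(1) by (simp add: building_def)
  then interpret group G by (simp add: coxeter_system_def)
  interpret laced_automorphism G S Ch \<delta> \<theta> \<sigma>
    using cs assms by unfold_locales (auto simp: spherical_def)
  show ?thesis
    using kangaroo_iff uniclass_pure[OF _ _ phi_Rt] pure_phi_uniclass by (auto simp: pure_def)
qed


end
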